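(* Let $k$ be a commutative ring, $H$ a Hopf algebra over $k$ and $C$ a left partial $H$-comodule coalgebra. Then the map $$\omega_0:\underline{C>\!\!\blacktriangleleft H}\to H,\qquad x>\!\!\blacktriangleleft h\mapsto\nabla(x)h,$$ where $\nabla(x)=x^{[-1]}\epsilon(x^{[0]})$, is a partial corepresentation of the Hopf algebra $H$ relative to (i.e. over) the partial cosmash coproduct $\underline{C>\!\!\blacktriangleleft H}$.
   Context: A partial left $H$-comodule coalgebra (symmetric left partial coaction) is a coalgebra $C$ with a linear map $\lambda:C\to H\otimes C$, $\lambda(c)=c^{[-1]}\otimes c^{[0]}$, such that for all $c\in C$: (LPCC1) $c^{[-1]}\otimes{c^{[0]}}_{(1)}\otimes{c^{[0]}}_{(2)}={c_{(1)}}^{[-1]}{c_{(2)}}^{[-1]}\otimes{c_{(1)}}^{[0]}\otimes{c_{(2)}}^{[0]}$; (LPCC2) $\epsilon_H(c^{[-1]})c^{[0]}=c$; (LPCC3) $c^{[-1]}\otimes c^{[0][-1]}\otimes c^{[0][0]}={c_{(1)}}^{[-1]}\epsilon_C({c_{(1)}}^{[0]}){{c_{(2)}}^{[-1]}}_{(1)}\otimes{{c_{(2)}}^{[-1]}}_{(2)}\otimes{c_{(2)}}^{[0]}={{c_{(1)}}^{[-1]}}_{(1)}{c_{(2)}}^{[-1]}\epsilon_C({c_{(2)}}^{[0]})\otimes{{c_{(1)}}^{[-1]}}_{(2)}\otimes{c_{(1)}}^{[0]}$. The partial cosmash coproduct $\underline{C>\!\!\blacktriangleleft H}$ is the $k$-submodule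 of $C\otimes H$ spanned by $x>\!\!\blacktriangleleft h=x_{(1)}\otimes{x_{(2)}}^{[-1]}\epsilon_C({x_{(2)}}^{[0]})h$; it is a coalgebra with comultiplication $\underline\Delta(x>\!\!\blacktriangleleft h)=(x_{(1)}>\!\!\blacktriangleleft{x_{(2)}}^{[-1]}h_{(1)})\otimes({x_{(2)}}^{[0]}>\!\!\blacktriangleleft h_{(2)})$ and counit $\underline\epsilon(x>\!\!\blacktriangleleft h)=\epsilon_C(x)\epsilon_H(h)$. A partial corepresentation of $H$ (antipode $S$) over a coalgebra $D$ is a linear map $\omega:D\to H$ with, for all $c\in D$: $\epsilon_H(\omega(c))=\epsilon_D(c)$; $\omega(c_{(1)})_{(1)}\otimes\omega(c_{(1)})_{(2)}S(\omega(c_{(2)}))=\omega(c_{(1)})\otimes\omega(c_{(2)})S(\omega(c_{(3)}))$; $\omega(c_{(1)})S(\omega(c_{(2)})_{(1)})\otimes\omega(c_{(2)})_{(2)}=\omega(c_{(1)})S(\omega(c_{(2)}))\otimes\omega(c_{(3)})$. *)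

theory Defs
  imports "HOL-Algebra.AbelCoset" "HOL-Algebra.Module" "HOL-Library.FuncSet"
begin

section \<open>Linear maps, spans and quotient modules\<close>

definition linear_map ::
    "('k, 'r) ring_scheme \<Rightarrow> ('k, 'a, 'm) module_scheme \<Rightarrow> ('k, 'b, 'n) module_scheme \<Rightarrow>
     ('a \<Rightarrow> 'b) \<Rightarrow> bool"
  where "linear_map R M N f \<longleftrightarrow>
    f \<in> carrier M \<rightarrow> carrier N \<and>
    (\<forall>x\<in>carrier M. \<forall>y\<in>carrier M. f (x \<oplus>\<^bsub>M\<^esub> y) = f x \<oplus>\<^bsub>N\<^esub> f y) \<and>
    (\<forall>r\<in>carrier R. \<forall>x\<in>carrier M. f (r \<odot>\<^bsub>M\<^esub> x) = r \<odot>\<^bsub>N\<^esub> f x)"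

definition regular_module :: "('k, 'r) ring_scheme \<Rightarrow> ('k, 'k) module"
  where "regular_module R =
    \<lparr>carrier = carrier R, mult = mult R, one = one R, zero = zero R, add = add R, smult = mult R\<rparr>"

definition module_span ::
    "('k, 'r) ring_scheme \<Rightarrow> ('k, 'a, 'm) module_scheme \<Rightarrow> 'a set \<Rightarrow> 'a set"
  where "module_span R M A = \<Inter>{N. submodule N R M \<and> A \<subseteq> N}"

text \<open>
  The \<open>mult\<close> and \<open>one\<close> components of a \<open>module\<close> record play no role in the locale \<open>module\<close>.
  They are left unspecified in the module constructions below.
\<close>

definition quotient_module ::
    "('k, 'a, 'm) module_scheme \<Rightarrow> 'a set \<Rightarrow> ('k, 'a set) module"
  where "quotient_module M N =
    \<lparr>carrier = a_rcosets\<^bsub>M\<^esub> N, mult = undefined, one = undefined, zero = N, add = (<+>\<^bsub>M\<^esub>),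
     smult = (\<lambda>r X. \<Union>x\<in>X. N +>\<^bsub>M\<^esub> (r \<odot>\<^bsub>M\<^esub> x))\<rparr>"

definition free_module :: "('k, 'r) ring_scheme \<Rightarrow> 'x set \<Rightarrow> ('k, 'x \<Rightarrow> 'k) module"
  where "free_module R X =
    \<lparr>carrier = {u. finite {x. u x \<noteq> \<zero>\<^bsub>R\<^esub>} \<and> {x. u x \<noteq> \<zero>\<^bsub>R\<^esub>} \<subseteq> X \<and> range u \<subseteq> carrier R},
     mult = undefined, one = undefined,
     zero = (\<lambda>x. \<zero>\<^bsub>R\<^esub>), add = (\<lambda>u v x. u x \<oplus>\<^bsub>R\<^esub> v x),
     smult = (\<lambda>r u x. r \<otimes>\<^bsub>R\<^esub> u x)\<rparr>"

definition free_gen :: "('k, 'r) ring_scheme \<Rightarrow> 'x \<Rightarrow> 'x \<Rightarrow> 'k"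
  where "free_gen R x = (\<lambda>y. if y = x then \<one>\<^bsub>R\<^esub> else \<zero>\<^bsub>R\<^esub>)"

text \<open>
  The linear map on \<open>M\<close> with prescribed values \<open>f i\<close> on a family \<open>g i\<close> (\<open>i \<in> I\<close>) that spans \<open>M\<close>.
  It is unspecified if the prescription is not well defined.
\<close>
definition linear_extension ::
    "('k, 'r) ring_scheme \<Rightarrow> ('k, 'a, 'm) module_scheme \<Rightarrow> ('k, 'b, 'n) module_scheme \<Rightarrow>
     'i set \<Rightarrow> ('i \<Rightarrow> 'a) \<Rightarrow> ('i \<Rightarrow> 'b) \<Rightarrow> 'a \<Rightarrow> 'b"
  where "linear_extension R M N I g f =
    (THE \<phi>. \<phi> \<in> extensional (carrier M) \<and> linear_map R M N \<phi> \<and> (\<forall>i\<in>I. \<phi> (g i) = f i))"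


section \<open>Tensor products\<close>

type_synonym ('k, 'a, 'b) tensor = "('a \<times> 'b \<Rightarrow> 'k) set"

definition tensor_relations ::
    "('k, 'r) ring_scheme \<Rightarrow> ('k, 'a, 'm) module_scheme \<Rightarrow> ('k, 'b, 'n) module_scheme \<Rightarrow>
     ('a \<times> 'b \<Rightarrow> 'k) set"
  where "tensor_relations R M N =
    (let F = free_module R (carrier M \<times> carrier N); e = (\<lambda>m n. free_gen R (m, n)) in
      {e (m \<oplus>\<^bsub>M\<^esub> m') n \<ominus>\<^bsub>F\<^esub> (e m n \<oplus>\<^bsub>F\<^esub> e m' n) | m m' n.
        m \<in> carrier M \<and> m' \<in> carrier M \<and> n \<in> carrier N} \<union>
      {e m (n \<oplus>\<^bsub>N\<^esub> n') \<ominus>\<^bsub>F\<^esub> (e m n \<oplus>\<^bsub>F\<^esub> e m n') | m n n'.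
        m \<in> carrier M \<and> n \<in> carrier N \<and> n' \<in> carrier N} \<union>
      {e (r \<odot>\<^bsub>M\<^esub> m) n \<ominus>\<^bsub>F\<^esub> (r \<odot>\<^bsub>F\<^esub> e m n) | r m n.
        r \<in> carrier R \<and> m \<in> carrier M \<and> n \<in> carrier N} \<union>
      {e m (r \<odot>\<^bsub>N\<^esub> n) \<ominus>\<^bsub>F\<^esub> (r \<odot>\<^bsub>F\<^esub> e m n) | r m n.
        r \<in> carrier R \<and> m \<in> carrier M \<and> n \<in> carrier N})"

definition tensor_kernel ::
    "('k, 'r) ring_scheme \<Rightarrow> ('k, 'a, 'm) module_scheme \<Rightarrow> ('k, 'b, 'n) module_scheme \<Rightarrow>
     ('a \<times> 'b \<Rightarrow> 'k) set"
  where "tensor_kernel R M N =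
    module_span R (free_module R (carrier M \<times> carrier N)) (tensor_relations R M N)"

definition tensor ::
    "('k, 'r) ring_scheme \<Rightarrow> ('k, 'a, 'm) module_scheme \<Rightarrow> ('k, 'b, 'n) module_scheme \<Rightarrow>
     ('k, ('k, 'a, 'b) tensor) module"
  where "tensor R M N =
    quotient_module (free_module R (carrier M \<times> carrier N)) (tensor_kernel R M N)"

definition pure_tensor ::
    "('k, 'r) ring_scheme \<Rightarrow> ('k, 'a, 'm) module_scheme \<Rightarrow> ('k, 'b, 'n) module_scheme \<Rightarrow>
     'a \<Rightarrow> 'b \<Rightarrow> ('k, 'a, 'b) tensor"
  where "pure_tensor R M N m n =
    tensor_kernel R M N +>\<^bsub>free_module R (carrier M \<times> carrier N)\<^esub> free_gen R (m, n)"

text \<open>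
  \<open>sweedler R P z f\<close> is the sum \<open>\<Sum>\<^sub>i f (a\<^sub>i) (b\<^sub>i) \<in> P\<close>, where \<open>z = \<Sum>\<^sub>i a\<^sub>i \<otimes> b\<^sub>i\<close>: the value at \<open>z\<close> of the linear
  map out of the tensor product that a bilinear \<open>f\<close> with values in \<open>P\<close> induces. For bilinear \<open>f\<close> the
  sum is the same for all formal sums \<open>u\<close> in the coset \<open>z\<close>. An expression in Sweedler notation is
  an iterated application, e.g. \<open>f (c\<^sub>(\<^sub>1\<^sub>)) (c\<^sub>(\<^sub>2\<^sub>))\<close> is \<open>sweedler R P (comult C c) f\<close>.
\<close>
definition sweedler ::
    "('k, 'r) ring_scheme \<Rightarrow> ('k, 'p, 'm) module_scheme \<Rightarrow> ('k, 'a, 'b) tensor \<Rightarrow>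
     ('a \<Rightarrow> 'b \<Rightarrow> 'p) \<Rightarrow> 'p"
  where "sweedler R P z f =
    (THE y. \<forall>u\<in>z. y = finsum P (\<lambda>(a, b). u (a, b) \<odot>\<^bsub>P\<^esub> f a b) {p. u p \<noteq> \<zero>\<^bsub>R\<^esub>})"


section \<open>Coalgebras and Hopf algebras\<close>

record ('k, 'a) coalg = "('k, 'a) module" +
  comult :: "'a \<Rightarrow> ('k, 'a, 'a) tensor"
  counit :: "'a \<Rightarrow> 'k"

text \<open>Coassociativity is stated in \<open>C \<otimes> (C \<otimes> C)\<close>.\<close>

locale coalgebra = module R C
  for R :: "('k, 'r) ring_scheme" and C :: "('k, 'c, 'm) coalg_scheme" +
  assumes comult_linear: "linear_map R C (tensor R C C) (comult C)"
    and counit_linear: "linear_map R C (regular_module R) (counit C)"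
    and coassoc: "c \<in> carrier C \<Longrightarrow>
      sweedler R (tensor R C (tensor R C C)) (comult C c) (\<lambda>c1 c2.
        sweedler R (tensor R C (tensor R C C)) (comult C c1) (\<lambda>c11 c12.
          pure_tensor R C (tensor R C C) c11 (pure_tensor R C C c12 c2)))
      = sweedler R (tensor R C (tensor R C C)) (comult C c) (\<lambda>c1 c2.
        sweedler R (tensor R C (tensor R C C)) (comult C c2) (\<lambda>c21 c22.
          pure_tensor R C (tensor R C C) c1 (pure_tensor R C C c21 c22)))"
    and counit_left: "c \<in> carrier C \<Longrightarrow>
      sweedler R C (comult C c) (\<lambda>c1 c2. counit C c1 \<odot>\<^bsub>C\<^esub> c2) = c"
    and counit_right: "c \<in> carrier C \<Longrightarrow>
      sweedler R C (comult C c) (\<lambda>c1 c2. counit C c2 \<odot>\<^bsub>C\<^esub> c1) = c"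

text \<open>The library locale \<open>algebra\<close> covers commutative algebras only.\<close>

locale assoc_algebra = module R A + ring A
  for R :: "('k, 'r) ring_scheme" and A :: "('k, 'a, 'm) module_scheme" +
  assumes smult_mult_left: "\<lbrakk>r \<in> carrier R; x \<in> carrier A; y \<in> carrier A\<rbrakk> \<Longrightarrow>
      (r \<odot>\<^bsub>A\<^esub> x) \<otimes>\<^bsub>A\<^esub> y = r \<odot>\<^bsub>A\<^esub> (x \<otimes>\<^bsub>A\<^esub> y)"
    and smult_mult_right: "\<lbrakk>r \<in> carrier R; x \<in> carrier A; y \<in> carrier A\<rbrakk> \<Longrightarrow>
      x \<otimes>\<^bsub>A\<^esub> (r \<odot>\<^bsub>A\<^esub> y) = r \<odot>\<^bsub>A\<^esub> (x \<otimes>\<^bsub>A\<^esub> y)"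

locale bialgebra = assoc_algebra R H + coalgebra R H
  for R :: "('k, 'r) ring_scheme" and H :: "('k, 'h, 'm) coalg_scheme" +
  assumes comult_mult: "\<lbrakk>g \<in> carrier H; h \<in> carrier H\<rbrakk> \<Longrightarrow>
      comult H (g \<otimes>\<^bsub>H\<^esub> h) =
        sweedler R (tensor R H H) (comult H g) (\<lambda>g1 g2.
          sweedler R (tensor R H H) (comult H h) (\<lambda>h1 h2.
            pure_tensor R H H (g1 \<otimes>\<^bsub>H\<^esub> h1) (g2 \<otimes>\<^bsub>H\<^esub> h2)))"
    and comult_one: "comult H \<one>\<^bsub>H\<^esub> = pure_tensor R H H \<one>\<^bsub>H\<^esub> \<one>\<^bsub>H\<^esub>"
    and counit_mult: "\<lbrakk>g \<in> carrier H; h \<in> carrier H\<rbrakk> \<Longrightarrow>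
      counit H (g \<otimes>\<^bsub>H\<^esub> h) = counit H g \<otimes>\<^bsub>R\<^esub> counit H h"
    and counit_one: "counit H \<one>\<^bsub>H\<^esub> = \<one>\<^bsub>R\<^esub>"

record ('k, 'h) hopf = "('k, 'h) coalg" +
  antipode :: "'h \<Rightarrow> 'h"

locale hopf_algebra = bialgebra R H
  for R :: "('k, 'r) ring_scheme" and H :: "('k, 'h, 'm) hopf_scheme" +
  assumes antipode_linear: "linear_map R H H (antipode H)"
    and antipode_left: "h \<in> carrier H \<Longrightarrow>
      sweedler R H (comult H h) (\<lambda>h1 h2. antipode H h1 \<otimes>\<^bsub>H\<^esub> h2) = counit H h \<odot>\<^bsub>H\<^esub> \<one>\<^bsub>H\<^esub>"
    and antipode_right: "h \<in> carrier H \<Longrightarrow>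
      sweedler R H (comult H h) (\<lambda>h1 h2. h1 \<otimes>\<^bsub>H\<^esub> antipode H h2) = counit H h \<odot>\<^bsub>H\<^esub> \<one>\<^bsub>H\<^esub>"


section \<open>Partial comodule coalgebras\<close>

locale left_partial_comodule_coalgebra = H?: hopf_algebra R H + C?: coalgebra R C
  for R :: "('k, 'r) ring_scheme" and H :: "('k, 'h, 'm) hopf_scheme"
    and C :: "('k, 'c, 'n) coalg_scheme" +
  fixes coact :: "'c \<Rightarrow> ('k, 'h, 'c) tensor"
  assumes coact_linear: "linear_map R C (tensor R H C) coact"
    and LPCC1: "c \<in> carrier C \<Longrightarrow>
      sweedler R (tensor R H (tensor R C C)) (coact c) (\<lambda>h d.
        sweedler R (tensor R H (tensor R C C)) (comult C d) (\<lambda>d1 d2.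
          pure_tensor R H (tensor R C C) h (pure_tensor R C C d1 d2)))
      = sweedler R (tensor R H (tensor R C C)) (comult C c) (\<lambda>c1 c2.
        sweedler R (tensor R H (tensor R C C)) (coact c1) (\<lambda>h d.
          sweedler R (tensor R H (tensor R C C)) (coact c2) (\<lambda>g e.
            pure_tensor R H (tensor R C C) (h \<otimes>\<^bsub>H\<^esub> g) (pure_tensor R C C d e))))"
    and LPCC2: "c \<in> carrier C \<Longrightarrow>
      sweedler R C (coact c) (\<lambda>h d. counit H h \<odot>\<^bsub>C\<^esub> d) = c"
    and LPCC3_left: "c \<in> carrier C \<Longrightarrow>
      sweedler R (tensor R H (tensor R H C)) (coact c) (\<lambda>h d.
        sweedler R (tensor R H (tensor R H C)) (coact d) (\<lambda>g e.
          pure_tensor R H (tensor R H C) h (pure_tensor R H C g e)))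
      = sweedler R (tensor R H (tensor R H C)) (comult C c) (\<lambda>c1 c2.
        sweedler R (tensor R H (tensor R H C)) (coact c1) (\<lambda>h d.
          sweedler R (tensor R H (tensor R H C)) (coact c2) (\<lambda>g e.
            sweedler R (tensor R H (tensor R H C)) (comult H g) (\<lambda>g1 g2.
              pure_tensor R H (tensor R H C) ((counit C d \<odot>\<^bsub>H\<^esub> h) \<otimes>\<^bsub>H\<^esub> g1)
                (pure_tensor R H C g2 e)))))"
    and LPCC3_right: "c \<in> carrier C \<Longrightarrow>
      sweedler R (tensor R H (tensor R H C)) (coact c) (\<lambda>h d.
        sweedler R (tensor R H (tensor R H C)) (coact d) (\<lambda>g e.
          pure_tensor R H (tensor R H C) h (pure_tensor R H C g e)))
      = sweedler R (tensor R H (tensor R H C)) (comult C c) (\<lambda>c1 c2.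
        sweedler R (tensor R H (tensor R H C)) (coact c1) (\<lambda>h d.
          sweedler R (tensor R H (tensor R H C)) (coact c2) (\<lambda>g e.
            sweedler R (tensor R H (tensor R H C)) (comult H h) (\<lambda>h1 h2.
              pure_tensor R H (tensor R H C) (h1 \<otimes>\<^bsub>H\<^esub> (counit C e \<odot>\<^bsub>H\<^esub> g))
                (pure_tensor R H C h2 d)))))"


section \<open>The partial cosmash coproduct\<close>

text \<open>\<open>nabla R H C coact x\<close> is \<open>x\<^bsup>[-1]\<^esup> \<epsilon>(x\<^bsup>[0]\<^esup>)\<close>.\<close>

definition nabla ::
    "('k, 'r) ring_scheme \<Rightarrow> ('k, 'h, 'm) hopf_scheme \<Rightarrow> ('k, 'c, 'n) coalg_scheme \<Rightarrow>
     ('c \<Rightarrow> ('k, 'h, 'c) tensor) \<Rightarrow> 'c \<Rightarrow> 'h"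
  where "nabla R H C coact x = sweedler R H (coact x) (\<lambda>h d. counit C d \<odot>\<^bsub>H\<^esub> h)"

definition cosmash_gen ::
    "('k, 'r) ring_scheme \<Rightarrow> ('k, 'h, 'm) hopf_scheme \<Rightarrow> ('k, 'c, 'n) coalg_scheme \<Rightarrow>
     ('c \<Rightarrow> ('k, 'h, 'c) tensor) \<Rightarrow> 'c \<Rightarrow> 'h \<Rightarrow> ('k, 'c, 'h) tensor"
  where "cosmash_gen R H C coact x h =
    sweedler R (tensor R C H) (comult C x) (\<lambda>x1 x2.
      pure_tensor R C H x1 (nabla R H C coact x2 \<otimes>\<^bsub>H\<^esub> h))"

definition cosmash_module ::
    "('k, 'r) ring_scheme \<Rightarrow> ('k, 'h, 'm) hopf_scheme \<Rightarrow> ('k, 'c, 'n) coalg_scheme \<Rightarrow>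
     ('c \<Rightarrow> ('k, 'h, 'c) tensor) \<Rightarrow> ('k, ('k, 'c, 'h) tensor) module"
  where "cosmash_module R H C coact =
    (tensor R C H)\<lparr>carrier := module_span R (tensor R C H)
      {cosmash_gen R H C coact x h | x h. x \<in> carrier C \<and> h \<in> carrier H}\<rparr>"

definition cosmash_comult ::
    "('k, 'r) ring_scheme \<Rightarrow> ('k, 'h, 'm) hopf_scheme \<Rightarrow> ('k, 'c, 'n) coalg_scheme \<Rightarrow>
     ('c \<Rightarrow> ('k, 'h, 'c) tensor) \<Rightarrow> ('k, 'c, 'h) tensor \<Rightarrow>
     ('k, ('k, 'c, 'h) tensor, ('k, 'c, 'h) tensor) tensor"
  where "cosmash_comult R H C coact =
    (let D = cosmash_module R H C coact; gen = cosmash_gen R H C coact; DD = tensor R D D in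
      linear_extension R D DD (carrier C \<times> carrier H) (\<lambda>(x, h). gen x h) (\<lambda>(x, h).
        sweedler R DD (comult C x) (\<lambda>x1 x2.
          sweedler R DD (coact x2) (\<lambda>g y.
            sweedler R DD (comult H h) (\<lambda>h1 h2.
              pure_tensor R D D (gen x1 (g \<otimes>\<^bsub>H\<^esub> h1)) (gen y h2))))))"

definition cosmash_counit ::
    "('k, 'r) ring_scheme \<Rightarrow> ('k, 'h, 'm) hopf_scheme \<Rightarrow> ('k, 'c, 'n) coalg_scheme \<Rightarrow>
     ('c \<Rightarrow> ('k, 'h, 'c) tensor) \<Rightarrow> ('k, 'c, 'h) tensor \<Rightarrow> 'k"
  where "cosmash_counit R H C coact =
    linear_extension R (cosmash_module R H C coact) (regular_module R) (carrier C \<times> carrier H)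
      (\<lambda>(x, h). cosmash_gen R H C coact x h) (\<lambda>(x, h). counit C x \<otimes>\<^bsub>R\<^esub> counit H h)"

definition cosmash ::
    "('k, 'r) ring_scheme \<Rightarrow> ('k, 'h, 'm) hopf_scheme \<Rightarrow> ('k, 'c, 'n) coalg_scheme \<Rightarrow>
     ('c \<Rightarrow> ('k, 'h, 'c) tensor) \<Rightarrow> ('k, ('k, 'c, 'h) tensor) coalg"
  where "cosmash R H C coact =
    module.extend (cosmash_module R H C coact)
      (coalg.fields (cosmash_comult R H C coact) (cosmash_counit R H C coact))"

definition omega0 ::
    "('k, 'r) ring_scheme \<Rightarrow> ('k, 'h, 'm) hopf_scheme \<Rightarrow> ('k, 'c, 'n) coalg_scheme \<Rightarrow>
     ('c \<Rightarrow> ('k, 'h, 'c) tensor) \<Rightarrow> ('k, 'c, 'h) tensor \<Rightarrow> 'h"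
  where "omega0 R H C coact =
    linear_extension R (cosmash R H C coact) H (carrier C \<times> carrier H)
      (\<lambda>(x, h). cosmash_gen R H C coact x h) (\<lambda>(x, h). nabla R H C coact x \<otimes>\<^bsub>H\<^esub> h)"


section \<open>Partial corepresentations\<close>

locale partial_corepresentation = H?: hopf_algebra R H + D?: coalgebra R D
  for R :: "('k, 'r) ring_scheme" and H :: "('k, 'h, 'm) hopf_scheme"
    and D :: "('k, 'd, 'n) coalg_scheme" +
  fixes \<omega> :: "'d \<Rightarrow> 'h"
  assumes linear: "linear_map R D H \<omega>"
    and counit: "c \<in> carrier D \<Longrightarrow> counit H (\<omega> c) = counit D c"
    and comult_antipode: "c \<in> carrier D \<Longrightarrow>
      sweedler R (tensor R H H) (comult D c) (\<lambda>c1 c2.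
        sweedler R (tensor R H H) (comult H (\<omega> c1)) (\<lambda>g1 g2.
          pure_tensor R H H g1 (g2 \<otimes>\<^bsub>H\<^esub> antipode H (\<omega> c2))))
      = sweedler R (tensor R H H) (comult D c) (\<lambda>c1 c'.
        sweedler R (tensor R H H) (comult D c') (\<lambda>c2 c3.
          pure_tensor R H H (\<omega> c1) (\<omega> c2 \<otimes>\<^bsub>H\<^esub> antipode H (\<omega> c3))))"
    and antipode_comult: "c \<in> carrier D \<Longrightarrow>
      sweedler R (tensor R H H) (comult D c) (\<lambda>c1 c2.
        sweedler R (tensor R H H) (comult H (\<omega> c2)) (\<lambda>g1 g2.
          pure_tensor R H H (\<omega> c1 \<otimes>\<^bsub>H\<^esub> antipode H g1) g2))
      = sweedler R (tensor R H H) (comult D c) (\<lambda>c1 c'.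
        sweedler R (tensor R H H) (comult D c') (\<lambda>c2 c3.
          pure_tensor R H H (\<omega> c1 \<otimes>\<^bsub>H\<^esub> antipode H (\<omega> c2)) (\<omega> c3)))"

end

(*
  Write N = nabla(x) = x^[-1] eps(x^[0]) for short. LPCC1 makes N idempotent under convolution,
  N(x1) N(x2) = N(x), so a bilinear map f on C x H descends to the cosmash coproduct as soon as
  f(x1, N(x2) h) = f(x, h). Applying eps to the last leg of LPCC3 gives the two expansions
    x^[-1] (x) N(x^[0])  =  N(x1) N(x2)_1 (x) N(x2)_2  =  N(x1)_1 N(x2) (x) N(x1)_2,
  and everything follows by playing one against the other: the comultiplication of the cosmash
  coproduct is well defined and coassociative, both sides of the first corepresentation axiom at
  x >< h equal x^[-1] h (x) N(x^[0]), and both sides of the second equal N(x1) (x) N(x2) h.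
*)
theory Submission
  imports Defs
begin

section \<open>Linear maps and free modules\<close>

text \<open>The ground ring is an arbitrary commutative ring and tensors are cosets of formal sums,
  so there are no bases, and a formula on generators x >< h needs a proof that it defines a map. The
  stability condition suffices for a reason: x (x) h |-> x1 (x) N(x2) h is an idempotent
  endomorphism of C (x) H with image the cosmash coproduct. A map on that image is the restriction
  of one on C (x) H, and the relations among the generators never have to be determined. Each axiom
  is an equation in some fixed tensor product. It is restated for an arbitrary target module and an
  arbitrary multilinear map, so that it can be applied under further products, antipodes and sums.
  The obstacle is the stability of the comultiplication: replacing h by N(x2) h comultiplies N(x2),
  and its second leg lands next to x^[0] itself, whereas the expansions of LPCC3 only speak about
  N(x^[0]). The missing N is created from the stability of the second generator and removed again at
  the end. In the corepresentation axioms the factor h has to be cancelled against its antipode,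
  which uses that S reverses products.\<close>

named_theorems lin
  "closure and linearity rules: as simp rules they discharge multilinearity side conditions"

lemma linear_mapI:
  assumes "\<And>x. x \<in> carrier M \<Longrightarrow> f x \<in> carrier N"
    and "\<And>x y. x \<in> carrier M \<Longrightarrow> y \<in> carrier M \<Longrightarrow> f (x \<oplus>\<^bsub>M\<^esub> y) = f x \<oplus>\<^bsub>N\<^esub> f y"
    and "\<And>r x. r \<in> carrier R \<Longrightarrow> x \<in> carrier M \<Longrightarrow> f (r \<odot>\<^bsub>M\<^esub> x) = r \<odot>\<^bsub>N\<^esub> f x"
  shows "linear_map R M N f"
  using assms by (auto simp: linear_map_def)

lemma linear_map_closed: "linear_map R M N f \<Longrightarrow> x \<in> carrier M \<Longrightarrow> f x \<in> carrier N"
  by (auto simp: linear_map_def)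

lemma linear_map_add:
  "linear_map R M N f \<Longrightarrow> x \<in> carrier M \<Longrightarrow> y \<in> carrier M \<Longrightarrow> f (x \<oplus>\<^bsub>M\<^esub> y) = f x \<oplus>\<^bsub>N\<^esub> f y"
  by (simp add: linear_map_def)

lemma linear_map_smult:
  "linear_map R M N f \<Longrightarrow> r \<in> carrier R \<Longrightarrow> x \<in> carrier M \<Longrightarrow> f (r \<odot>\<^bsub>M\<^esub> x) = r \<odot>\<^bsub>N\<^esub> f x"
  by (simp add: linear_map_def)

lemma linear_map_compose:
  "linear_map R N P g \<Longrightarrow> linear_map R M N f \<Longrightarrow> linear_map R M P (\<lambda>x. g (f x))"
  by (auto simp: linear_map_def Pi_iff)

lemma linear_map_cong:
  assumes "\<And>x. x \<in> carrier M \<Longrightarrow> f x = g x" "linear_map R M N g" "module R M"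
  shows "linear_map R M N f"
proof -
  interpret module R M by fact
  show ?thesis using assms(1,2) by (auto simp: linear_map_def)
qed

lemma linear_map_zero:
  assumes "module R M" "module R N" "linear_map R M N f"
  shows "f \<zero>\<^bsub>M\<^esub> = \<zero>\<^bsub>N\<^esub>"
proof -
  interpret M: module R M by fact
  interpret N: module R N by fact
  have "f (\<zero>\<^bsub>R\<^esub> \<odot>\<^bsub>M\<^esub> \<zero>\<^bsub>M\<^esub>) = \<zero>\<^bsub>R\<^esub> \<odot>\<^bsub>N\<^esub> f \<zero>\<^bsub>M\<^esub>"
    using assms(3) by (intro linear_map_smult) auto
  then show ?thesis using assms(3) by (simp add: linear_map_closed)
qed

lemma linear_map_neg:
  assumes "module R M" "module R N" "linear_map R M N f" "x \<in> carrier M"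
  shows "f (\<ominus>\<^bsub>M\<^esub> x) = \<ominus>\<^bsub>N\<^esub> f x"
proof -
  interpret M: module R M by fact
  interpret N: module R N by fact
  have "f (\<ominus>\<^bsub>M\<^esub> x) \<oplus>\<^bsub>N\<^esub> f x = \<zero>\<^bsub>N\<^esub>"
    using linear_map_add[OF assms(3), of "\<ominus>\<^bsub>M\<^esub> x" x] linear_map_zero[OF assms(1-3)] assms(4)
    by (simp add: M.M.l_neg)
  then show ?thesis using assms(3,4) by (simp add: N.M.minus_equality linear_map_closed)
qed

lemma linear_map_minus:
  assumes "module R M" "module R N" "linear_map R M N f" "x \<in> carrier M" "y \<in> carrier M"
  shows "f (x \<ominus>\<^bsub>M\<^esub> y) = f x \<ominus>\<^bsub>N\<^esub> f y"
proof -
  interpret M: module R M by fact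
  show ?thesis
    using assms by (simp add: a_minus_def linear_map_add linear_map_neg)
qed

lemma linear_map_id: "linear_map R M M (\<lambda>x. x)"
  by (auto simp: linear_map_def)

text \<open>Moves a module structure between records of different types that share these four
  fields, such as a submodule of \<open>tensor R C H\<close> and the extended record
  \<open>cosmash\<close>.\<close>

lemma module_cong:
  assumes "module R M" "carrier M' = carrier M" "add M' = add M" "zero M' = zero M" "smult M' = smult M"
  shows "module R M'"
proof -
  interpret M: module R M by fact
  have "abelian_group M'"
    by (rule abelian_groupI)
      (use M.M.l_neg in \<open>auto simp: assms M.M.a_ac intro!: bexI[of _ "\<ominus>\<^bsub>M\<^esub> x" for x]\<close>)
  then show ?thesis
    by (intro moduleI M.R.is_cring)
      (simp_all add: assms M.smult_l_distr M.smult_r_distr M.smult_assoc1)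
qed

lemma module_regular: "cring R \<Longrightarrow> module R (regular_module R)"
proof -
  assume "cring R"
  then interpret cring R .
  have "abelian_group (regular_module R)"
    by (rule abelian_groupI)
       (auto simp: regular_module_def a_assoc a_comm a_lcomm intro!: bexI[of _ "\<ominus>\<^bsub>R\<^esub> x" for x] l_neg)
  then show ?thesis
    by (intro moduleI is_cring) (auto simp: regular_module_def l_distr r_distr m_assoc)
qed

lemma carrier_regular_module: "carrier (regular_module R) = carrier R"
  by (simp add: regular_module_def)

lemma smult_regular_module: "smult (regular_module R) = mult R"
  by (simp add: regular_module_def)

section \<open>Free modules and their universal property\<close>

lemma free_module_coeff: "u \<in> carrier (free_module R X) \<Longrightarrow> u x \<in> carrier R"
  by (auto simp: free_module_def)

lemma free_module_support:
  "u \<in> carrier (free_module R X) \<Longrightarrow> finite {x. u x \<noteq> \<zero>\<^bsub>R\<^esub>}"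
  "u \<in> carrier (free_module R X) \<Longrightarrow> u x \<noteq> \<zero>\<^bsub>R\<^esub> \<Longrightarrow> x \<in> X"
  by (auto simp: free_module_def)

lemma free_moduleI:
  assumes "\<And>x. u x \<in> carrier R" "finite A" "\<And>x. u x \<noteq> \<zero>\<^bsub>R\<^esub> \<Longrightarrow> x \<in> A" "\<And>x. u x \<noteq> \<zero>\<^bsub>R\<^esub> \<Longrightarrow> x \<in> X"
  shows "u \<in> carrier (free_module R X)"
proof -
  have "{x. u x \<noteq> \<zero>\<^bsub>R\<^esub>} \<subseteq> A" using assms(3) by blast
  with assms show ?thesis by (auto simp: free_module_def intro: finite_subset)
qed

lemma module_free:
  assumes "cring R" shows "module R (free_module R X)"
proof -
  interpret cring R by fact
  let ?F = "free_module R X"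
  note [simp] = free_module_coeff
  have add: "(\<lambda>x. u x \<oplus>\<^bsub>R\<^esub> v x) \<in> carrier ?F" if u: "u \<in> carrier ?F" and v: "v \<in> carrier ?F" for u v
  proof (rule free_moduleI[OF _ finite_UnI[OF free_module_support(1)[OF u] free_module_support(1)[OF v]]])
    fix x assume "u x \<oplus>\<^bsub>R\<^esub> v x \<noteq> \<zero>\<^bsub>R\<^esub>"
    then have "u x \<noteq> \<zero>\<^bsub>R\<^esub> \<or> v x \<noteq> \<zero>\<^bsub>R\<^esub>" by auto
    then show "x \<in> {x. u x \<noteq> \<zero>\<^bsub>R\<^esub>} \<union> {x. v x \<noteq> \<zero>\<^bsub>R\<^esub>}" "x \<in> X"
      using free_module_support(2)[OF u] free_module_support(2)[OF v] by auto
  qed (use u v in auto)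
  have sm: "(\<lambda>x. r \<otimes>\<^bsub>R\<^esub> u x) \<in> carrier ?F" if r: "r \<in> carrier R" and u: "u \<in> carrier ?F" for r u
  proof (rule free_moduleI[OF _ free_module_support(1)[OF u]])
    fix x assume "r \<otimes>\<^bsub>R\<^esub> u x \<noteq> \<zero>\<^bsub>R\<^esub>"
    then have "u x \<noteq> \<zero>\<^bsub>R\<^esub>" using r by auto
    then show "x \<in> {x. u x \<noteq> \<zero>\<^bsub>R\<^esub>}" "x \<in> X" using free_module_support(2)[OF u] by auto
  qed (use r u in auto)
  have zero: "(\<lambda>x. \<zero>\<^bsub>R\<^esub>) \<in> carrier ?F"
    by (rule free_moduleI[of _ _ "{}"]) auto
  have ops: "add ?F = (\<lambda>u v x. u x \<oplus>\<^bsub>R\<^esub> v x)" "zero ?F = (\<lambda>x. \<zero>\<^bsub>R\<^esub>)"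
    "smult ?F = (\<lambda>r u x. r \<otimes>\<^bsub>R\<^esub> u x)"
    by (simp_all add: free_module_def)
  have ag: "abelian_group ?F"
  proof (rule abelian_groupI)
    fix u assume u: "u \<in> carrier ?F"
    \<comment> \<open>Finite support of the negative comes from closure under scalars, applied to
      -1.\<close>
    with sm[of "\<ominus>\<^bsub>R\<^esub> \<one>\<^bsub>R\<^esub>" u] show "\<exists>v\<in>carrier ?F. v \<oplus>\<^bsub>?F\<^esub> u = \<zero>\<^bsub>?F\<^esub>"
      by (intro bexI[of _ "\<lambda>x. \<ominus>\<^bsub>R\<^esub> \<one>\<^bsub>R\<^esub> \<otimes>\<^bsub>R\<^esub> u x"]) (auto simp: ops l_minus l_neg)
  qed (simp_all add: ops add zero a_assoc a_comm a_lcomm)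
  show ?thesis
    by (rule moduleI[OF assms ag]) (simp_all add: ops sm l_distr r_distr m_assoc)
qed

lemma free_gen_closed:
  assumes "cring R" "x \<in> X" shows "free_gen R x \<in> carrier (free_module R X)"
proof -
  interpret cring R by fact
  have "{y. free_gen R x y \<noteq> \<zero>\<^bsub>R\<^esub>} \<subseteq> {x}" by (auto simp: free_gen_def)
  then show ?thesis
    using assms(2) finite_subset[of _ "{x}"] by (auto simp: free_module_def free_gen_def)
qed

text \<open>Induction on a finite set containing the support, splitting off one coefficient at a
  time. The set may stick out of \<open>X\<close>; at a point outside \<open>X\<close> the
  coefficient is zero and the induction hypothesis applies directly.\<close>

lemma free_linear_eqI:
  assumes R: "cring R" and P: "module R P"
    and f: "linear_map R (free_module R X) P f" and g: "linear_map R (free_module R X) P g"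
    and eq: "\<And>x. x \<in> X \<Longrightarrow> f (free_gen R x) = g (free_gen R x)"
    and u: "u \<in> carrier (free_module R X)"
  shows "f u = g u"
proof -
  interpret R: cring R by fact
  interpret P: module R P by fact
  let ?F = "free_module R X"
  interpret F: module R ?F by (rule module_free[OF R])
  have "\<forall>u\<in>carrier ?F. {x. u x \<noteq> \<zero>\<^bsub>R\<^esub>} \<subseteq> A \<longrightarrow> f u = g u" if "finite A" for A
    using that
  proof induction
    case empty
    have "u = \<zero>\<^bsub>?F\<^esub>" if "{x. u x \<noteq> \<zero>\<^bsub>R\<^esub>} \<subseteq> {}" for u
      using that by (auto simp: free_module_def)
    moreover have "f \<zero>\<^bsub>?F\<^esub> = g \<zero>\<^bsub>?F\<^esub>"
      using linear_map_zero[OF F.module_axioms P f] linear_map_zero[OF F.module_axioms P g] by simp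
    ultimately show ?case by metis
  next
    case (insert a A)
    show ?case
    proof (intro ballI impI)
      fix u assume u: "u \<in> carrier ?F" and supp: "{x. u x \<noteq> \<zero>\<^bsub>R\<^esub>} \<subseteq> insert a A"
      have uR: "u x \<in> carrier R" for x using u by (auto simp: free_module_def)
      show "f u = g u"
      proof (cases "a \<in> X")
        case True
        define v where "v = u(a := \<zero>\<^bsub>R\<^esub>)"
        have "{x. v x \<noteq> \<zero>\<^bsub>R\<^esub>} \<subseteq> {x. u x \<noteq> \<zero>\<^bsub>R\<^esub>}" by (auto simp: v_def)
        then have v: "v \<in> carrier ?F" using u finite_subset[of "{x. v x \<noteq> \<zero>\<^bsub>R\<^esub>}"]
          by (auto simp: free_module_def v_def)
        have vA: "{x. v x \<noteq> \<zero>\<^bsub>R\<^esub>} \<subseteq> A" using supp by (auto simp: v_def)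
        have e: "free_gen R a \<in> carrier ?F" using free_gen_closed[OF R True] .
        have "u = v \<oplus>\<^bsub>?F\<^esub> u a \<odot>\<^bsub>?F\<^esub> free_gen R a"
          using uR by (auto simp: v_def free_module_def free_gen_def)
        moreover have "h (v \<oplus>\<^bsub>?F\<^esub> u a \<odot>\<^bsub>?F\<^esub> free_gen R a) = h v \<oplus>\<^bsub>P\<^esub> u a \<odot>\<^bsub>P\<^esub> h (free_gen R a)"
          if "linear_map R ?F P h" for h
          using that v e uR by (simp add: linear_map_add linear_map_smult)
        moreover have "f v = g v" using insert.IH v vA by blast
        ultimately show ?thesis using f g eq[OF True] by metis
      next
        case False
        then have "u a = \<zero>\<^bsub>R\<^esub>" using u by (auto simp: free_module_def)
        then have "{x. u x \<noteq> \<zero>\<^bsub>R\<^esub>} \<subseteq> A" using supp by auto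
        then show ?thesis using insert.IH u by blast
      qed
    qed
  qed
  moreover have "finite {x. u x \<noteq> \<zero>\<^bsub>R\<^esub>}" using u by (auto simp: free_module_def)
  ultimately show ?thesis using u by blast
qed

text \<open>The linear map out of the free module that \<open>f\<close> induces. Up to uncurrying it
  is literally the sum inside \<open>sweedler\<close>, so facts about it carry over without
  conversion.\<close>

definition free_lift ::
    "('k, 'r) ring_scheme \<Rightarrow> ('k, 'p, 'm) module_scheme \<Rightarrow> ('x \<Rightarrow> 'p) \<Rightarrow> ('x \<Rightarrow> 'k) \<Rightarrow> 'p"
  where "free_lift R P f u = finsum P (\<lambda>x. u x \<odot>\<^bsub>P\<^esub> f x) {x. u x \<noteq> \<zero>\<^bsub>R\<^esub>}"

text \<open>Points with zero coefficient contribute nothing. Needed because supports vary: that of a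
  sum or a multiple can be smaller than expected, so sums are compared over a common index
  set.\<close>

lemma free_lift_superset:
  assumes P: "module R P" and "f \<in> X \<rightarrow> carrier P" "u \<in> carrier (free_module R X)"
    and "finite A" "{x. u x \<noteq> \<zero>\<^bsub>R\<^esub>} \<subseteq> A" "A \<subseteq> X"
  shows "free_lift R P f u = finsum P (\<lambda>x. u x \<odot>\<^bsub>P\<^esub> f x) A"
proof -
  interpret P: module R P by fact
  show ?thesis
    unfolding free_lift_def
  proof (rule P.M.add.finprod_mono_neutral_cong_left)
    fix x assume "x \<in> A - {x. u x \<noteq> \<zero>\<^bsub>R\<^esub>}"
    then have "u x = \<zero>\<^bsub>R\<^esub>" "f x \<in> carrier P" using assms by auto
    then show "u x \<odot>\<^bsub>P\<^esub> f x = \<zero>\<^bsub>P\<^esub>" by simp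
  next
    show "(\<lambda>x. u x \<odot>\<^bsub>P\<^esub> f x) \<in> A \<rightarrow> carrier P"
      using assms by (auto simp: Pi_iff free_module_coeff)
  qed (use assms in auto)
qed

lemma free_lift_closed:
  assumes P: "module R P" and "f \<in> X \<rightarrow> carrier P" "u \<in> carrier (free_module R X)"
  shows "free_lift R P f u \<in> carrier P"
proof -
  interpret P: module R P by fact
  show ?thesis
    unfolding free_lift_def
    by (rule P.M.finsum_closed)
      (use assms free_module_support[OF assms(3)] free_module_coeff[OF assms(3)] in auto)
qed

lemma linear_map_free_lift:
  assumes P: "module R P" and f: "f \<in> X \<rightarrow> carrier P"
  shows "linear_map R (free_module R X) P (free_lift R P f)"
proof -
  interpret P: module R P by fact
  show ?thesis
  proof (rule linear_mapI)
    let ?F = "free_module R X"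
    interpret F: module R ?F by (rule module_free[OF P.R.is_cring])
    fix u assume u: "u \<in> carrier ?F"
    let ?S = "\<lambda>u. {x. u x \<noteq> \<zero>\<^bsub>R\<^esub>}"
    have u': "finite (?S u)" "?S u \<subseteq> X" "\<And>x. u x \<in> carrier R"
      using u by (auto simp: free_module_def)
    have fx: "f x \<in> carrier P" if "x \<in> X" for x using f that by auto
    have uX: "x \<in> X" if "u x \<noteq> \<zero>\<^bsub>R\<^esub>" for x using u' that by auto
    show "free_lift R P f u \<in> carrier P" by (rule free_lift_closed[OF P f u])
    {
      fix v assume v: "v \<in> carrier ?F"
      have v': "finite (?S v)" "?S v \<subseteq> X" "\<And>x. v x \<in> carrier R"
        using v by (auto simp: free_module_def)
      have vX: "x \<in> X" if "v x \<noteq> \<zero>\<^bsub>R\<^esub>" for x using v' that by auto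
      let ?A = "?S u \<union> ?S v"
      have uv: "u \<oplus>\<^bsub>?F\<^esub> v = (\<lambda>x. u x \<oplus>\<^bsub>R\<^esub> v x)" by (simp add: free_module_def)
      have "free_lift R P f (u \<oplus>\<^bsub>?F\<^esub> v) = finsum P (\<lambda>x. (u x \<oplus>\<^bsub>R\<^esub> v x) \<odot>\<^bsub>P\<^esub> f x) ?A"
        unfolding uv using u v F.M.a_closed[of u v] u' v'
        by (intro free_lift_superset[OF P f]) (auto simp: uv)
      also have "\<dots> = finsum P (\<lambda>x. u x \<odot>\<^bsub>P\<^esub> f x \<oplus>\<^bsub>P\<^esub> v x \<odot>\<^bsub>P\<^esub> f x) ?A"
        using u' v' fx uX vX by (intro P.M.finsum_cong') (auto simp: P.smult_l_distr)
      also have "\<dots> = finsum P (\<lambda>x. u x \<odot>\<^bsub>P\<^esub> f x) ?A \<oplus>\<^bsub>P\<^esub> finsum P (\<lambda>x. v x \<odot>\<^bsub>P\<^esub> f x) ?A"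
        using u' v' fx uX vX by (intro P.M.finsum_addf) auto
      also have "\<dots> = free_lift R P f u \<oplus>\<^bsub>P\<^esub> free_lift R P f v"
        using u v u' v' free_lift_superset[OF P f u, of ?A] free_lift_superset[OF P f v, of ?A] by auto
      finally show "free_lift R P f (u \<oplus>\<^bsub>?F\<^esub> v) = free_lift R P f u \<oplus>\<^bsub>P\<^esub> free_lift R P f v" .
    }
    {
      fix r assume r: "r \<in> carrier R"
      have ru: "r \<odot>\<^bsub>?F\<^esub> u = (\<lambda>x. r \<otimes>\<^bsub>R\<^esub> u x)" by (simp add: free_module_def)
      have "free_lift R P f (r \<odot>\<^bsub>?F\<^esub> u) = finsum P (\<lambda>x. (r \<otimes>\<^bsub>R\<^esub> u x) \<odot>\<^bsub>P\<^esub> f x) (?S u)"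
        unfolding ru using F.smult_closed[OF r u] u' r
        by (intro free_lift_superset[OF P f]) (auto simp: ru)
      also have "\<dots> = finsum P (\<lambda>x. r \<odot>\<^bsub>P\<^esub> (u x \<odot>\<^bsub>P\<^esub> f x)) (?S u)"
        using u' fx uX r by (intro P.M.finsum_cong') (auto simp: P.smult_assoc1)
      also have "\<dots> = r \<odot>\<^bsub>P\<^esub> free_lift R P f u"
        unfolding free_lift_def using u' fx uX r by (intro P.finsum_smult_ldistr[symmetric]) auto
      finally show "free_lift R P f (r \<odot>\<^bsub>?F\<^esub> u) = r \<odot>\<^bsub>P\<^esub> free_lift R P f u" .
    }
  qed
qed

lemma free_lift_gen:
  assumes P: "module R P" and f: "f \<in> X \<rightarrow> carrier P" and x: "x \<in> X"
  shows "free_lift R P f (free_gen R x) = f x"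
proof -
  interpret P: module R P by fact
  \<comment> \<open>Summing over \<open>{x}\<close> instead of the support covers the zero ring too,
    where the support of \<open>free_gen R x\<close> is empty.\<close>
  have "free_lift R P f (free_gen R x) = finsum P (\<lambda>y. free_gen R x y \<odot>\<^bsub>P\<^esub> f y) {x}"
    using x by (intro free_lift_superset[OF P f] free_gen_closed P.R.is_cring)
      (auto simp: free_gen_def)
  also have "\<dots> = f x"
    using f x by (subst P.M.finsum_insert)
      (auto simp: free_gen_def P.M.finsum_empty P.M.r_zero Pi_iff)
  finally show ?thesis .
qed

lemma linear_map_free_lift_param:
  assumes P: "module R P" and f: "\<And>x. x \<in> X \<Longrightarrow> linear_map R M P (\<lambda>a. f a x)" and u: "u \<in> carrier (free_module R X)"
  shows "linear_map R M P (\<lambda>a. free_lift R P (f a) u)"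
proof -
  interpret P: module R P by fact
  show ?thesis
  proof (rule linear_mapI)
    have u': "finite {x. u x \<noteq> \<zero>\<^bsub>R\<^esub>}" "\<And>x. u x \<noteq> \<zero>\<^bsub>R\<^esub> \<Longrightarrow> x \<in> X" "\<And>x. u x \<in> carrier R"
      using u by (auto simp: free_module_def)
    fix a assume a: "a \<in> carrier M"
    have fa: "f a x \<in> carrier P" if "x \<in> X" "a \<in> carrier M" for a x
      using linear_map_closed[OF f[OF that(1)] that(2)] .
    show "free_lift R P (f a) u \<in> carrier P"
      using fa a u by (intro free_lift_closed[OF P]) auto
    {
      fix b assume b: "b \<in> carrier M"
      have "free_lift R P (f (a \<oplus>\<^bsub>M\<^esub> b)) u =
          finsum P (\<lambda>x. u x \<odot>\<^bsub>P\<^esub> f a x \<oplus>\<^bsub>P\<^esub> u x \<odot>\<^bsub>P\<^esub> f b x) {x. u x \<noteq> \<zero>\<^bsub>R\<^esub>}"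
        unfolding free_lift_def using u' fa a b linear_map_add[OF f a b]
        by (intro P.M.finsum_cong') (auto simp: P.smult_r_distr)
      then show "free_lift R P (f (a \<oplus>\<^bsub>M\<^esub> b)) u = free_lift R P (f a) u \<oplus>\<^bsub>P\<^esub> free_lift R P (f b) u"
        unfolding free_lift_def using u' fa a b by (subst (asm) P.M.finsum_addf) auto
    }
    {
      fix r assume r: "r \<in> carrier R"
      \<comment> \<open>Commutativity of \<open>R\<close> lets the new scalar pass the coefficient
        \<open>u x\<close>.\<close>
      have "u x \<odot>\<^bsub>P\<^esub> (r \<odot>\<^bsub>P\<^esub> f a x) = r \<odot>\<^bsub>P\<^esub> (u x \<odot>\<^bsub>P\<^esub> f a x)" if "x \<in> X" for x
        using fa[OF that a] u' r P.smult_assoc1[of "u x" r] P.smult_assoc1[of r "u x"]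
        by (simp add: P.R.m_comm)
      then have "free_lift R P (f (r \<odot>\<^bsub>M\<^esub> a)) u =
          finsum P (\<lambda>x. r \<odot>\<^bsub>P\<^esub> (u x \<odot>\<^bsub>P\<^esub> f a x)) {x. u x \<noteq> \<zero>\<^bsub>R\<^esub>}"
        unfolding free_lift_def using u' fa a r linear_map_smult[OF f r a]
        by (intro P.M.finsum_cong') auto
      then show "free_lift R P (f (r \<odot>\<^bsub>M\<^esub> a)) u = r \<odot>\<^bsub>P\<^esub> free_lift R P (f a) u"
        unfolding free_lift_def using u' fa a r by (subst P.finsum_smult_ldistr) auto
    }
  qed
qed

lemma linear_map_of_free_lift:
  assumes P: "module R P" and Q: "module R Q" and \<phi>: "linear_map R P Q \<phi>"
    and f: "f \<in> X \<rightarrow> carrier P" and u: "u \<in> carrier (free_module R X)"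
  shows "\<phi> (free_lift R P f u) = free_lift R Q (\<lambda>x. \<phi> (f x)) u"
proof -
  interpret P: module R P by fact
  show ?thesis
  proof (rule free_linear_eqI[OF P.R.is_cring Q _ _ _ u])
    have \<phi>f: "(\<lambda>x. \<phi> (f x)) \<in> X \<rightarrow> carrier Q"
      using f \<phi> by (auto intro: linear_map_closed)
    show "linear_map R (free_module R X) Q (free_lift R Q (\<lambda>x. \<phi> (f x)))"
      by (rule linear_map_free_lift[OF Q \<phi>f])
    show "linear_map R (free_module R X) Q (\<lambda>u. \<phi> (free_lift R P f u))"
      by (rule linear_map_compose[OF \<phi> linear_map_free_lift[OF P f]])
    show "\<phi> (free_lift R P f (free_gen R x)) = free_lift R Q (\<lambda>x. \<phi> (f x)) (free_gen R x)"
      if "x \<in> X" for x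
      using that by (simp add: free_lift_gen[OF P f] free_lift_gen[OF Q \<phi>f])
  qed
qed

section \<open>Quotients and tensor products\<close>

lemma module_span_least: "submodule N R M \<Longrightarrow> A \<subseteq> N \<Longrightarrow> module_span R M A \<subseteq> N"
  by (auto simp: module_span_def)

lemma module_span_superset: "A \<subseteq> module_span R M A"
  by (auto simp: module_span_def)

lemma submodule_span:
  assumes "module R M" "A \<subseteq> carrier M"
  shows "submodule (module_span R M A) R M"
proof -
  interpret module R M by fact
  have c: "module_span R M A \<subseteq> carrier M"
    using module_span_least[OF carrier_is_submodule assms(2)] .
  show ?thesis
  proof (rule submoduleI[OF c])
    have "\<zero>\<^bsub>M\<^esub> \<in> N" if "submodule N R M" for N
      using subgroup.one_closed[OF submodule.axioms(1)[OF that]] by simp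
    then show "\<zero>\<^bsub>M\<^esub> \<in> module_span R M A"
      by (auto simp: module_span_def)
  qed (auto simp: module_span_def submoduleE)
qed

text \<open>The elements of \<open>N\<close> on which \<open>f\<close> and \<open>g\<close> agree
  form a submodule containing \<open>A\<close>. Linearity is asked only on \<open>N\<close>, so that
  maps living only on the cosmash coproduct can be compared on its generators.\<close>

lemma module_span_linear_eqI:
  assumes P: "module R P" and M: "module R M" "A \<subseteq> carrier M"
    and N: "submodule N R M" "A \<subseteq> N"
    and f: "linear_map R (M\<lparr>carrier := N\<rparr>) P f" and g: "linear_map R (M\<lparr>carrier := N\<rparr>) P g"
    and eq: "\<And>x. x \<in> A \<Longrightarrow> f x = g x"
    and x: "x \<in> module_span R M A"
  shows "f x = g x"
proof -
  interpret M: module R M by fact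
  interpret P: module R P by fact
  have "module R (M\<lparr>carrier := N\<rparr>)" by (rule submodule.submodule_is_module[OF N(1) M(1)])
  then interpret N: module R "M\<lparr>carrier := N\<rparr>" .
  have NM: "N \<subseteq> carrier M" using M.submoduleE(1)[OF N(1)] .
  have N0: "\<zero>\<^bsub>M\<^esub> \<in> N" using N.M.zero_closed by simp
  let ?E = "{x \<in> N. f x = g x}"
  \<comment> \<open>The negation of the restricted record is a different term from that of
    \<open>M\<close>; the scalar -1 acts by the same operation in both, so negation is expressed
    through it.\<close>
  have h: "h (\<ominus>\<^bsub>M\<^esub> y) = (\<ominus>\<^bsub>R\<^esub> \<one>\<^bsub>R\<^esub>) \<odot>\<^bsub>P\<^esub> h y"
    if "linear_map R (M\<lparr>carrier := N\<rparr>) P h" "y \<in> N" for h y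
    using linear_map_smult[OF that(1), of "\<ominus>\<^bsub>R\<^esub> \<one>\<^bsub>R\<^esub>" y] that(2) NM M.smult_l_minus[of "\<one>\<^bsub>R\<^esub>" y]
    by auto
  have "submodule ?E R M"
  proof (rule M.submoduleI)
    show "\<zero>\<^bsub>M\<^esub> \<in> ?E"
      using N0 linear_map_zero[OF N.module_axioms P f] linear_map_zero[OF N.module_axioms P g] by simp
  next
    fix y assume "y \<in> ?E"
    then show "\<ominus>\<^bsub>M\<^esub> y \<in> ?E"
      using h[OF f, of y] h[OF g, of y] M.submoduleE(3)[OF N(1)] by auto
  next
    fix y z assume "y \<in> ?E" "z \<in> ?E"
    then show "y \<oplus>\<^bsub>M\<^esub> z \<in> ?E"
      using linear_map_add[OF f, of y z] linear_map_add[OF g, of y z] M.submoduleE(5)[OF N(1)] by auto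
  next
    fix r y assume "r \<in> carrier R" "y \<in> ?E"
    then show "r \<odot>\<^bsub>M\<^esub> y \<in> ?E"
      using linear_map_smult[OF f, of r y] linear_map_smult[OF g, of r y] M.submoduleE(4)[OF N(1)] by auto
  qed (use NM in auto)
  then have "module_span R M A \<subseteq> ?E"
    using N(2) eq by (intro module_span_least) auto
  with x show ?thesis by auto
qed

context
  fixes R :: "('k, 'r) ring_scheme" and M :: "('k, 'a, 'm) module_scheme" and N :: "'a set"
  assumes M: "module R M" and N: "submodule N R M"
begin

interpretation M: module R M by (rule M)

interpretation N: abelian_subgroup N M
  by (intro abelian_subgroupI3 additive_subgroup.intro submodule.axioms(1)[OF N] M.abelian_group_axioms)

text \<open>The scalar action is defined as a union over all representatives of the coset. As
  \<open>N\<close> is closed under scalars they all yield the same coset, and the union collapses to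
  it.\<close>

lemma quotient_smult:
  assumes r: "r \<in> carrier R" and m: "m \<in> carrier M"
  shows "r \<odot>\<^bsub>quotient_module M N\<^esub> (N +>\<^bsub>M\<^esub> m) = N +>\<^bsub>M\<^esub> (r \<odot>\<^bsub>M\<^esub> m)"
proof -
  have "N +>\<^bsub>M\<^esub> (r \<odot>\<^bsub>M\<^esub> x) = N +>\<^bsub>M\<^esub> (r \<odot>\<^bsub>M\<^esub> m)" if x: "x \<in> N +>\<^bsub>M\<^esub> m" for x
  proof -
    obtain n where n: "n \<in> N" "x = n \<oplus>\<^bsub>M\<^esub> m"
      using x by (auto simp: a_r_coset_def')
    then have nM: "n \<in> carrier M" using N.a_subset by auto
    have "r \<odot>\<^bsub>M\<^esub> x = r \<odot>\<^bsub>M\<^esub> n \<oplus>\<^bsub>M\<^esub> r \<odot>\<^bsub>M\<^esub> m"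
      using n nM r m by (simp add: M.smult_r_distr)
    moreover have "r \<odot>\<^bsub>M\<^esub> n \<in> N" using submodule.smult_closed[OF N r n(1)] .
    ultimately have "r \<odot>\<^bsub>M\<^esub> x \<in> N +>\<^bsub>M\<^esub> (r \<odot>\<^bsub>M\<^esub> m)"
      by (auto simp: a_r_coset_def')
    then show ?thesis
      using N.a_repr_independence'[of "r \<odot>\<^bsub>M\<^esub> x" "r \<odot>\<^bsub>M\<^esub> m"] r m by simp
  qed
  then have "(\<Union>x\<in>N +>\<^bsub>M\<^esub> m. N +>\<^bsub>M\<^esub> (r \<odot>\<^bsub>M\<^esub> x)) = (\<Union>x\<in>N +>\<^bsub>M\<^esub> m. N +>\<^bsub>M\<^esub> (r \<odot>\<^bsub>M\<^esub> m))"
    by (intro SUP_cong refl)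
  moreover have "m \<in> N +>\<^bsub>M\<^esub> m" using N.a_rcos_self[OF m] .
  ultimately show ?thesis by (simp only: quotient_module_def module.simps UN_constant) auto
qed

lemma quotient_add:
  assumes "m \<in> carrier M" "n \<in> carrier M"
  shows "(N +>\<^bsub>M\<^esub> m) \<oplus>\<^bsub>quotient_module M N\<^esub> (N +>\<^bsub>M\<^esub> n) = N +>\<^bsub>M\<^esub> (m \<oplus>\<^bsub>M\<^esub> n)"
  using N.a_rcos_sum[OF assms] by (simp add: quotient_module_def)

lemma carrier_quotient: "carrier (quotient_module M N) = (\<lambda>m. N +>\<^bsub>M\<^esub> m) ` carrier M"
  by (auto simp: quotient_module_def A_RCOSETS_def')

lemma module_quotient: "module R (quotient_module M N)"
proof (rule moduleI)
  let ?Q = "quotient_module M N"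
  have zero: "\<zero>\<^bsub>?Q\<^esub> = N +>\<^bsub>M\<^esub> \<zero>\<^bsub>M\<^esub>"
    using N.a_rcos_const[OF N.zero_closed] by (simp add: quotient_module_def)
  show "abelian_group ?Q"
  proof (rule abelian_groupI)
    fix X assume "X \<in> carrier ?Q"
    then obtain m where "m \<in> carrier M" "X = N +>\<^bsub>M\<^esub> m" by (auto simp: carrier_quotient)
    then show "\<exists>Y\<in>carrier ?Q. Y \<oplus>\<^bsub>?Q\<^esub> X = \<zero>\<^bsub>?Q\<^esub>"
      by (intro bexI[of _ "N +>\<^bsub>M\<^esub> (\<ominus>\<^bsub>M\<^esub> m)"])
        (auto simp: quotient_add zero carrier_quotient M.M.l_neg)
  qed (auto simp: carrier_quotient quotient_add zero M.M.a_ac)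
  show "cring R" by (rule M.R.is_cring)
qed (auto simp: carrier_quotient quotient_smult quotient_add
      M.smult_l_distr M.smult_r_distr M.smult_assoc1)

lemma linear_map_coset: "linear_map R M (quotient_module M N) (\<lambda>m. N +>\<^bsub>M\<^esub> m)"
  by (rule linear_mapI) (auto simp: carrier_quotient quotient_smult quotient_add)

lemma coset_eqI: "m \<ominus>\<^bsub>M\<^esub> n \<in> N \<Longrightarrow> m \<in> carrier M \<Longrightarrow> n \<in> carrier M \<Longrightarrow> N +>\<^bsub>M\<^esub> m = N +>\<^bsub>M\<^esub> n"
  using N.a_rcos_module_rev[of n m] N.a_repr_independence'[of m n] by (simp add: a_minus_def)

end

section \<open>Bilinear maps and the universal property of the tensor product\<close>

definition bilinear_map ::
    "('k, 'r) ring_scheme \<Rightarrow> ('k, 'a, 'm) module_scheme \<Rightarrow> ('k, 'b, 'n) module_scheme \<Rightarrow>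
     ('k, 'p, 'q) module_scheme \<Rightarrow> ('a \<Rightarrow> 'b \<Rightarrow> 'p) \<Rightarrow> bool"
  where "bilinear_map R M N P f \<longleftrightarrow>
    (\<forall>n\<in>carrier N. linear_map R M P (\<lambda>m. f m n)) \<and> (\<forall>m\<in>carrier M. linear_map R N P (f m))"

lemma bilinear_mapI [lin]:
  assumes "\<And>n. n \<in> carrier N \<Longrightarrow> linear_map R M P (\<lambda>m. f m n)"
    and "\<And>m. m \<in> carrier M \<Longrightarrow> linear_map R N P (f m)"
  shows "bilinear_map R M N P f"
  using assms by (simp add: bilinear_map_def)

lemma bilinear_map_closed:
  "bilinear_map R M N P f \<Longrightarrow> m \<in> carrier M \<Longrightarrow> n \<in> carrier N \<Longrightarrow> f m n \<in> carrier P"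
  by (auto simp: bilinear_map_def linear_map_closed)

text \<open>
  \<open>tsum\<close> is \<open>sweedler\<close> computed on one fixed representative of \<open>z\<close>. It agrees with \<open>sweedler\<close> for bilinear
  \<open>f\<close>, but it is a finite sum for every \<open>f\<close>, so congruence, exchange of sums and linearity in a
  parameter need no bilinearity.
\<close>

definition tsum ::
    "('k, 'r) ring_scheme \<Rightarrow> ('k, 'a, 'm) module_scheme \<Rightarrow> ('k, 'b, 'n) module_scheme \<Rightarrow>
     ('k, 'p, 'q) module_scheme \<Rightarrow> ('k, 'a, 'b) tensor \<Rightarrow> ('a \<Rightarrow> 'b \<Rightarrow> 'p) \<Rightarrow> 'p"
  where "tsum R M N P z f =
    free_lift R P (\<lambda>(m, n)\<in>carrier M \<times> carrier N. f m n) (SOME u. u \<in> z)"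

text \<open>The summand of \<open>tsum\<close> is restricted to the carriers, so agreement there is
  enough. As a congruence rule this lets the simplifier rewrite inside Sweedler sums knowing that
  the legs lie in the carriers.\<close>

lemma tsum_cong:
  assumes "z = z'" "\<And>m n. m \<in> carrier M \<Longrightarrow> n \<in> carrier N \<Longrightarrow> f m n = g m n"
  shows "tsum R M N P z f = tsum R M N P z' g"
proof -
  have "(\<lambda>(m, n)\<in>carrier M \<times> carrier N. f m n) = (\<lambda>(m, n)\<in>carrier M \<times> carrier N. g m n)"
    using assms(2) by (intro restrict_ext) auto
  then show ?thesis by (simp add: tsum_def assms(1))
qed

text \<open>\<open>cosmash_comult\<close> takes values in the tensor square of
  \<open>cosmash_module\<close>, while the coalgebra axioms speak about that of
  \<open>cosmash\<close>; this identifies the two.\<close>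

lemma tensor_cong_module:
  assumes "carrier M = carrier M'" "add M = add M'" "smult M = smult M'"
    and "carrier N = carrier N'" "add N = add N'" "smult N = smult N'"
  shows "tensor R M N = tensor R M' N'" and "pure_tensor R M N = pure_tensor R M' N'"
  using assms
  by (simp_all add: tensor_def tensor_kernel_def tensor_relations_def pure_tensor_def fun_eq_iff)

lemma tensor_relations_subset:
  assumes "module R M" "module R N"
  shows "tensor_relations R M N \<subseteq> carrier (free_module R (carrier M \<times> carrier N))"
proof -
  interpret M: module R M by fact
  interpret N: module R N by fact
  interpret F: module R "free_module R (carrier M \<times> carrier N)"
    by (rule module_free[OF M.R.is_cring])
  show ?thesis
    by (auto simp: tensor_relations_def Let_def intro!: F.M.minus_closed F.M.a_closed F.smult_closed
        free_gen_closed[OF M.R.is_cring])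
qed

lemma submodule_tensor_kernel:
  assumes "module R M" "module R N"
  shows "submodule (tensor_kernel R M N) R (free_module R (carrier M \<times> carrier N))"
  unfolding tensor_kernel_def
  by (intro submodule_span tensor_relations_subset module_free assms)
    (use assms(1) in \<open>simp add: module_def\<close>)

lemma module_cring: "module R M \<Longrightarrow> cring R"
  by (simp add: module_def)

lemma module_tensor [lin]: "module R M \<Longrightarrow> module R N \<Longrightarrow> module R (tensor R M N)"
  unfolding tensor_def
  by (intro module_quotient module_free submodule_tensor_kernel) (auto dest: module_cring)

lemma linear_map_tensor_coset:
  assumes "module R M" "module R N"
  shows "linear_map R (free_module R (carrier M \<times> carrier N)) (tensor R M N)
    (\<lambda>u. tensor_kernel R M N +>\<^bsub>free_module R (carrier M \<times> carrier N)\<^esub> u)"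
  unfolding tensor_def
  by (intro linear_map_coset module_free submodule_tensor_kernel assms)
    (use assms in \<open>auto dest: module_cring\<close>)

lemma carrier_tensor:
  assumes "module R M" "module R N"
  shows "carrier (tensor R M N) =
    (\<lambda>u. tensor_kernel R M N +>\<^bsub>free_module R (carrier M \<times> carrier N)\<^esub> u) `
      carrier (free_module R (carrier M \<times> carrier N))"
  unfolding tensor_def
  by (intro carrier_quotient[where R = R] module_free submodule_tensor_kernel assms)
    (use assms in \<open>auto dest: module_cring\<close>)

lemma pure_tensor_closed [lin]:
  assumes "module R M" "module R N" "m \<in> carrier M" "n \<in> carrier N"
  shows "pure_tensor R M N m n \<in> carrier (tensor R M N)"
  unfolding pure_tensor_def
  by (rule linear_map_closed[OF linear_map_tensor_coset])
    (use assms in \<open>auto intro!: free_gen_closed dest: module_cring\<close>)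

lemma bilinear_pure_tensor:
  assumes M: "module R M" and N: "module R N"
  shows "bilinear_map R M N (tensor R M N) (pure_tensor R M N)"
proof -
  interpret M: module R M by fact
  interpret N: module R N by fact
  let ?F = "free_module R (carrier M \<times> carrier N)" and ?K = "tensor_kernel R M N"
  interpret F: module R ?F by (rule module_free[OF M.R.is_cring])
  let ?q = "\<lambda>u. ?K +>\<^bsub>?F\<^esub> u"
  have q: "linear_map R ?F (tensor R M N) ?q" by (rule linear_map_tensor_coset[OF M N])
  have rel: "?q u = ?q v"
    if "u \<ominus>\<^bsub>?F\<^esub> v \<in> tensor_relations R M N" "u \<in> carrier ?F" "v \<in> carrier ?F" for u v
    using that(1) module_span_superset[of "tensor_relations R M N" R ?F]
    by (intro coset_eqI[OF F.module_axioms submodule_tensor_kernel[OF M N]] that(2,3))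
      (auto simp: tensor_kernel_def)
  have e: "free_gen R (m, n) \<in> carrier ?F" if "m \<in> carrier M" "n \<in> carrier N" for m n
    using that by (intro free_gen_closed M.R.is_cring) auto
  let ?e = "\<lambda>m n. free_gen R (m, n)"
  have rel_add_l: "?q (?e (m \<oplus>\<^bsub>M\<^esub> m') n) = ?q (?e m n \<oplus>\<^bsub>?F\<^esub> ?e m' n)"
    if "m \<in> carrier M" "m' \<in> carrier M" "n \<in> carrier N" for m m' n
    using that by (intro rel) (auto simp: e tensor_relations_def Let_def)
  have rel_add_r: "?q (?e m (n \<oplus>\<^bsub>N\<^esub> n')) = ?q (?e m n \<oplus>\<^bsub>?F\<^esub> ?e m n')"
    if "m \<in> carrier M" "n \<in> carrier N" "n' \<in> carrier N" for m n n'
    using that by (intro rel) (auto simp: e tensor_relations_def Let_def)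
  have rel_smult_l: "?q (?e (r \<odot>\<^bsub>M\<^esub> m) n) = ?q (r \<odot>\<^bsub>?F\<^esub> ?e m n)"
    if "r \<in> carrier R" "m \<in> carrier M" "n \<in> carrier N" for r m n
    using that by (intro rel) (auto simp: e tensor_relations_def Let_def)
  have rel_smult_r: "?q (?e m (r \<odot>\<^bsub>N\<^esub> n)) = ?q (r \<odot>\<^bsub>?F\<^esub> ?e m n)"
    if "r \<in> carrier R" "m \<in> carrier M" "n \<in> carrier N" for r m n
    using that by (intro rel) (auto simp: e tensor_relations_def Let_def)
  have pure: "pure_tensor R M N m n = ?q (free_gen R (m, n))" for m n
    by (simp add: pure_tensor_def)
  show ?thesis
  proof (intro bilinear_mapI linear_mapI)
    fix m m' n assume "m \<in> carrier M" "m' \<in> carrier M" "n \<in> carrier N"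
    then show "pure_tensor R M N (m \<oplus>\<^bsub>M\<^esub> m') n =
        pure_tensor R M N m n \<oplus>\<^bsub>tensor R M N\<^esub> pure_tensor R M N m' n"
      unfolding pure
      using rel_add_l[of m m' n] by (simp add: e linear_map_add[OF q])
  next
    fix m n n' assume "m \<in> carrier M" "n \<in> carrier N" "n' \<in> carrier N"
    then show "pure_tensor R M N m (n \<oplus>\<^bsub>N\<^esub> n') =
        pure_tensor R M N m n \<oplus>\<^bsub>tensor R M N\<^esub> pure_tensor R M N m n'"
      unfolding pure
      using rel_add_r[of m n n'] by (simp add: e linear_map_add[OF q])
  next
    fix r m n assume "r \<in> carrier R" "m \<in> carrier M" "n \<in> carrier N"
    then show "pure_tensor R M N (r \<odot>\<^bsub>M\<^esub> m) n = r \<odot>\<^bsub>tensor R M N\<^esub> pure_tensor R M N m n"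
      unfolding pure
      using rel_smult_l[of r m n] by (simp add: e linear_map_smult[OF q])
  next
    fix r m n assume "r \<in> carrier R" "m \<in> carrier M" "n \<in> carrier N"
    then show "pure_tensor R M N m (r \<odot>\<^bsub>N\<^esub> n) = r \<odot>\<^bsub>tensor R M N\<^esub> pure_tensor R M N m n"
      unfolding pure
      using rel_smult_r[of r m n] by (simp add: e linear_map_smult[OF q])
  qed (use M N in \<open>auto intro: pure_tensor_closed\<close>)
qed

text \<open>The kernel of the induced map is a submodule, and bilinearity of \<open>f\<close> says
  that it contains all tensor relations; hence it contains their span.\<close>

lemma free_lift_tensor_kernel:
  assumes M: "module R M" and N: "module R N" and P: "module R P"
    and f: "bilinear_map R M N P f" and u: "u \<in> tensor_kernel R M N"
  shows "free_lift R P (\<lambda>(m, n). f m n) u = \<zero>\<^bsub>P\<^esub>"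
proof -
  interpret M: module R M by fact
  interpret N: module R N by fact
  interpret P: module R P by fact
  let ?F = "free_module R (carrier M \<times> carrier N)" and ?l = "free_lift R P (\<lambda>(m, n). f m n)"
  interpret F: module R ?F by (rule module_free[OF M.R.is_cring])
  have fP: "(\<lambda>(m, n). f m n) \<in> carrier M \<times> carrier N \<rightarrow> carrier P"
    using bilinear_map_closed[OF f] by auto
  have l: "linear_map R ?F P ?l" by (rule linear_map_free_lift[OF P fP])
  have lgen: "?l (free_gen R (m, n)) = f m n" if "m \<in> carrier M" "n \<in> carrier N" for m n
    using that by (subst free_lift_gen[OF P fP]) auto
  have e: "free_gen R (m, n) \<in> carrier ?F" if "m \<in> carrier M" "n \<in> carrier N" for m n
    using that by (intro free_gen_closed M.R.is_cring) auto
  let ?E = "{u \<in> carrier ?F. ?l u = \<zero>\<^bsub>P\<^esub>}"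
  have "submodule ?E R ?F"
    by (rule F.submoduleI)
      (auto simp: linear_map_zero[OF F.module_axioms P l] linear_map_neg[OF F.module_axioms P l]
        linear_map_add[OF l] linear_map_smult[OF l])
  moreover have "tensor_relations R M N \<subseteq> ?E"
  proof
    fix v assume v: "v \<in> tensor_relations R M N"
    have fl: "linear_map R M P (\<lambda>m. f m n)" if "n \<in> carrier N" for n
      using f that by (simp add: bilinear_map_def)
    have fr: "linear_map R N P (f m)" if "m \<in> carrier M" for m
      using f that by (simp add: bilinear_map_def)
    note * = linear_map_minus[OF F.module_axioms P l] linear_map_add[OF l] linear_map_smult[OF l]
      lgen e bilinear_map_closed[OF f] linear_map_add[OF fl] linear_map_add[OF fr]
      linear_map_smult[OF fl] linear_map_smult[OF fr]
    have "?l v = \<zero>\<^bsub>P\<^esub>"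
      using v by (auto simp: tensor_relations_def Let_def * P.M.r_neg a_minus_def[of P])
    moreover have "v \<in> carrier ?F" using v tensor_relations_subset[OF M N] by auto
    ultimately show "v \<in> ?E" by simp
  qed
  ultimately have "tensor_kernel R M N \<subseteq> ?E"
    unfolding tensor_kernel_def by (rule module_span_least)
  with u show ?thesis by auto
qed

lemma free_lift_tensor:
  assumes M: "module R M" and N: "module R N" and P: "module R P"
    and f: "bilinear_map R M N P f" and v: "v \<in> carrier (free_module R (carrier M \<times> carrier N))"
    and u: "u \<in> tensor_kernel R M N +>\<^bsub>free_module R (carrier M \<times> carrier N)\<^esub> v"
  shows "free_lift R P (\<lambda>(m, n). f m n) u = free_lift R P (\<lambda>(m, n). f m n) v"
proof -
  interpret M: module R M by fact
  interpret P: module R P by fact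
  let ?F = "free_module R (carrier M \<times> carrier N)"
  interpret F: module R ?F by (rule module_free[OF M.R.is_cring])
  have fP: "(\<lambda>(m, n). f m n) \<in> carrier M \<times> carrier N \<rightarrow> carrier P"
    using bilinear_map_closed[OF f] by auto
  obtain k where k: "k \<in> tensor_kernel R M N" "u = k \<oplus>\<^bsub>?F\<^esub> v"
    using u by (auto simp: a_r_coset_def')
  have "k \<in> carrier ?F" using k F.submoduleE(1)[OF submodule_tensor_kernel[OF M N]] by auto
  then show ?thesis
    using v free_lift_closed[OF P fP v]
    by (simp add: k(2) linear_map_add[OF linear_map_free_lift[OF P fP]]
        free_lift_tensor_kernel[OF M N P f k(1)])
qed

text \<open>The sum takes the same value on all representatives of the coset \<open>z\<close>, so
  the definite description in \<open>sweedler\<close> denotes that value and any representative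
  computes it.\<close>

lemma sweedler_eq_free_lift:
  assumes "module R M" "module R N" "module R P"
    and f: "bilinear_map R M N P f" and z: "z \<in> carrier (tensor R M N)" and u: "u \<in> z"
  shows "sweedler R P z f = free_lift R P (\<lambda>(m, n). f m n) u"
proof -
  obtain v where v: "v \<in> carrier (free_module R (carrier M \<times> carrier N))"
    "z = tensor_kernel R M N +>\<^bsub>free_module R (carrier M \<times> carrier N)\<^esub> v"
    using z by (auto simp: carrier_tensor[OF assms(1,2)])
  have *: "finsum P (\<lambda>(a, b). w (a, b) \<odot>\<^bsub>P\<^esub> f a b) {p. w p \<noteq> \<zero>\<^bsub>R\<^esub>}
      = free_lift R P (\<lambda>(m, n). f m n) w" for w
    by (simp add: free_lift_def case_prod_beta')
  have c: "free_lift R P (\<lambda>(m, n). f m n) w = free_lift R P (\<lambda>(m, n). f m n) v" if "w \<in> z" for w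
    using free_lift_tensor[OF assms(1-3) f v(1)] that v(2) by simp
  show ?thesis
    unfolding sweedler_def *
    by (rule the_equality) (use c u in metis)+
qed

lemma tensor_element_props:
  assumes "module R M" "module R N" "z \<in> carrier (tensor R M N)"
  shows "(SOME u. u \<in> z) \<in> z"
    and "u \<in> z \<Longrightarrow> u \<in> carrier (free_module R (carrier M \<times> carrier N))"
proof -
  let ?F = "free_module R (carrier M \<times> carrier N)"
  interpret F: module R ?F by (rule module_free[OF module_cring[OF assms(1)]])
  obtain v where v: "v \<in> carrier ?F" "z = tensor_kernel R M N +>\<^bsub>?F\<^esub> v"
    using assms by (auto simp: carrier_tensor)
  note K = submodule_tensor_kernel[OF assms(1,2)]
  have "abelian_subgroup (tensor_kernel R M N) ?F"
    by (intro abelian_subgroupI3 additive_subgroup.intro submodule.axioms(1)[OF K] F.abelian_group_axioms)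
  then interpret K: abelian_subgroup "tensor_kernel R M N" ?F .
  have "v \<in> z" using K.a_rcos_self[OF v(1)] v(2) by simp
  then show "(SOME u. u \<in> z) \<in> z" by (rule someI[of "\<lambda>u. u \<in> z"])
  show "u \<in> z \<Longrightarrow> u \<in> carrier ?F"
    using v K.a_elemrcos_carrier[OF v(1)] by auto
qed

lemma free_lift_cong:
  assumes "module R P" "g \<in> X \<rightarrow> carrier P" "u \<in> carrier (free_module R X)"
    and "\<And>x. x \<in> X \<Longrightarrow> f x = g x"
  shows "free_lift R P f u = free_lift R P g u"
proof -
  interpret module R P by fact
  show ?thesis
    unfolding free_lift_def
    using assms(2,4) free_module_support(2)[OF assms(3)] free_module_coeff[OF assms(3)]
    by (intro M.finsum_cong') (auto simp: Pi_iff)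
qed

lemma tsum_eq_free_lift:
  assumes "module R M" "module R N" "module R P"
    and "\<And>m n. m \<in> carrier M \<Longrightarrow> n \<in> carrier N \<Longrightarrow> f m n \<in> carrier P"
    and "z \<in> carrier (tensor R M N)"
  shows "tsum R M N P z f = free_lift R P (\<lambda>(m, n). f m n) (SOME u. u \<in> z)"
  unfolding tsum_def
  by (rule free_lift_cong[where X = "carrier M \<times> carrier N"])
    (use assms tensor_element_props[OF assms(1,2,5)] in auto)

lemma sweedler_eq_tsum:
  assumes "module R M" "module R N" "module R P"
    and "bilinear_map R M N P f" and z: "z \<in> carrier (tensor R M N)"
  shows "sweedler R P z f = tsum R M N P z f"
  using assms tensor_element_props(1)[OF assms(1,2,5)]
  by (simp add: sweedler_eq_free_lift[OF assms] tsum_eq_free_lift bilinear_map_closed)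

lemma tsum_closed:
  assumes "module R M" "module R N" "module R P" "z \<in> carrier (tensor R M N)"
    and "\<And>m n. m \<in> carrier M \<Longrightarrow> n \<in> carrier N \<Longrightarrow> f m n \<in> carrier P"
  shows "tsum R M N P z f \<in> carrier P"
  using assms tensor_element_props[OF assms(1,2,4)]
  by (subst tsum_eq_free_lift)
    (auto intro!: free_lift_closed[where X = "carrier M \<times> carrier N"])

text \<open>Existence in the universal property of the tensor product; \<open>tsum_pure\<close> adds
  the values on pure tensors. The chosen representative may be replaced by any other, so linearity
  is inherited from the free module.\<close>

lemma linear_map_tsum:
  assumes M: "module R M" and N: "module R N" and P: "module R P"
    and f: "bilinear_map R M N P f"
  shows "linear_map R (tensor R M N) P (\<lambda>z. tsum R M N P z f)"
proof -
  let ?F = "free_module R (carrier M \<times> carrier N)" and ?K = "tensor_kernel R M N"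
  let ?l = "free_lift R P (\<lambda>(m, n). f m n)"
  interpret F: module R ?F by (rule module_free[OF module_cring[OF M]])
  have fP: "(\<lambda>(m, n). f m n) \<in> carrier M \<times> carrier N \<rightarrow> carrier P"
    using bilinear_map_closed[OF f] by auto
  have l: "linear_map R ?F P ?l" by (rule linear_map_free_lift[OF P fP])
  have q: "linear_map R ?F (tensor R M N) (\<lambda>u. ?K +>\<^bsub>?F\<^esub> u)"
    by (rule linear_map_tensor_coset[OF M N])
  have "tsum R M N P (?K +>\<^bsub>?F\<^esub> u) f = ?l u" if u: "u \<in> carrier ?F" for u
    using u tensor_element_props(1)[OF M N linear_map_closed[OF q u]]
    by (subst tsum_eq_free_lift[OF M N P])
       (auto intro!: bilinear_map_closed[OF f] linear_map_closed[OF q] free_lift_tensor[OF M N P f])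
  note * = this linear_map_add[OF q, symmetric] linear_map_smult[OF q, symmetric]
  show ?thesis
    by (rule linear_mapI)
      (auto simp: carrier_tensor[OF M N] * linear_map_add[OF l] linear_map_smult[OF l]
        linear_map_closed[OF l])
qed

lemma linear_map_tsum_param:
  assumes "module R M" "module R N" "module R P" "module R Q" "z \<in> carrier (tensor R M N)"
    and f: "\<And>m n. m \<in> carrier M \<Longrightarrow> n \<in> carrier N \<Longrightarrow> linear_map R Q P (\<lambda>x. f x m n)"
  shows "linear_map R Q P (\<lambda>x. tsum R M N P z (f x))"
proof (rule linear_map_cong)
  fix x assume x: "x \<in> carrier Q"
  show "tsum R M N P z (f x) = free_lift R P (\<lambda>(m, n). f x m n) (SOME u. u \<in> z)"
    using assms linear_map_closed[OF f x] by (intro tsum_eq_free_lift) auto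
next
  show "linear_map R Q P (\<lambda>x. free_lift R P (\<lambda>(m, n). f x m n) (SOME u. u \<in> z))"
    using assms tensor_element_props[OF assms(1,2,5)]
    by (intro linear_map_free_lift_param[where X = "carrier M \<times> carrier N"]) auto
qed fact

lemma tsum_pure:
  assumes M: "module R M" and N: "module R N" and P: "module R P"
    and f: "bilinear_map R M N P f" and mn: "m \<in> carrier M" "n \<in> carrier N"
  shows "tsum R M N P (pure_tensor R M N m n) f = f m n"
proof -
  have fP: "(\<lambda>(m, n). f m n) \<in> carrier M \<times> carrier N \<rightarrow> carrier P"
    using bilinear_map_closed[OF f] by auto
  have e: "free_gen R (m, n) \<in> carrier (free_module R (carrier M \<times> carrier N))"
    using mn by (intro free_gen_closed module_cring[OF M]) auto
  have p: "pure_tensor R M N m n \<in> carrier (tensor R M N)"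
    by (rule pure_tensor_closed) fact+
  have "tsum R M N P (pure_tensor R M N m n) f
      = free_lift R P (\<lambda>(m, n). f m n) (SOME u. u \<in> pure_tensor R M N m n)"
    by (rule tsum_eq_free_lift) (auto intro: M N P p bilinear_map_closed[OF f])
  also have "\<dots> = free_lift R P (\<lambda>(m, n). f m n) (free_gen R (m, n))"
    using tensor_element_props(1)[OF M N p]
    by (intro free_lift_tensor[OF M N P f e]) (simp add: pure_tensor_def)
  also have "\<dots> = f m n" using mn by (subst free_lift_gen[OF P fP]) auto
  finally show ?thesis .
qed

lemma linear_of_tsum:
  assumes "module R M" "module R N" "module R P" "module R Q" "z \<in> carrier (tensor R M N)"
    and \<phi>: "linear_map R P Q \<phi>"
    and f: "\<And>m n. m \<in> carrier M \<Longrightarrow> n \<in> carrier N \<Longrightarrow> f m n \<in> carrier P"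
  shows "\<phi> (tsum R M N P z f) = tsum R M N Q z (\<lambda>m n. \<phi> (f m n))"
proof -
  let ?F = "free_module R (carrier M \<times> carrier N)"
  have "(SOME u. u \<in> z) \<in> carrier ?F" using tensor_element_props[OF assms(1,2,5)] by auto
  then have "\<phi> (free_lift R P (\<lambda>(m, n). f m n) (SOME u. u \<in> z))
      = free_lift R Q (\<lambda>x. \<phi> (case x of (m, n) \<Rightarrow> f m n)) (SOME u. u \<in> z)"
    using f by (intro linear_map_of_free_lift[OF assms(3,4) \<phi>]) auto
  then show ?thesis
    using assms f linear_map_closed[OF \<phi>] by (simp add: tsum_eq_free_lift case_prod_beta')
qed

text \<open>With representatives fixed, both sides are linear in the one of \<open>z\<close>. It
  therefore suffices to compare them on free generators, where the sum over \<open>z\<close>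
  collapses to a single term.\<close>

lemma tsum_swap:
  assumes M: "module R M" and N: "module R N" and K: "module R K" and L: "module R L"
    and P: "module R P" and z: "z \<in> carrier (tensor R M N)" and w: "w \<in> carrier (tensor R K L)"
    and f: "\<And>m n k l. m \<in> carrier M \<Longrightarrow> n \<in> carrier N \<Longrightarrow> k \<in> carrier K \<Longrightarrow> l \<in> carrier L \<Longrightarrow>
      f m n k l \<in> carrier P"
  shows "tsum R M N P z (\<lambda>m n. tsum R K L P w (f m n))
    = tsum R K L P w (\<lambda>k l. tsum R M N P z (\<lambda>m n. f m n k l))"
proof -
  let ?F = "free_module R (carrier M \<times> carrier N)" and ?G = "free_module R (carrier K \<times> carrier L)"
  define v where "v = (SOME u. u \<in> w)"
  define u where "u = (SOME u. u \<in> z)"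
  have u: "u \<in> carrier ?F" using tensor_element_props[OF M N z] by (auto simp: u_def)
  have v: "v \<in> carrier ?G" using tensor_element_props[OF K L w] by (auto simp: v_def)
  have 1: "(\<lambda>(k, l). f m n k l) \<in> carrier K \<times> carrier L \<rightarrow> carrier P"
    if "m \<in> carrier M" "n \<in> carrier N" for m n using f that by auto
  have 2: "(\<lambda>(m, n). f m n k l) \<in> carrier M \<times> carrier N \<rightarrow> carrier P"
    if "k \<in> carrier K" "l \<in> carrier L" for k l using f that by auto
  have "tsum R M N P z (\<lambda>m n. tsum R K L P w (f m n))
      = tsum R M N P z (\<lambda>m n. free_lift R P (\<lambda>(k, l). f m n k l) v)"
    using f by (intro tsum_cong refl) (auto simp: tsum_eq_free_lift K L P w v_def)
  also have "\<dots> = free_lift R P (\<lambda>(m, n). free_lift R P (\<lambda>(k, l). f m n k l) v) u"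
    unfolding u_def by (intro tsum_eq_free_lift M N P z free_lift_closed[OF P 1 v])
  also have "\<dots> = free_lift R P (\<lambda>(k, l). free_lift R P (\<lambda>(m, n). f m n k l) u) v"
  proof (rule free_linear_eqI[OF module_cring[OF M] P _ _ _ u])
    show "linear_map R ?F P (free_lift R P (\<lambda>(m, n). free_lift R P (\<lambda>(k, l). f m n k l) v))"
      using free_lift_closed[OF P 1 v] by (intro linear_map_free_lift[OF P]) auto
    have "linear_map R ?F P (\<lambda>u. (case x of (k, l) \<Rightarrow> free_lift R P (\<lambda>(m, n). f m n k l) u))"
      if "x \<in> carrier K \<times> carrier L" for x
      using that by (auto intro!: linear_map_free_lift[OF P] f)
    from linear_map_free_lift_param[OF P this v]
    show "linear_map R ?F P (\<lambda>u. free_lift R P (\<lambda>(k, l). free_lift R P (\<lambda>(m, n). f m n k l) u) v)"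
      by (simp add: case_prod_beta')
    fix x assume x: "x \<in> carrier M \<times> carrier N"
    have "free_lift R P (\<lambda>(m, n). free_lift R P (\<lambda>(k, l). f m n k l) v) (free_gen R x)
        = free_lift R P (\<lambda>(k, l). f (fst x) (snd x) k l) v"
      using x free_lift_closed[OF P 1 v]
      by (subst free_lift_gen[OF P, where X = "carrier M \<times> carrier N"]) auto
    also have "\<dots> = free_lift R P (\<lambda>(k, l). free_lift R P (\<lambda>(m, n). f m n k l) (free_gen R x)) v"
    proof (rule free_lift_cong[OF P _ v])
      show "(\<lambda>(k, l). free_lift R P (\<lambda>(m, n). f m n k l) (free_gen R x))
          \<in> carrier K \<times> carrier L \<rightarrow> carrier P"
        using x by (auto intro!: free_lift_closed[OF P 2] free_gen_closed module_cring[OF M])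
    qed (use x in \<open>auto simp: free_lift_gen[OF P 2]\<close>)
    finally show "free_lift R P (\<lambda>(m, n). free_lift R P (\<lambda>(k, l). f m n k l) v) (free_gen R x)
        = free_lift R P (\<lambda>(k, l). free_lift R P (\<lambda>(m, n). f m n k l) (free_gen R x)) v" .
  qed
  also have "\<dots> = tsum R K L P w (\<lambda>k l. free_lift R P (\<lambda>(m, n). f m n k l) u)"
    unfolding v_def by (intro tsum_eq_free_lift[symmetric] K L P w free_lift_closed[OF P 2 u])
  also have "\<dots> = tsum R K L P w (\<lambda>k l. tsum R M N P z (\<lambda>m n. f m n k l))"
    using f by (intro tsum_cong refl) (auto simp: tsum_eq_free_lift M N P z u_def)
  finally show ?thesis .
qed

text \<open>Keeping \<open>f\<close> and \<open>g\<close> apart makes the rule recursive: for nested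
  expressions the premise \<open>f m n = g m n\<close> is again a conversion, of the inner sum, and
  bilinearity is asked only of the converted \<open>g\<close>.\<close>

lemma sweedler_eq_tsumI:
  assumes M: "module R M" and N: "module R N" and P: "module R P" and z: "z \<in> carrier (tensor R M N)"
    and eq: "\<And>m n. m \<in> carrier M \<Longrightarrow> n \<in> carrier N \<Longrightarrow> f m n = g m n"
    and g: "bilinear_map R M N P g"
  shows "sweedler R P z f = tsum R M N P z g"
proof -
  have "free_lift R P (\<lambda>(m, n). f m n) u = free_lift R P (\<lambda>(m, n). g m n) u" if "u \<in> z" for u
    using tensor_element_props(2)[OF M N z that] eq bilinear_map_closed[OF g]
    by (intro free_lift_cong[OF P, where X = "carrier M \<times> carrier N"]) auto
  then have "sweedler R P z f = sweedler R P z g"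
    by (simp add: sweedler_def free_lift_def case_prod_beta')
  then show ?thesis using sweedler_eq_tsum[OF M N P g z] by simp
qed

text \<open>The outer sum is linear in its tensor. Together with \<open>tsum_pure\<close> this
  evaluates a multilinear map on a tensor that is itself given as a Sweedler sum of pure
  tensors.\<close>

lemma tsum_tsum:
  assumes "module R M" "module R N" "module R A" "module R B" "module R P"
    and "z \<in> carrier (tensor R M N)" "bilinear_map R A B P f"
    and "\<And>m n. m \<in> carrier M \<Longrightarrow> n \<in> carrier N \<Longrightarrow> g m n \<in> carrier (tensor R A B)"
  shows "tsum R A B P (tsum R M N (tensor R A B) z g) f
    = tsum R M N P z (\<lambda>m n. tsum R A B P (g m n) f)"
  using assms by (intro linear_of_tsum linear_map_tsum module_tensor) auto

section \<open>Rules that decide multilinearity of Sweedler expressions\<close>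

declare linear_map_id [lin] tsum_closed [lin]

text \<open>A Sweedler sum may depend on \<open>x\<close> through its tensor, as here, or through
  its summand, as in \<open>linear_map_tsum_param\<close>. The two rules together settle linearity
  of nested sums in every variable.\<close>

lemma linear_map_tsum_comp [lin]:
  assumes "module R M" "module R N" "module R P" "bilinear_map R M N P f"
    and "linear_map R Q (tensor R M N) g"
  shows "linear_map R Q P (\<lambda>x. tsum R M N P (g x) f)"
  using linear_map_compose[OF linear_map_tsum assms(5)] assms by blast

declare linear_map_tsum_param [lin]

lemma linear_map_pure_left [lin]:
  assumes "module R M" "module R N" "linear_map R Q M g" "n \<in> carrier N"
  shows "linear_map R Q (tensor R M N) (\<lambda>x. pure_tensor R M N (g x) n)"
  using bilinear_pure_tensor[OF assms(1,2)] assms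
  by (intro linear_map_compose[OF _ assms(3), where g = "\<lambda>m. pure_tensor R M N m n"])
    (auto simp: bilinear_map_def)

lemma linear_map_pure_right [lin]:
  assumes "module R M" "module R N" "linear_map R Q N g" "m \<in> carrier M"
  shows "linear_map R Q (tensor R M N) (\<lambda>x. pure_tensor R M N m (g x))"
  using bilinear_pure_tensor[OF assms(1,2)] assms
  by (intro linear_map_compose[OF _ assms(3)]) (auto simp: bilinear_map_def)

lemma linear_map_smult_left [lin]:
  assumes "module R P" "linear_map R Q (regular_module R) r" "y \<in> carrier P"
  shows "linear_map R Q P (\<lambda>x. r x \<odot>\<^bsub>P\<^esub> y)"
proof -
  interpret P: module R P by fact
  have "linear_map R (regular_module R) P (\<lambda>r. r \<odot>\<^bsub>P\<^esub> y)"
    by (rule linear_mapI)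
      (use assms in \<open>auto simp: regular_module_def P.smult_l_distr P.smult_assoc1\<close>)
  from linear_map_compose[OF this assms(2)] show ?thesis .
qed

lemma linear_map_smult_right [lin]:
  assumes "module R P" "r \<in> carrier R" "linear_map R Q P g"
  shows "linear_map R Q P (\<lambda>x. r \<odot>\<^bsub>P\<^esub> g x)"
proof -
  interpret P: module R P by fact
  have "linear_map R P P (\<lambda>y. r \<odot>\<^bsub>P\<^esub> y)"
    by (rule linear_mapI)
      (use assms in \<open>auto simp: P.smult_r_distr P.smult_assoc1[symmetric] P.R.m_comm\<close>)
  from linear_map_compose[OF this assms(3)] show ?thesis .
qed

lemma module_smult_closed [lin]: "module R P \<Longrightarrow> r \<in> carrier R \<Longrightarrow> y \<in> carrier P \<Longrightarrow> r \<odot>\<^bsub>P\<^esub> y \<in> carrier P"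
  by (rule module.smult_closed)

definition trilinear_map ::
    "('k, 'r) ring_scheme \<Rightarrow> ('k, 'a, 'm) module_scheme \<Rightarrow> ('k, 'b, 'n) module_scheme \<Rightarrow>
     ('k, 'c, 'l) module_scheme \<Rightarrow> ('k, 'p, 'q) module_scheme \<Rightarrow> ('a \<Rightarrow> 'b \<Rightarrow> 'c \<Rightarrow> 'p) \<Rightarrow> bool"
  where "trilinear_map R A B D P f \<longleftrightarrow>
    (\<forall>b\<in>carrier B. \<forall>d\<in>carrier D. linear_map R A P (\<lambda>a. f a b d)) \<and>
    (\<forall>a\<in>carrier A. bilinear_map R B D P (f a))"

lemma trilinear_mapI [lin]:
  assumes "\<And>b d. b \<in> carrier B \<Longrightarrow> d \<in> carrier D \<Longrightarrow> linear_map R A P (\<lambda>a. f a b d)"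
    and "\<And>a. a \<in> carrier A \<Longrightarrow> bilinear_map R B D P (f a)"
  shows "trilinear_map R A B D P f"
  using assms by (simp add: trilinear_map_def)

text \<open>Instantiated with a given map \<open>f\<close>, this rule and its bilinear and trilinear
  analogues below extend \<open>lin\<close> to expressions in which \<open>f\<close> occurs.\<close>

lemma linear_map_use:
  assumes "linear_map R A P f"
  shows "\<And>a. a \<in> carrier A \<Longrightarrow> f a \<in> carrier P"
    and "\<And>M g. linear_map R M A g \<Longrightarrow> linear_map R M P (\<lambda>x. f (g x))"
  using assms by (auto intro: linear_map_closed linear_map_compose)

lemma bilinear_map_use:
  assumes "bilinear_map R A B P f"
  shows "\<And>a b. a \<in> carrier A \<Longrightarrow> b \<in> carrier B \<Longrightarrow> f a b \<in> carrier P"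
    and "\<And>M g b. linear_map R M A g \<Longrightarrow> b \<in> carrier B \<Longrightarrow> linear_map R M P (\<lambda>x. f (g x) b)"
    and "\<And>M g a. linear_map R M B g \<Longrightarrow> a \<in> carrier A \<Longrightarrow> linear_map R M P (\<lambda>x. f a (g x))"
  using assms
  by (auto simp: bilinear_map_def intro: linear_map_closed linear_map_compose[of _ _ _ "\<lambda>a. f a b" for b]
      linear_map_compose[of _ _ _ "f a" for a])

lemma trilinear_map_use:
  assumes f: "trilinear_map R A B D P f"
  shows "\<And>a b d. a \<in> carrier A \<Longrightarrow> b \<in> carrier B \<Longrightarrow> d \<in> carrier D \<Longrightarrow> f a b d \<in> carrier P"
    and "\<And>M g b d. linear_map R M A g \<Longrightarrow> b \<in> carrier B \<Longrightarrow> d \<in> carrier D \<Longrightarrow>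
      linear_map R M P (\<lambda>x. f (g x) b d)"
    and "\<And>M g a d. linear_map R M B g \<Longrightarrow> a \<in> carrier A \<Longrightarrow> d \<in> carrier D \<Longrightarrow>
      linear_map R M P (\<lambda>x. f a (g x) d)"
    and "\<And>M g a b. linear_map R M D g \<Longrightarrow> a \<in> carrier A \<Longrightarrow> b \<in> carrier B \<Longrightarrow>
      linear_map R M P (\<lambda>x. f a b (g x))"
proof -
  have b: "bilinear_map R B D P (f a)" if "a \<in> carrier A" for a
    using f that by (simp add: trilinear_map_def)
  show "f a b d \<in> carrier P" if "a \<in> carrier A" "b \<in> carrier B" "d \<in> carrier D" for a b d
    using bilinear_map_use(1)[OF b] that by blast
  show "linear_map R M P (\<lambda>x. f (g x) b d)"
    if "linear_map R M A g" "b \<in> carrier B" "d \<in> carrier D" for M g b d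
    using f that linear_map_compose[of R A P "\<lambda>a. f a b d" M g] by (auto simp: trilinear_map_def)
  show "linear_map R M P (\<lambda>x. f a (g x) d)"
    if "linear_map R M B g" "a \<in> carrier A" "d \<in> carrier D" for M g a d
    using bilinear_map_use(2)[OF b] that by blast
  show "linear_map R M P (\<lambda>x. f a b (g x))"
    if "linear_map R M D g" "a \<in> carrier A" "b \<in> carrier B" for M g a b
    using bilinear_map_use(3)[OF b] that by blast
qed

section \<open>Sweedler calculus\<close>

context coalgebra
begin

lemma module_R_C [lin]: "module R C" ..

lemma module_regular_R [lin]: "module R (regular_module R)"
  by (rule module_regular) (rule R.is_cring)

lemma comult_closed [lin]: "c \<in> carrier C \<Longrightarrow> comult C c \<in> carrier (tensor R C C)"
  by (rule linear_map_closed[OF comult_linear])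

lemma linear_map_comult [lin]:
  "linear_map R M C g \<Longrightarrow> linear_map R M (tensor R C C) (\<lambda>x. comult C (g x))"
  by (rule linear_map_compose[OF comult_linear])

lemma counit_closed [lin]: "c \<in> carrier C \<Longrightarrow> counit C c \<in> carrier R"
  using linear_map_closed[OF counit_linear] by (simp add: carrier_regular_module)

lemma linear_map_counit [lin]:
  "linear_map R M C g \<Longrightarrow> linear_map R M (regular_module R) (\<lambda>x. counit C (g x))"
  by (rule linear_map_compose[OF counit_linear])

text \<open>Apply to both sides of the axiom the linear map that \<open>f\<close> induces on the
  triple tensor product. The result no longer mentions a tensor product in its target, so it can be
  used underneath other sums; all axioms below are transported in this way.\<close>

lemma coassoc_tsum:
  assumes P: "module R P" and f: "trilinear_map R C C C P f" and c: "c \<in> carrier C"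
  shows "tsum R C C P (comult C c) (\<lambda>c1 c2. tsum R C C P (comult C c1) (\<lambda>c11 c12. f c11 c12 c2))
    = tsum R C C P (comult C c) (\<lambda>c1 c2. tsum R C C P (comult C c2) (f c1))"
proof -
  let ?T = "tensor R C (tensor R C C)"
  let ?p = "\<lambda>a b d. pure_tensor R C (tensor R C C) a (pure_tensor R C C b d)"
  have "sweedler R ?T (comult C c) (\<lambda>c1 c2. sweedler R ?T (comult C c1) (\<lambda>a b. ?p a b c2))
    = tsum R C C ?T (comult C c) (\<lambda>c1 c2. tsum R C C ?T (comult C c1) (\<lambda>a b. ?p a b c2))"
    using c by (intro sweedler_eq_tsumI) (simp_all add: lin)
  moreover have "sweedler R ?T (comult C c) (\<lambda>c1 c2. sweedler R ?T (comult C c2) (\<lambda>a b. ?p c1 a b))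
    = tsum R C C ?T (comult C c) (\<lambda>c1 c2. tsum R C C ?T (comult C c2) (\<lambda>a b. ?p c1 a b))"
    using c by (intro sweedler_eq_tsumI) (simp_all add: lin)
  ultimately have "tsum R C C ?T (comult C c) (\<lambda>c1 c2. tsum R C C ?T (comult C c1) (\<lambda>a b. ?p a b c2))
    = tsum R C C ?T (comult C c) (\<lambda>c1 c2. tsum R C C ?T (comult C c2) (\<lambda>a b. ?p c1 a b))"
    using coassoc[OF c] by simp
  from arg_cong[OF this, of "\<lambda>z. tsum R C (tensor R C C) P z (\<lambda>a w. tsum R C C P w (f a))"]
  show ?thesis
    using c by (simp add: lin tsum_tsum tsum_pure P trilinear_map_use[OF f] cong: tsum_cong)
qed

lemma counit_left_tsum:
  assumes P: "module R P" and f: "linear_map R C P f" and c: "c \<in> carrier C"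
  shows "tsum R C C P (comult C c) (\<lambda>c1 c2. counit C c1 \<odot>\<^bsub>P\<^esub> f c2) = f c"
proof -
  have "sweedler R C (comult C c) (\<lambda>c1 c2. counit C c1 \<odot>\<^bsub>C\<^esub> c2)
    = tsum R C C C (comult C c) (\<lambda>c1 c2. counit C c1 \<odot>\<^bsub>C\<^esub> c2)"
    using c by (intro sweedler_eq_tsumI) (simp_all add: lin)
  then have "f c = f (tsum R C C C (comult C c) (\<lambda>c1 c2. counit C c1 \<odot>\<^bsub>C\<^esub> c2))"
    using counit_left[OF c] by simp
  also have "\<dots> = tsum R C C P (comult C c) (\<lambda>c1 c2. counit C c1 \<odot>\<^bsub>P\<^esub> f c2)"
    using c
      by (simp add: linear_of_tsum[OF _ _ _ _ _ f] lin P linear_map_smult[OF f] cong: tsum_cong)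
  finally show ?thesis ..
qed

lemma counit_right_tsum:
  assumes P: "module R P" and f: "linear_map R C P f" and c: "c \<in> carrier C"
  shows "tsum R C C P (comult C c) (\<lambda>c1 c2. counit C c2 \<odot>\<^bsub>P\<^esub> f c1) = f c"
proof -
  have "sweedler R C (comult C c) (\<lambda>c1 c2. counit C c2 \<odot>\<^bsub>C\<^esub> c1)
    = tsum R C C C (comult C c) (\<lambda>c1 c2. counit C c2 \<odot>\<^bsub>C\<^esub> c1)"
    using c by (intro sweedler_eq_tsumI) (simp_all add: lin)
  then have "f c = f (tsum R C C C (comult C c) (\<lambda>c1 c2. counit C c2 \<odot>\<^bsub>C\<^esub> c1))"
    using counit_right[OF c] by simp
  also have "\<dots> = tsum R C C P (comult C c) (\<lambda>c1 c2. counit C c2 \<odot>\<^bsub>P\<^esub> f c1)"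
    using c
      by (simp add: linear_of_tsum[OF _ _ _ _ _ f] lin P linear_map_smult[OF f] cong: tsum_cong)
  finally show ?thesis ..
qed

end

section \<open>Products, comultiplication of products, and the antipode\<close>

context assoc_algebra
begin

lemma linear_map_mult_left [lin]:
  assumes "linear_map R M A g" "y \<in> carrier A"
  shows "linear_map R M A (\<lambda>x. g x \<otimes>\<^bsub>A\<^esub> y)"
  by (rule linear_map_compose[OF _ assms(1), of _ "\<lambda>x. x \<otimes>\<^bsub>A\<^esub> y"], rule linear_mapI)
    (use assms(2) in \<open>auto simp: l_distr smult_mult_left\<close>)

lemma linear_map_mult_right [lin]:
  assumes "linear_map R M A g" "y \<in> carrier A"
  shows "linear_map R M A (\<lambda>x. y \<otimes>\<^bsub>A\<^esub> g x)"
  by (rule linear_map_compose[OF _ assms(1), of _ "\<lambda>x. y \<otimes>\<^bsub>A\<^esub> x"], rule linear_mapI)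
    (use assms(2) in \<open>auto simp: r_distr smult_mult_right\<close>)

end

context bialgebra
begin

lemma comult_mult_tsum:
  assumes P: "module R P" and f: "bilinear_map R H H P f" and g: "g \<in> carrier H"
    and h: "h \<in> carrier H"
  shows "tsum R H H P (comult H (g \<otimes>\<^bsub>H\<^esub> h)) f
    = tsum R H H P (comult H g) (\<lambda>g1 g2. tsum R H H P (comult H h) (\<lambda>h1 h2.
        f (g1 \<otimes>\<^bsub>H\<^esub> h1) (g2 \<otimes>\<^bsub>H\<^esub> h2)))"
proof -
  let ?T = "tensor R H H"
  have "comult H (g \<otimes>\<^bsub>H\<^esub> h) = tsum R H H ?T (comult H g) (\<lambda>g1 g2. tsum R H H ?T (comult H h) (\<lambda>h1 h2.
        pure_tensor R H H (g1 \<otimes>\<^bsub>H\<^esub> h1) (g2 \<otimes>\<^bsub>H\<^esub> h2)))"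
    unfolding comult_mult[OF g h]
    using g h by (intro sweedler_eq_tsumI) (simp_all add: lin)
  then show ?thesis
    using g h by (simp add: lin tsum_tsum tsum_pure P f bilinear_map_use[OF f] cong: tsum_cong)
qed

end

context hopf_algebra
begin

lemma antipode_closed [lin]: "h \<in> carrier H \<Longrightarrow> antipode H h \<in> carrier H"
  by (rule linear_map_closed[OF antipode_linear])

lemma linear_map_antipode [lin]:
  "linear_map R M H g \<Longrightarrow> linear_map R M H (\<lambda>x. antipode H (g x))"
  by (rule linear_map_compose[OF antipode_linear])

lemma antipode_left_tsum:
  assumes P: "module R P" and f: "linear_map R H P f" and h: "h \<in> carrier H"
  shows "tsum R H H P (comult H h) (\<lambda>h1 h2. f (antipode H h1 \<otimes>\<^bsub>H\<^esub> h2))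
    = counit H h \<odot>\<^bsub>P\<^esub> f \<one>\<^bsub>H\<^esub>"
proof -
  have "sweedler R H (comult H h) (\<lambda>h1 h2. antipode H h1 \<otimes>\<^bsub>H\<^esub> h2)
    = tsum R H H H (comult H h) (\<lambda>h1 h2. antipode H h1 \<otimes>\<^bsub>H\<^esub> h2)"
    using h by (intro sweedler_eq_tsumI) (simp_all add: lin)
  with antipode_left[OF h] show ?thesis
    using h linear_of_tsum[OF _ _ _ _ _ f, of H H "comult H h" "\<lambda>h1 h2. antipode H h1 \<otimes>\<^bsub>H\<^esub> h2"]
    by (simp add: lin P linear_map_smult[OF f])
qed

lemma antipode_right_tsum:
  assumes P: "module R P" and f: "linear_map R H P f" and h: "h \<in> carrier H"
  shows "tsum R H H P (comult H h) (\<lambda>h1 h2. f (h1 \<otimes>\<^bsub>H\<^esub> antipode H h2))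
    = counit H h \<odot>\<^bsub>P\<^esub> f \<one>\<^bsub>H\<^esub>"
proof -
  have "sweedler R H (comult H h) (\<lambda>h1 h2. h1 \<otimes>\<^bsub>H\<^esub> antipode H h2)
    = tsum R H H H (comult H h) (\<lambda>h1 h2. h1 \<otimes>\<^bsub>H\<^esub> antipode H h2)"
    using h by (intro sweedler_eq_tsumI) (simp_all add: lin)
  with antipode_right[OF h] show ?thesis
    using h linear_of_tsum[OF _ _ _ _ _ f, of H H "comult H h" "\<lambda>h1 h2. h1 \<otimes>\<^bsub>H\<^esub> antipode H h2"]
    by (simp add: lin P linear_map_smult[OF f])
qed

text \<open>The antipode axiom turns the inner sum into a counit, which the counit law absorbs: h_1
  \<otimes> h_2 S(h_3) = h \<otimes> 1 in Sweedler notation.\<close>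

lemma antipode_cancel_right:
  assumes P: "module R P" and f: "bilinear_map R H H P f" and h: "h \<in> carrier H"
  shows "tsum R H H P (comult H h) (\<lambda>h1 h'. tsum R H H P (comult H h') (\<lambda>h2 h3.
      f h1 (h2 \<otimes>\<^bsub>H\<^esub> antipode H h3))) = f h \<one>\<^bsub>H\<^esub>"
proof -
  have "tsum R H H P (comult H h) (\<lambda>h1 h'. tsum R H H P (comult H h') (\<lambda>h2 h3.
      f h1 (h2 \<otimes>\<^bsub>H\<^esub> antipode H h3)))
    = tsum R H H P (comult H h) (\<lambda>h1 h'. counit H h' \<odot>\<^bsub>P\<^esub> f h1 \<one>\<^bsub>H\<^esub>)"
    by (intro tsum_cong refl antipode_right_tsum P) (simp_all add: lin bilinear_map_use[OF f])
  also have "\<dots> = f h \<one>\<^bsub>H\<^esub>"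
    by (intro counit_right_tsum P h) (simp add: lin bilinear_map_use[OF f])
  finally show ?thesis .
qed

text \<open>Here the legs that cancel are the first two, so coassociativity has to regroup them
  before the antipode axiom applies.\<close>

lemma antipode_cancel_left:
  assumes P: "module R P" and f: "bilinear_map R H H P f" and h: "h \<in> carrier H"
  shows "tsum R H H P (comult H h) (\<lambda>h1 h'. tsum R H H P (comult H h') (\<lambda>h2 h3.
      f (h1 \<otimes>\<^bsub>H\<^esub> antipode H h2) h3)) = f \<one>\<^bsub>H\<^esub> h"
proof -
  have "tsum R H H P (comult H h) (\<lambda>h1 h'. tsum R H H P (comult H h') (\<lambda>h2 h3.
      f (h1 \<otimes>\<^bsub>H\<^esub> antipode H h2) h3))
    = tsum R H H P (comult H h) (\<lambda>h' h3. tsum R H H P (comult H h') (\<lambda>h1 h2.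
      f (h1 \<otimes>\<^bsub>H\<^esub> antipode H h2) h3))"
    by (rule coassoc_tsum[OF P _ h, symmetric]) (simp add: lin bilinear_map_use[OF f])
  also have "\<dots> = tsum R H H P (comult H h) (\<lambda>h' h3. counit H h' \<odot>\<^bsub>P\<^esub> f \<one>\<^bsub>H\<^esub> h3)"
    by (intro tsum_cong refl antipode_right_tsum[where f = "\<lambda>w. f w _"] P)
      (simp_all add: lin bilinear_map_use[OF f])
  also have "\<dots> = f \<one>\<^bsub>H\<^esub> h"
    by (intro counit_left_tsum P h) (simp add: lin bilinear_map_use[OF f])
  finally show ?thesis .
qed

text \<open>Both sides are evaluations of \<open>S(g\<^sub>1 h\<^sub>1) g\<^sub>2 h\<^sub>2 S(h\<^sub>3) S(g\<^sub>3)\<close>.\<close>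

lemma antipode_mult:
  assumes g: "g \<in> carrier H" and h: "h \<in> carrier H"
  shows "antipode H (g \<otimes>\<^bsub>H\<^esub> h) = antipode H h \<otimes>\<^bsub>H\<^esub> antipode H g"
proof -
  let ?S = "antipode H"
  let ?t = "tsum R H H H"
  have "?S (g \<otimes>\<^bsub>H\<^esub> h) = ?t (comult H g) (\<lambda>g1 g'. ?t (comult H g') (\<lambda>g2 g3.
      ?S (g1 \<otimes>\<^bsub>H\<^esub> h) \<otimes>\<^bsub>H\<^esub> (g2 \<otimes>\<^bsub>H\<^esub> ?S g3)))"
    using g h by (subst antipode_cancel_right) (simp_all add: lin)
  also have "\<dots> = ?t (comult H g) (\<lambda>g1 g'. ?t (comult H g') (\<lambda>g2 g3.
      ?t (comult H h) (\<lambda>h1 h'. ?t (comult H h') (\<lambda>h2 h3.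
        ?S (g1 \<otimes>\<^bsub>H\<^esub> h1) \<otimes>\<^bsub>H\<^esub> (g2 \<otimes>\<^bsub>H\<^esub> (h2 \<otimes>\<^bsub>H\<^esub> ?S h3) \<otimes>\<^bsub>H\<^esub> ?S g3)))))"
  proof (intro tsum_cong refl)
    fix g1 g2 g3 assume [simp]: "g1 \<in> carrier H" "g2 \<in> carrier H" "g3 \<in> carrier H"
    show "?S (g1 \<otimes>\<^bsub>H\<^esub> h) \<otimes>\<^bsub>H\<^esub> (g2 \<otimes>\<^bsub>H\<^esub> ?S g3)
      = ?t (comult H h) (\<lambda>h1 h'. ?t (comult H h') (\<lambda>h2 h3.
        ?S (g1 \<otimes>\<^bsub>H\<^esub> h1) \<otimes>\<^bsub>H\<^esub> (g2 \<otimes>\<^bsub>H\<^esub> (h2 \<otimes>\<^bsub>H\<^esub> ?S h3) \<otimes>\<^bsub>H\<^esub> ?S g3)))"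
      using h by (subst antipode_cancel_right[where f = "\<lambda>a w. ?S (g1 \<otimes>\<^bsub>H\<^esub> a) \<otimes>\<^bsub>H\<^esub> (g2 \<otimes>\<^bsub>H\<^esub> w \<otimes>\<^bsub>H\<^esub> ?S g3)"])
        (simp_all add: lin)
  qed
  also have "\<dots> = ?t (comult H g) (\<lambda>g1 g'. ?t (comult H g') (\<lambda>g2 g3.
      ?t (comult H h) (\<lambda>h' h3. ?t (comult H h') (\<lambda>h1 h2.
        (?S (g1 \<otimes>\<^bsub>H\<^esub> h1) \<otimes>\<^bsub>H\<^esub> (g2 \<otimes>\<^bsub>H\<^esub> h2)) \<otimes>\<^bsub>H\<^esub> (?S h3 \<otimes>\<^bsub>H\<^esub> ?S g3)))))"
  proof (rule tsum_cong[OF refl], rule tsum_cong[OF refl])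
    fix g1 g2 g3 assume [simp]: "g1 \<in> carrier H" "g2 \<in> carrier H" "g3 \<in> carrier H"
    show "?t (comult H h) (\<lambda>h1 h'. ?t (comult H h') (\<lambda>h2 h3.
        ?S (g1 \<otimes>\<^bsub>H\<^esub> h1) \<otimes>\<^bsub>H\<^esub> (g2 \<otimes>\<^bsub>H\<^esub> (h2 \<otimes>\<^bsub>H\<^esub> ?S h3) \<otimes>\<^bsub>H\<^esub> ?S g3)))
      = ?t (comult H h) (\<lambda>h' h3. ?t (comult H h') (\<lambda>h1 h2.
        (?S (g1 \<otimes>\<^bsub>H\<^esub> h1) \<otimes>\<^bsub>H\<^esub> (g2 \<otimes>\<^bsub>H\<^esub> h2)) \<otimes>\<^bsub>H\<^esub> (?S h3 \<otimes>\<^bsub>H\<^esub> ?S g3)))"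
      using h by (subst coassoc_tsum) (simp_all add: lin m_assoc cong: tsum_cong)
  qed
  also have "\<dots> = ?t (comult H g) (\<lambda>g' g3. ?t (comult H g') (\<lambda>g1 g2.
      ?t (comult H h) (\<lambda>h' h3. ?t (comult H h') (\<lambda>h1 h2.
        (?S (g1 \<otimes>\<^bsub>H\<^esub> h1) \<otimes>\<^bsub>H\<^esub> (g2 \<otimes>\<^bsub>H\<^esub> h2)) \<otimes>\<^bsub>H\<^esub> (?S h3 \<otimes>\<^bsub>H\<^esub> ?S g3)))))"
    using g h by (subst coassoc_tsum) (simp_all add: lin cong: tsum_cong)
  also have "\<dots> = ?t (comult H g) (\<lambda>g' g3. ?t (comult H h) (\<lambda>h' h3.
      ?t (comult H g') (\<lambda>g1 g2. ?t (comult H h') (\<lambda>h1 h2.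
        (?S (g1 \<otimes>\<^bsub>H\<^esub> h1) \<otimes>\<^bsub>H\<^esub> (g2 \<otimes>\<^bsub>H\<^esub> h2)) \<otimes>\<^bsub>H\<^esub> (?S h3 \<otimes>\<^bsub>H\<^esub> ?S g3)))))"
    using g h by (intro tsum_cong[OF refl] tsum_swap) (simp_all add: lin)
  also have "\<dots> = ?t (comult H g) (\<lambda>g' g3. ?t (comult H h) (\<lambda>h' h3.
      counit H g' \<odot>\<^bsub>H\<^esub> (counit H h' \<odot>\<^bsub>H\<^esub> (?S h3 \<otimes>\<^bsub>H\<^esub> ?S g3))))"
  proof (intro tsum_cong refl)
    fix g' g3 h' h3
    assume [simp]: "g' \<in> carrier H" "g3 \<in> carrier H" "h' \<in> carrier H" "h3 \<in> carrier H"
    \<comment> \<open>The double sum is the comultiplication of the product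
      \<open>g' \<otimes> h'\<close> in \<open>H\<close>, so the antipode axiom can be used for that
      product.\<close>
    have "?t (comult H g') (\<lambda>g1 g2. ?t (comult H h') (\<lambda>h1 h2.
        (?S (g1 \<otimes>\<^bsub>H\<^esub> h1) \<otimes>\<^bsub>H\<^esub> (g2 \<otimes>\<^bsub>H\<^esub> h2)) \<otimes>\<^bsub>H\<^esub> (?S h3 \<otimes>\<^bsub>H\<^esub> ?S g3)))
      = ?t (comult H (g' \<otimes>\<^bsub>H\<^esub> h')) (\<lambda>k1 k2. (?S k1 \<otimes>\<^bsub>H\<^esub> k2) \<otimes>\<^bsub>H\<^esub> (?S h3 \<otimes>\<^bsub>H\<^esub> ?S g3))"
      by (subst comult_mult_tsum) (simp_all add: lin)
    also have "\<dots> = counit H (g' \<otimes>\<^bsub>H\<^esub> h') \<odot>\<^bsub>H\<^esub> (\<one>\<^bsub>H\<^esub> \<otimes>\<^bsub>H\<^esub> (?S h3 \<otimes>\<^bsub>H\<^esub> ?S g3))"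
      by (rule antipode_left_tsum[where f = "\<lambda>w. w \<otimes>\<^bsub>H\<^esub> (?S h3 \<otimes>\<^bsub>H\<^esub> ?S g3)"]) (simp_all add: lin)
    finally show "?t (comult H g') (\<lambda>g1 g2. ?t (comult H h') (\<lambda>h1 h2.
        (?S (g1 \<otimes>\<^bsub>H\<^esub> h1) \<otimes>\<^bsub>H\<^esub> (g2 \<otimes>\<^bsub>H\<^esub> h2)) \<otimes>\<^bsub>H\<^esub> (?S h3 \<otimes>\<^bsub>H\<^esub> ?S g3)))
      = counit H g' \<odot>\<^bsub>H\<^esub> (counit H h' \<odot>\<^bsub>H\<^esub> (?S h3 \<otimes>\<^bsub>H\<^esub> ?S g3))"
      by (simp add: lin counit_mult smult_assoc1)
  qed
  also have "\<dots> = ?t (comult H g) (\<lambda>g' g3. counit H g' \<odot>\<^bsub>H\<^esub> (?S h \<otimes>\<^bsub>H\<^esub> ?S g3))"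
  proof (intro tsum_cong refl)
    fix g' g3 assume [simp]: "g' \<in> carrier H" "g3 \<in> carrier H"
    have "?t (comult H h) (\<lambda>h' h3. counit H g' \<odot>\<^bsub>H\<^esub> (counit H h' \<odot>\<^bsub>H\<^esub> (?S h3 \<otimes>\<^bsub>H\<^esub> ?S g3)))
      = counit H g' \<odot>\<^bsub>H\<^esub> ?t (comult H h) (\<lambda>h' h3. counit H h' \<odot>\<^bsub>H\<^esub> (?S h3 \<otimes>\<^bsub>H\<^esub> ?S g3))"
      using h by (intro linear_of_tsum[symmetric]) (simp_all add: lin)
    then show "?t (comult H h) (\<lambda>h' h3. counit H g' \<odot>\<^bsub>H\<^esub> (counit H h' \<odot>\<^bsub>H\<^esub> (?S h3 \<otimes>\<^bsub>H\<^esub> ?S g3)))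
      = counit H g' \<odot>\<^bsub>H\<^esub> (?S h \<otimes>\<^bsub>H\<^esub> ?S g3)"
      using h by (simp add: counit_left_tsum lin)
  qed
  also have "\<dots> = ?S h \<otimes>\<^bsub>H\<^esub> ?S g"
    using g h by (intro counit_left_tsum) (simp_all add: lin)
  finally show ?thesis .
qed

end

section \<open>Identities in partial comodule coalgebras\<close>

context left_partial_comodule_coalgebra
begin

abbreviation nab ("\<nabla>")
  where "\<nabla> x \<equiv> nabla R H C coact x"

text \<open>
  \<open>dC P c (\<lambda>c1 c2. _)\<close>, \<open>dH P h (\<lambda>h1 h2. _)\<close> and \<open>co P c (\<lambda>h d. _)\<close> stand for expressions with values
  in \<open>P\<close> in Sweedler notation, with \<open>c\<^sub>(\<^sub>1\<^sub>) \<otimes> c\<^sub>(\<^sub>2\<^sub>)\<close>, \<open>h\<^sub>(\<^sub>1\<^sub>) \<otimes> h\<^sub>(\<^sub>2\<^sub>)\<close> and \<open>c\<^bsup>[-1]\<^esup> \<otimes> c\<^bsup>[0]\<^esup>\<close> named by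
  the bound variables.
\<close>

abbreviation dC where "dC P x f \<equiv> tsum R C C P (comult C x) f"

abbreviation dH where "dH P h f \<equiv> tsum R H H P (comult H h) f"

abbreviation co where "co P x f \<equiv> tsum R H C P (coact x) f"

lemma coact_closed [lin]: "c \<in> carrier C \<Longrightarrow> coact c \<in> carrier (tensor R H C)"
  by (rule linear_map_closed[OF coact_linear])

lemma linear_map_coact [lin]:
  "linear_map R M C g \<Longrightarrow> linear_map R M (tensor R H C) (\<lambda>x. coact (g x))"
  by (rule linear_map_compose[OF coact_linear])

lemma nabla_eq: "c \<in> carrier C \<Longrightarrow> \<nabla> c = co H c (\<lambda>h d. counit C d \<odot>\<^bsub>H\<^esub> h)"
  unfolding nabla_def by (intro sweedler_eq_tsumI) (simp_all add: lin)

lemma nabla_closed [lin]: "c \<in> carrier C \<Longrightarrow> \<nabla> c \<in> carrier H"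
  by (simp add: nabla_eq lin)

lemma linear_map_nabla [lin]:
  assumes "linear_map R M C g" shows "linear_map R M H (\<lambda>x. \<nabla> (g x))"
proof (rule linear_map_compose[OF _ assms, of _ "\<nabla>"])
  show "linear_map R C H \<nabla>"
    by (rule linear_map_cong[where g = "\<lambda>c. co H c (\<lambda>h d. counit C d \<odot>\<^bsub>H\<^esub> h)"])
      (simp_all add: nabla_eq lin)
qed

text \<open>Read from right to left this opens up \<open>\<nabla> c\<close> inside any linear
  expression, after which the axioms for the coaction apply; read from left to right it closes it
  again.\<close>

lemma nabla_tsum:
  assumes P: "module R P" and f: "linear_map R H P f" and c: "c \<in> carrier C"
  shows "co P c (\<lambda>h d. counit C d \<odot>\<^bsub>P\<^esub> f h) = f (\<nabla> c)"
  using c by (simp add: nabla_eq linear_of_tsum[OF _ _ _ _ _ f] lin P linear_map_smult[OF f] cong: tsum_cong)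

section \<open>Axioms of the partial coaction with an arbitrary target module\<close>

lemma LPCC1_tsum:
  assumes P: "module R P" and f: "trilinear_map R H C C P f" and c: "c \<in> carrier C"
  shows "co P c (\<lambda>h d. dC P d (f h))
    = dC P c (\<lambda>c1 c2. co P c1 (\<lambda>h d. co P c2 (\<lambda>g e. f (h \<otimes>\<^bsub>H\<^esub> g) d e)))"
proof -
  let ?T = "tensor R H (tensor R C C)"
  let ?p = "\<lambda>h d e. pure_tensor R H (tensor R C C) h (pure_tensor R C C d e)"
  have "sweedler R ?T (coact c) (\<lambda>h d. sweedler R ?T (comult C d) (?p h))
    = co ?T c (\<lambda>h d. dC ?T d (?p h))"
    using c by (intro sweedler_eq_tsumI) (simp_all add: lin)
  moreover have "sweedler R ?T (comult C c) (\<lambda>c1 c2. sweedler R ?T (coact c1) (\<lambda>h d.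
      sweedler R ?T (coact c2) (\<lambda>g e. ?p (h \<otimes>\<^bsub>H\<^esub> g) d e)))
    = dC ?T c (\<lambda>c1 c2. co ?T c1 (\<lambda>h d. co ?T c2 (\<lambda>g e. ?p (h \<otimes>\<^bsub>H\<^esub> g) d e)))"
    using c by (intro sweedler_eq_tsumI) (simp_all add: lin)
  ultimately have "co ?T c (\<lambda>h d. dC ?T d (?p h))
    = dC ?T c (\<lambda>c1 c2. co ?T c1 (\<lambda>h d. co ?T c2 (\<lambda>g e. ?p (h \<otimes>\<^bsub>H\<^esub> g) d e)))"
    using LPCC1[OF c] by simp
  from arg_cong[OF this, of "\<lambda>z. tsum R H (tensor R C C) P z (\<lambda>a w. tsum R C C P w (f a))"]
  show ?thesis
    using c by (simp add: lin tsum_tsum tsum_pure P trilinear_map_use[OF f] cong: tsum_cong)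
qed

lemma LPCC2_tsum:
  assumes P: "module R P" and f: "linear_map R C P f" and c: "c \<in> carrier C"
  shows "co P c (\<lambda>h d. counit H h \<odot>\<^bsub>P\<^esub> f d) = f c"
proof -
  have "sweedler R C (coact c) (\<lambda>h d. counit H h \<odot>\<^bsub>C\<^esub> d) = co C c (\<lambda>h d. counit H h \<odot>\<^bsub>C\<^esub> d)"
    using c by (intro sweedler_eq_tsumI) (simp_all add: lin)
  then have "f c = f (co C c (\<lambda>h d. counit H h \<odot>\<^bsub>C\<^esub> d))"
    using LPCC2[OF c] by simp
  also have "\<dots> = co P c (\<lambda>h d. counit H h \<odot>\<^bsub>P\<^esub> f d)"
    using c
      by (simp add: linear_of_tsum[OF _ _ _ _ _ f] lin P linear_map_smult[OF f] cong: tsum_cong)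
  finally show ?thesis ..
qed

text \<open>After transport along \<open>f\<close>, the summand depends on \<open>coact c1\<close>
  only through \<open>counit C d\<close> times \<open>h\<close>, so that this sum collapses to
  \<open>\<nabla> c1\<close>.\<close>

lemma LPCC3_left_tsum:
  assumes P: "module R P" and f: "trilinear_map R H H C P f" and c: "c \<in> carrier C"
  shows "co P c (\<lambda>h d. co P d (f h))
    = dC P c (\<lambda>c1 c2. co P c2 (\<lambda>g e. dH P g (\<lambda>g1 g2. f (\<nabla> c1 \<otimes>\<^bsub>H\<^esub> g1) g2 e)))"
proof -
  let ?T = "tensor R H (tensor R H C)"
  let ?p = "\<lambda>h d e. pure_tensor R H (tensor R H C) h (pure_tensor R H C d e)"
  have "sweedler R ?T (coact c) (\<lambda>h d. sweedler R ?T (coact d) (?p h)) = co ?T c (\<lambda>h d. co ?T d (?p h))"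
    using c by (intro sweedler_eq_tsumI) (simp_all add: lin)
  moreover have "sweedler R ?T (comult C c) (\<lambda>c1 c2. sweedler R ?T (coact c1) (\<lambda>h d.
      sweedler R ?T (coact c2) (\<lambda>g e. sweedler R ?T (comult H g) (\<lambda>g1 g2.
        ?p ((counit C d \<odot>\<^bsub>H\<^esub> h) \<otimes>\<^bsub>H\<^esub> g1) g2 e))))
    = dC ?T c (\<lambda>c1 c2. co ?T c1 (\<lambda>h d. co ?T c2 (\<lambda>g e. dH ?T g (\<lambda>g1 g2.
        ?p ((counit C d \<odot>\<^bsub>H\<^esub> h) \<otimes>\<^bsub>H\<^esub> g1) g2 e))))"
    using c by (intro sweedler_eq_tsumI) (simp_all add: lin)
  ultimately have "co ?T c (\<lambda>h d. co ?T d (?p h))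
    = dC ?T c (\<lambda>c1 c2. co ?T c1 (\<lambda>h d. co ?T c2 (\<lambda>g e. dH ?T g (\<lambda>g1 g2.
        ?p ((counit C d \<odot>\<^bsub>H\<^esub> h) \<otimes>\<^bsub>H\<^esub> g1) g2 e))))"
    using LPCC3_left[OF c] by simp
  from arg_cong[OF this, of "\<lambda>z. tsum R H (tensor R H C) P z (\<lambda>a w. tsum R H C P w (f a))"]
  have "co P c (\<lambda>h d. co P d (f h)) = dC P c (\<lambda>c1 c2. co P c1 (\<lambda>h d. co P c2 (\<lambda>g e. dH P g (\<lambda>g1 g2.
        f ((counit C d \<odot>\<^bsub>H\<^esub> h) \<otimes>\<^bsub>H\<^esub> g1) g2 e))))"
    using c by (simp add: lin tsum_tsum tsum_pure P trilinear_map_use[OF f] cong: tsum_cong)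
  also have "\<dots> = dC P c (\<lambda>c1 c2. co P c2 (\<lambda>g e. dH P g (\<lambda>g1 g2. f (\<nabla> c1 \<otimes>\<^bsub>H\<^esub> g1) g2 e)))"
  proof (rule tsum_cong[OF refl])
    fix c1 c2 assume [simp]: "c1 \<in> carrier C" "c2 \<in> carrier C"
    let ?F = "\<lambda>w. co P c2 (\<lambda>g e. dH P g (\<lambda>g1 g2. f (w \<otimes>\<^bsub>H\<^esub> g1) g2 e))"
    have F: "linear_map R H P ?F" by (simp add: lin P trilinear_map_use[OF f])
    have "co P c1 (\<lambda>h d. ?F (counit C d \<odot>\<^bsub>H\<^esub> h)) = co P c1 (\<lambda>h d. counit C d \<odot>\<^bsub>P\<^esub> ?F h)"
      by (intro tsum_cong refl linear_map_smult[OF F]) (simp_all add: lin)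
    also have "\<dots> = ?F (\<nabla> c1)" by (rule nabla_tsum[OF P F]) simp
    finally show "co P c1 (\<lambda>h d. ?F (counit C d \<odot>\<^bsub>H\<^esub> h)) = ?F (\<nabla> c1)" .
  qed
  finally show ?thesis .
qed

lemma LPCC3_right_tsum:
  assumes P: "module R P" and f: "trilinear_map R H H C P f" and c: "c \<in> carrier C"
  shows "co P c (\<lambda>h d. co P d (f h))
    = dC P c (\<lambda>c1 c2. co P c1 (\<lambda>h d. dH P h (\<lambda>h1 h2. f (h1 \<otimes>\<^bsub>H\<^esub> \<nabla> c2) h2 d)))"
proof -
  let ?T = "tensor R H (tensor R H C)"
  let ?p = "\<lambda>h d e. pure_tensor R H (tensor R H C) h (pure_tensor R H C d e)"
  have "sweedler R ?T (coact c) (\<lambda>h d. sweedler R ?T (coact d) (?p h)) = co ?T c (\<lambda>h d. co ?T d (?p h))"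
    using c by (intro sweedler_eq_tsumI) (simp_all add: lin)
  moreover have "sweedler R ?T (comult C c) (\<lambda>c1 c2. sweedler R ?T (coact c1) (\<lambda>h d.
      sweedler R ?T (coact c2) (\<lambda>g e. sweedler R ?T (comult H h) (\<lambda>h1 h2.
        ?p (h1 \<otimes>\<^bsub>H\<^esub> (counit C e \<odot>\<^bsub>H\<^esub> g)) h2 d))))
    = dC ?T c (\<lambda>c1 c2. co ?T c1 (\<lambda>h d. co ?T c2 (\<lambda>g e. dH ?T h (\<lambda>h1 h2.
        ?p (h1 \<otimes>\<^bsub>H\<^esub> (counit C e \<odot>\<^bsub>H\<^esub> g)) h2 d))))"
    using c by (intro sweedler_eq_tsumI) (simp_all add: lin)
  ultimately have "co ?T c (\<lambda>h d. co ?T d (?p h))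
    = dC ?T c (\<lambda>c1 c2. co ?T c1 (\<lambda>h d. co ?T c2 (\<lambda>g e. dH ?T h (\<lambda>h1 h2.
        ?p (h1 \<otimes>\<^bsub>H\<^esub> (counit C e \<odot>\<^bsub>H\<^esub> g)) h2 d))))"
    using LPCC3_right[OF c] by simp
  from arg_cong[OF this, of "\<lambda>z. tsum R H (tensor R H C) P z (\<lambda>a w. tsum R H C P w (f a))"]
  have "co P c (\<lambda>h d. co P d (f h)) = dC P c (\<lambda>c1 c2. co P c1 (\<lambda>h d. co P c2 (\<lambda>g e. dH P h (\<lambda>h1 h2.
        f (h1 \<otimes>\<^bsub>H\<^esub> (counit C e \<odot>\<^bsub>H\<^esub> g)) h2 d))))"
    using c by (simp add: lin tsum_tsum tsum_pure P trilinear_map_use[OF f] cong: tsum_cong)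
  also have "\<dots> = dC P c (\<lambda>c1 c2. co P c1 (\<lambda>h d. dH P h (\<lambda>h1 h2. f (h1 \<otimes>\<^bsub>H\<^esub> \<nabla> c2) h2 d)))"
  proof (rule tsum_cong[OF refl], rule tsum_cong[OF refl])
    fix c1 c2 h d assume [simp]: "c1 \<in> carrier C" "c2 \<in> carrier C" "h \<in> carrier H" "d \<in> carrier C"
    let ?F = "\<lambda>w. dH P h (\<lambda>h1 h2. f (h1 \<otimes>\<^bsub>H\<^esub> w) h2 d)"
    have F: "linear_map R H P ?F" by (simp add: lin P trilinear_map_use[OF f])
    have "co P c2 (\<lambda>g e. ?F (counit C e \<odot>\<^bsub>H\<^esub> g)) = co P c2 (\<lambda>g e. counit C e \<odot>\<^bsub>P\<^esub> ?F g)"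
      by (intro tsum_cong refl linear_map_smult[OF F]) (simp_all add: lin)
    also have "\<dots> = ?F (\<nabla> c2)" by (rule nabla_tsum[OF P F]) simp
    finally show "co P c2 (\<lambda>g e. ?F (counit C e \<odot>\<^bsub>H\<^esub> g)) = ?F (\<nabla> c2)" .
  qed
  finally show ?thesis .
qed

section \<open>Absorption and idempotence of nabla\<close>

lemma nabla_absorb_right:
  assumes P: "module R P" and f: "bilinear_map R H C P f" and c: "c \<in> carrier C"
  shows "dC P c (\<lambda>c1 c2. co P c1 (\<lambda>h d. f (h \<otimes>\<^bsub>H\<^esub> \<nabla> c2) d)) = co P c f"
proof -
  \<comment> \<open>The counit is put on the last leg of LPCC1: on one side it undoes the
    comultiplication of \<open>d\<close>, on the other it turns the coaction on \<open>c2\<close>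
    into \<open>\<nabla> c2\<close>.\<close>
  have "co P c f = co P c (\<lambda>h d. dC P d (\<lambda>d1 d2. counit C d2 \<odot>\<^bsub>P\<^esub> f h d1))"
    by (intro tsum_cong refl C.counit_right_tsum[symmetric] P)
      (simp_all add: lin bilinear_map_use[OF f])
  also have "\<dots> = dC P c (\<lambda>c1 c2. co P c1 (\<lambda>h d. co P c2 (\<lambda>g e. counit C e \<odot>\<^bsub>P\<^esub> f (h \<otimes>\<^bsub>H\<^esub> g) d)))"
    by (rule LPCC1_tsum[OF P _ c]) (simp add: lin P bilinear_map_use[OF f])
  also have "\<dots> = dC P c (\<lambda>c1 c2. co P c1 (\<lambda>h d. f (h \<otimes>\<^bsub>H\<^esub> \<nabla> c2) d))"
    by (rule tsum_cong[OF refl], rule tsum_cong[OF refl], rule nabla_tsum[OF P])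
      (simp_all add: lin bilinear_map_use[OF f])
  finally show ?thesis ..
qed

text \<open>Mirror image, with the counit on the middle leg of LPCC1. The resulting scalar has to be
  moved across the sum over \<open>coact c2\<close> before the sum over \<open>coact c1\<close> can
  become \<open>\<nabla> c1\<close>.\<close>

lemma nabla_absorb_left:
  assumes P: "module R P" and f: "bilinear_map R H C P f" and c: "c \<in> carrier C"
  shows "dC P c (\<lambda>c1 c2. co P c2 (\<lambda>h d. f (\<nabla> c1 \<otimes>\<^bsub>H\<^esub> h) d)) = co P c f"
proof -
  have "co P c f = co P c (\<lambda>h d. dC P d (\<lambda>d1 d2. counit C d1 \<odot>\<^bsub>P\<^esub> f h d2))"
    by (intro tsum_cong refl C.counit_left_tsum[symmetric] P)
      (simp_all add: lin bilinear_map_use[OF f])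
  also have "\<dots> = dC P c (\<lambda>c1 c2. co P c1 (\<lambda>h d. co P c2 (\<lambda>g e. counit C d \<odot>\<^bsub>P\<^esub> f (h \<otimes>\<^bsub>H\<^esub> g) e)))"
    by (rule LPCC1_tsum[OF P _ c]) (simp add: lin P bilinear_map_use[OF f])
  also have "\<dots> = dC P c (\<lambda>c1 c2. co P c2 (\<lambda>g e. f (\<nabla> c1 \<otimes>\<^bsub>H\<^esub> g) e))"
  proof (rule tsum_cong[OF refl])
    fix c1 c2 assume [simp]: "c1 \<in> carrier C" "c2 \<in> carrier C"
    have "co P c1 (\<lambda>h d. co P c2 (\<lambda>g e. counit C d \<odot>\<^bsub>P\<^esub> f (h \<otimes>\<^bsub>H\<^esub> g) e))
      = co P c1 (\<lambda>h d. counit C d \<odot>\<^bsub>P\<^esub> co P c2 (\<lambda>g e. f (h \<otimes>\<^bsub>H\<^esub> g) e))"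
      by (rule tsum_cong[OF refl], rule linear_of_tsum[symmetric])
        (simp_all add: lin P bilinear_map_use[OF f])
    also have "\<dots> = co P c2 (\<lambda>g e. f (\<nabla> c1 \<otimes>\<^bsub>H\<^esub> g) e)"
      by (rule nabla_tsum[OF P]) (simp_all add: lin P bilinear_map_use[OF f])
    finally show "co P c1 (\<lambda>h d. co P c2 (\<lambda>g e. counit C d \<odot>\<^bsub>P\<^esub> f (h \<otimes>\<^bsub>H\<^esub> g) e))
      = co P c2 (\<lambda>g e. f (\<nabla> c1 \<otimes>\<^bsub>H\<^esub> g) e)" .
  qed
  finally show ?thesis ..
qed

text \<open>Apply the counit to the remaining leg of \<open>nabla_absorb_left\<close>.\<close>

lemma nabla_idem:
  assumes P: "module R P" and f: "linear_map R H P f" and c: "c \<in> carrier C"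
  shows "dC P c (\<lambda>c1 c2. f (\<nabla> c1 \<otimes>\<^bsub>H\<^esub> \<nabla> c2)) = f (\<nabla> c)"
proof -
  have "dC P c (\<lambda>c1 c2. f (\<nabla> c1 \<otimes>\<^bsub>H\<^esub> \<nabla> c2))
    = dC P c (\<lambda>c1 c2. co P c2 (\<lambda>h d. counit C d \<odot>\<^bsub>P\<^esub> f (\<nabla> c1 \<otimes>\<^bsub>H\<^esub> h)))"
    by (rule tsum_cong[OF refl], rule nabla_tsum[OF P, symmetric])
      (simp_all add: lin linear_map_use[OF f])
  also have "\<dots> = co P c (\<lambda>h d. counit C d \<odot>\<^bsub>P\<^esub> f h)"
    by (rule nabla_absorb_left[OF P _ c]) (simp add: lin P linear_map_use[OF f])
  also have "\<dots> = f (\<nabla> c)" by (rule nabla_tsum[OF P f c])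
  finally show ?thesis .
qed

section \<open>The two expansions of the coaction followed by nabla\<close>

lemma coact_nabla_left:
  assumes P: "module R P" and f: "bilinear_map R H H P f" and c: "c \<in> carrier C"
  shows "co P c (\<lambda>h d. f h (\<nabla> d))
    = dC P c (\<lambda>c1 c2. dH P (\<nabla> c2) (\<lambda>g1 g2. f (\<nabla> c1 \<otimes>\<^bsub>H\<^esub> g1) g2))"
proof -
  have "co P c (\<lambda>h d. f h (\<nabla> d)) = co P c (\<lambda>h d. co P d (\<lambda>g e. counit C e \<odot>\<^bsub>P\<^esub> f h g))"
    by (rule tsum_cong[OF refl], rule nabla_tsum[OF P, symmetric])
      (simp_all add: lin bilinear_map_use[OF f])
  also have "\<dots> = dC P c (\<lambda>c1 c2. co P c2 (\<lambda>g e. dH P g (\<lambda>g1 g2.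
      counit C e \<odot>\<^bsub>P\<^esub> f (\<nabla> c1 \<otimes>\<^bsub>H\<^esub> g1) g2)))"
    by (rule LPCC3_left_tsum[OF P _ c]) (simp add: lin P bilinear_map_use[OF f])
  also have "\<dots> = dC P c (\<lambda>c1 c2. co P c2 (\<lambda>g e. counit C e \<odot>\<^bsub>P\<^esub> dH P g (\<lambda>g1 g2.
      f (\<nabla> c1 \<otimes>\<^bsub>H\<^esub> g1) g2)))"
    by (rule tsum_cong[OF refl], rule tsum_cong[OF refl], rule linear_of_tsum[symmetric])
      (simp_all add: lin P bilinear_map_use[OF f])
  also have "\<dots> = dC P c (\<lambda>c1 c2. dH P (\<nabla> c2) (\<lambda>g1 g2. f (\<nabla> c1 \<otimes>\<^bsub>H\<^esub> g1) g2))"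
    by (rule tsum_cong[OF refl], rule nabla_tsum[OF P]) (simp_all add: lin P bilinear_map_use[OF f])
  finally show ?thesis .
qed

lemma coact_nabla_right:
  assumes P: "module R P" and f: "bilinear_map R H H P f" and c: "c \<in> carrier C"
  shows "co P c (\<lambda>h d. f h (\<nabla> d))
    = dC P c (\<lambda>c1 c2. dH P (\<nabla> c1) (\<lambda>g1 g2. f (g1 \<otimes>\<^bsub>H\<^esub> \<nabla> c2) g2))"
proof -
  have "co P c (\<lambda>h d. f h (\<nabla> d)) = co P c (\<lambda>h d. co P d (\<lambda>g e. counit C e \<odot>\<^bsub>P\<^esub> f h g))"
    by (rule tsum_cong[OF refl], rule nabla_tsum[OF P, symmetric])
      (simp_all add: lin bilinear_map_use[OF f])
  also have "\<dots> = dC P c (\<lambda>c1 c2. co P c1 (\<lambda>g e. dH P g (\<lambda>g1 g2.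
      counit C e \<odot>\<^bsub>P\<^esub> f (g1 \<otimes>\<^bsub>H\<^esub> \<nabla> c2) g2)))"
    by (rule LPCC3_right_tsum[OF P _ c]) (simp add: lin P bilinear_map_use[OF f])
  also have "\<dots> = dC P c (\<lambda>c1 c2. co P c1 (\<lambda>g e. counit C e \<odot>\<^bsub>P\<^esub> dH P g (\<lambda>g1 g2.
      f (g1 \<otimes>\<^bsub>H\<^esub> \<nabla> c2) g2)))"
    by (rule tsum_cong[OF refl], rule tsum_cong[OF refl], rule linear_of_tsum[symmetric])
      (simp_all add: lin P bilinear_map_use[OF f])
  also have "\<dots> = dC P c (\<lambda>c1 c2. dH P (\<nabla> c1) (\<lambda>g1 g2. f (g1 \<otimes>\<^bsub>H\<^esub> \<nabla> c2) g2))"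
    by (rule tsum_cong[OF refl], rule nabla_tsum[OF P]) (simp_all add: lin P bilinear_map_use[OF f])
  finally show ?thesis .
qed

text \<open>Once the two counits are commuted in \<open>R\<close>, the sum that defines
  \<open>\<nabla> c\<close> has the form of LPCC2 with values in the regular module.\<close>

lemma counit_nabla:
  assumes c: "c \<in> carrier C" shows "counit H (\<nabla> c) = counit C c"
proof -
  have "counit H (\<nabla> c) = co (regular_module R) c (\<lambda>h d. counit C d \<odot>\<^bsub>regular_module R\<^esub> counit H h)"
    using c by (simp add: nabla_tsum lin)
  also have "\<dots> = co (regular_module R) c (\<lambda>h d. counit H h \<odot>\<^bsub>regular_module R\<^esub> counit C d)"
    by (intro tsum_cong refl) (simp add: smult_regular_module lin R.m_comm)
  also have "\<dots> = counit C c"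
    using c by (simp add: LPCC2_tsum lin)
  finally show ?thesis .
qed

lemma comult_nabla_idem:
  assumes P: "module R P" and f: "bilinear_map R H H P f" and c: "c \<in> carrier C"
  shows "dC P c (\<lambda>c1 c2. dH P (\<nabla> c1) (\<lambda>m1 m2. dH P (\<nabla> c2) (\<lambda>n1 n2.
    f (m1 \<otimes>\<^bsub>H\<^esub> n1) (m2 \<otimes>\<^bsub>H\<^esub> n2)))) = dH P (\<nabla> c) f"
proof -
  have "dC P c (\<lambda>c1 c2. dH P (\<nabla> c1) (\<lambda>m1 m2. dH P (\<nabla> c2) (\<lambda>n1 n2.
      f (m1 \<otimes>\<^bsub>H\<^esub> n1) (m2 \<otimes>\<^bsub>H\<^esub> n2)))) = dC P c (\<lambda>c1 c2. dH P (\<nabla> c1 \<otimes>\<^bsub>H\<^esub> \<nabla> c2) f)"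
    by (rule tsum_cong[OF refl], rule comult_mult_tsum[symmetric]) (simp_all add: lin P f)
  also have "\<dots> = dH P (\<nabla> c) f"
    by (rule nabla_idem[OF P _ c]) (simp add: lin P f)
  finally show ?thesis .
qed

text \<open>The expansion is switched in the middle. Expanding the coaction on \<open>c1\<close> by
  \<open>coact_nabla_right\<close> leaves, on the last two legs of \<open>c\<close>, exactly the
  shape of \<open>coact_nabla_left\<close>. Trading that for \<open>coact_nabla_right\<close> brings
  the comultiplied values \<open>\<nabla> a\<close> and \<open>\<nabla> b\<close> next to each
  other, and \<open>comult_nabla_idem\<close> merges them.\<close>

lemma coact_comult_nabla:
  assumes P: "module R P" and f: "bilinear_map R H H P f" and c: "c \<in> carrier C"
  shows "dC P c (\<lambda>c1 c2. co P c1 (\<lambda>g y. dH P (\<nabla> c2) (\<lambda>n1 n2.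
      f (g \<otimes>\<^bsub>H\<^esub> n1) (\<nabla> y \<otimes>\<^bsub>H\<^esub> n2)))) = co P c (\<lambda>g y. f g (\<nabla> y))"
proof -
  note [simp] = lin P bilinear_map_use[OF f]
  have "dC P c (\<lambda>c1 c2. co P c1 (\<lambda>g y. dH P (\<nabla> c2) (\<lambda>n1 n2.
      f (g \<otimes>\<^bsub>H\<^esub> n1) (\<nabla> y \<otimes>\<^bsub>H\<^esub> n2))))
    = dC P c (\<lambda>c1 c2. dC P c1 (\<lambda>a b. dH P (\<nabla> a) (\<lambda>m1 m2. dH P (\<nabla> c2) (\<lambda>n1 n2.
        f ((m1 \<otimes>\<^bsub>H\<^esub> \<nabla> b) \<otimes>\<^bsub>H\<^esub> n1) (m2 \<otimes>\<^bsub>H\<^esub> n2)))))"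
    by (rule tsum_cong[OF refl], rule coact_nabla_right[OF P, where f = "\<lambda>g w. dH P (\<nabla> _) (\<lambda>n1 n2.
      f (g \<otimes>\<^bsub>H\<^esub> n1) (w \<otimes>\<^bsub>H\<^esub> n2))"]) simp_all
  also have "\<dots> = dC P c (\<lambda>a c'. dC P c' (\<lambda>b c2. dH P (\<nabla> a) (\<lambda>m1 m2. dH P (\<nabla> c2) (\<lambda>n1 n2.
        f ((m1 \<otimes>\<^bsub>H\<^esub> \<nabla> b) \<otimes>\<^bsub>H\<^esub> n1) (m2 \<otimes>\<^bsub>H\<^esub> n2)))))"
    by (rule C.coassoc_tsum[OF P _ c]) simp
  also have "\<dots> = dC P c (\<lambda>a c'. dH P (\<nabla> a) (\<lambda>m1 m2. dC P c' (\<lambda>b c2. dH P (\<nabla> c2) (\<lambda>n1 n2.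
        f (m1 \<otimes>\<^bsub>H\<^esub> (\<nabla> b \<otimes>\<^bsub>H\<^esub> n1)) (m2 \<otimes>\<^bsub>H\<^esub> n2)))))"
    by (rule tsum_cong[OF refl], subst tsum_swap) (simp_all add: m_assoc cong: tsum_cong)
  also have "\<dots> = dC P c (\<lambda>a c'. dH P (\<nabla> a) (\<lambda>m1 m2. co P c' (\<lambda>g y. f (m1 \<otimes>\<^bsub>H\<^esub> g) (m2 \<otimes>\<^bsub>H\<^esub> \<nabla> y))))"
    by (rule tsum_cong[OF refl], rule tsum_cong[OF refl], rule coact_nabla_left[OF P, symmetric,
      where f = "\<lambda>p q. f (_ \<otimes>\<^bsub>H\<^esub> p) (_ \<otimes>\<^bsub>H\<^esub> q)"]) simp_all
  also have "\<dots> = dC P c (\<lambda>a c'. dH P (\<nabla> a) (\<lambda>m1 m2. dC P c' (\<lambda>b d. dH P (\<nabla> b) (\<lambda>n1 n2.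
        f (m1 \<otimes>\<^bsub>H\<^esub> (n1 \<otimes>\<^bsub>H\<^esub> \<nabla> d)) (m2 \<otimes>\<^bsub>H\<^esub> n2)))))"
    by (rule tsum_cong[OF refl], rule tsum_cong[OF refl], rule coact_nabla_right[OF P,
      where f = "\<lambda>p q. f (_ \<otimes>\<^bsub>H\<^esub> p) (_ \<otimes>\<^bsub>H\<^esub> q)"]) simp_all
  also have "\<dots> = dC P c (\<lambda>a c'. dC P c' (\<lambda>b d. dH P (\<nabla> a) (\<lambda>m1 m2. dH P (\<nabla> b) (\<lambda>n1 n2.
        f ((m1 \<otimes>\<^bsub>H\<^esub> n1) \<otimes>\<^bsub>H\<^esub> \<nabla> d) (m2 \<otimes>\<^bsub>H\<^esub> n2)))))"
    by (rule tsum_cong[OF refl], subst tsum_swap) (simp_all add: m_assoc cong: tsum_cong)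
  also have "\<dots> = dC P c (\<lambda>c' d. dC P c' (\<lambda>a b. dH P (\<nabla> a) (\<lambda>m1 m2. dH P (\<nabla> b) (\<lambda>n1 n2.
        f ((m1 \<otimes>\<^bsub>H\<^esub> n1) \<otimes>\<^bsub>H\<^esub> \<nabla> d) (m2 \<otimes>\<^bsub>H\<^esub> n2)))))"
    by (rule C.coassoc_tsum[OF P _ c, symmetric]) simp
  also have "\<dots> = dC P c (\<lambda>c' d. dH P (\<nabla> c') (\<lambda>m1 m2. f (m1 \<otimes>\<^bsub>H\<^esub> \<nabla> d) m2))"
    by (rule tsum_cong[OF refl], rule comult_nabla_idem[OF P, where f = "\<lambda>p q. f (p \<otimes>\<^bsub>H\<^esub> \<nabla> _) q"])
      simp_all
  also have "\<dots> = co P c (\<lambda>g y. f g (\<nabla> y))"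
    by (rule coact_nabla_right[OF P f c, symmetric])
  finally show ?thesis .
qed

text \<open>Lifts \<open>coact_comult_nabla\<close> from \<open>\<nabla> y\<close> to
  \<open>y\<close> itself, for maps that identify y \<otimes> b with y_1 \<otimes> \<nabla>(y_2) b,
  as maps out of the cosmash coproduct do. Stability creates a factor \<open>\<nabla> y2\<close>,
  LPCC1 moves \<open>y2\<close> to a leg of \<open>c\<close> of its own, the previous lemma removes
  \<open>\<nabla> c2\<close> there, and the first two moves are undone.\<close>

lemma coact_comult_nabla_stable:
  assumes P: "module R P" and f: "trilinear_map R H C H P f" and c: "c \<in> carrier C"
    and stable: "\<And>a y b. a \<in> carrier H \<Longrightarrow> y \<in> carrier C \<Longrightarrow> b \<in> carrier H \<Longrightarrow>
      dC P y (\<lambda>y1 y2. f a y1 (\<nabla> y2 \<otimes>\<^bsub>H\<^esub> b)) = f a y b"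
  shows "dC P c (\<lambda>c1 c2. co P c1 (\<lambda>g y. dH P (\<nabla> c2) (\<lambda>n1 n2. f (g \<otimes>\<^bsub>H\<^esub> n1) y n2)))
    = co P c (\<lambda>g y. f g y \<one>\<^bsub>H\<^esub>)"
proof -
  note [simp] = lin P trilinear_map_use[OF f]
  have "dC P c (\<lambda>c1 c2. co P c1 (\<lambda>g y. dH P (\<nabla> c2) (\<lambda>n1 n2. f (g \<otimes>\<^bsub>H\<^esub> n1) y n2)))
    = dC P c (\<lambda>c1 c2. co P c1 (\<lambda>g y. dC P y (\<lambda>y1 y2. dH P (\<nabla> c2) (\<lambda>n1 n2.
        f (g \<otimes>\<^bsub>H\<^esub> n1) y1 (\<nabla> y2 \<otimes>\<^bsub>H\<^esub> n2)))))"
    by (rule tsum_cong[OF refl], rule tsum_cong[OF refl], subst tsum_swap)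
      (simp_all add: stable cong: tsum_cong)
  also have "\<dots> = dC P c (\<lambda>c' c2. dC P c' (\<lambda>a b. co P a (\<lambda>g y1. co P b (\<lambda>k y2. dH P (\<nabla> c2) (\<lambda>n1 n2.
        f ((g \<otimes>\<^bsub>H\<^esub> k) \<otimes>\<^bsub>H\<^esub> n1) y1 (\<nabla> y2 \<otimes>\<^bsub>H\<^esub> n2))))))"
    by (rule tsum_cong[OF refl], rule LPCC1_tsum[OF P, where f = "\<lambda>g y1 y2. dH P (\<nabla> _) (\<lambda>n1 n2.
        f (g \<otimes>\<^bsub>H\<^esub> n1) y1 (\<nabla> y2 \<otimes>\<^bsub>H\<^esub> n2))"]) simp_all
  also have "\<dots> = dC P c (\<lambda>a c'. dC P c' (\<lambda>b c2. co P a (\<lambda>g y1. co P b (\<lambda>k y2. dH P (\<nabla> c2) (\<lambda>n1 n2.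
        f ((g \<otimes>\<^bsub>H\<^esub> k) \<otimes>\<^bsub>H\<^esub> n1) y1 (\<nabla> y2 \<otimes>\<^bsub>H\<^esub> n2))))))"
    by (rule C.coassoc_tsum[OF P _ c]) simp
  also have "\<dots> = dC P c (\<lambda>a c'. co P a (\<lambda>g y1. dC P c' (\<lambda>b c2. co P b (\<lambda>k y2. dH P (\<nabla> c2) (\<lambda>n1 n2.
        f (g \<otimes>\<^bsub>H\<^esub> (k \<otimes>\<^bsub>H\<^esub> n1)) y1 (\<nabla> y2 \<otimes>\<^bsub>H\<^esub> n2))))))"
    by (rule tsum_cong[OF refl], subst tsum_swap) (simp_all add: m_assoc cong: tsum_cong)
  also have "\<dots> = dC P c (\<lambda>a c'. co P a (\<lambda>g y1. co P c' (\<lambda>k y2. f (g \<otimes>\<^bsub>H\<^esub> k) y1 (\<nabla> y2))))"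
    by (rule tsum_cong[OF refl], rule tsum_cong[OF refl], rule coact_comult_nabla[OF P,
        where f = "\<lambda>p q. f (_ \<otimes>\<^bsub>H\<^esub> p) _ q"]) simp_all
  also have "\<dots> = co P c (\<lambda>g y. dC P y (\<lambda>y1 y2. f g y1 (\<nabla> y2)))"
    by (rule LPCC1_tsum[OF P _ c, symmetric]) simp
  also have "\<dots> = co P c (\<lambda>g y. f g y \<one>\<^bsub>H\<^esub>)"
    by (rule tsum_cong[OF refl], subst stable[symmetric]) (simp_all cong: tsum_cong)
  finally show ?thesis .
qed

section \<open>Cancelling antipodes against the coaction\<close>

lemma coact_comult_antipode_nabla:
  assumes P: "module R P" and f: "bilinear_map R H H P f" and c: "c \<in> carrier C"
  shows "co P c (\<lambda>g y. dH P g (\<lambda>g1 g2. f g1 (g2 \<otimes>\<^bsub>H\<^esub> antipode H (\<nabla> y))))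
    = co P c (\<lambda>g y. f g (\<nabla> y))"
proof -
  note [simp] = lin P bilinear_map_use[OF f]
  \<comment> \<open>The left expansion separates \<open>\<nabla> b\<close> into two legs. The first
    one, comultiplied, cancels the antipode of the second, and what remains is the right expansion
    of the same element.\<close>
  have "co P c (\<lambda>g y. dH P g (\<lambda>g1 g2. f g1 (g2 \<otimes>\<^bsub>H\<^esub> antipode H (\<nabla> y))))
    = dC P c (\<lambda>a b. dH P (\<nabla> b) (\<lambda>p q. dH P (\<nabla> a \<otimes>\<^bsub>H\<^esub> p) (\<lambda>g1 g2. f g1 (g2 \<otimes>\<^bsub>H\<^esub> antipode H q))))"
    by (rule coact_nabla_left[OF P _ c,
      where f = "\<lambda>g w. dH P g (\<lambda>g1 g2. f g1 (g2 \<otimes>\<^bsub>H\<^esub> antipode H w))"])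
      simp
  also have "\<dots> = dC P c (\<lambda>a b. dH P (\<nabla> b) (\<lambda>p q. dH P (\<nabla> a) (\<lambda>n1 n2. dH P p (\<lambda>p1 p2.
      f (n1 \<otimes>\<^bsub>H\<^esub> p1) (n2 \<otimes>\<^bsub>H\<^esub> (p2 \<otimes>\<^bsub>H\<^esub> antipode H q))))))"
    by (rule tsum_cong[OF refl], rule tsum_cong[OF refl], subst comult_mult_tsum)
      (simp_all add: m_assoc cong: tsum_cong)
  also have "\<dots> = dC P c (\<lambda>a b. dH P (\<nabla> a) (\<lambda>n1 n2. dH P (\<nabla> b) (\<lambda>p q. dH P p (\<lambda>p1 p2.
      f (n1 \<otimes>\<^bsub>H\<^esub> p1) (n2 \<otimes>\<^bsub>H\<^esub> (p2 \<otimes>\<^bsub>H\<^esub> antipode H q))))))"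
    by (rule tsum_cong[OF refl], rule tsum_swap) simp_all
  also have "\<dots> = dC P c (\<lambda>a b. dH P (\<nabla> a) (\<lambda>n1 n2. dH P (\<nabla> b) (\<lambda>p1 p'. dH P p' (\<lambda>p2 q.
      f (n1 \<otimes>\<^bsub>H\<^esub> p1) (n2 \<otimes>\<^bsub>H\<^esub> (p2 \<otimes>\<^bsub>H\<^esub> antipode H q))))))"
    by (rule tsum_cong[OF refl], rule tsum_cong[OF refl], rule H.coassoc_tsum[OF P]) simp_all
  also have "\<dots> = dC P c (\<lambda>a b. dH P (\<nabla> a) (\<lambda>n1 n2. f (n1 \<otimes>\<^bsub>H\<^esub> \<nabla> b) (n2 \<otimes>\<^bsub>H\<^esub> \<one>\<^bsub>H\<^esub>)))"
    by (rule tsum_cong[OF refl], rule tsum_cong[OF refl], rule antipode_cancel_right[OF P,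
        where f = "\<lambda>p q. f (_ \<otimes>\<^bsub>H\<^esub> p) (_ \<otimes>\<^bsub>H\<^esub> q)"]) simp_all
  also have "\<dots> = dC P c (\<lambda>a b. dH P (\<nabla> a) (\<lambda>n1 n2. f (n1 \<otimes>\<^bsub>H\<^esub> \<nabla> b) n2))"
    by (simp cong: tsum_cong)
  also have "\<dots> = co P c (\<lambda>g y. f g (\<nabla> y))"
    by (rule coact_nabla_right[OF P f c, symmetric])
  finally show ?thesis .
qed

text \<open>After the left expansion three consecutive legs of \<open>\<nabla> b\<close> are
  present, the first two in the form p S(q_1), and they cancel.\<close>

lemma coact_antipode_comult_nabla:
  assumes P: "module R P" and f: "bilinear_map R H H P f" and c: "c \<in> carrier C"
  shows "co P c (\<lambda>g y. dH P (\<nabla> y) (\<lambda>n1 n2. f (g \<otimes>\<^bsub>H\<^esub> antipode H n1) n2))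
    = dC P c (\<lambda>a b. f (\<nabla> a) (\<nabla> b))"
proof -
  note [simp] = lin P bilinear_map_use[OF f]
  have "co P c (\<lambda>g y. dH P (\<nabla> y) (\<lambda>n1 n2. f (g \<otimes>\<^bsub>H\<^esub> antipode H n1) n2))
    = dC P c (\<lambda>a b. dH P (\<nabla> b) (\<lambda>p q. dH P q (\<lambda>q1 q2. f ((\<nabla> a \<otimes>\<^bsub>H\<^esub> p) \<otimes>\<^bsub>H\<^esub> antipode H q1) q2)))"
    by (rule coact_nabla_left[OF P _ c,
      where f = "\<lambda>g w. dH P w (\<lambda>n1 n2. f (g \<otimes>\<^bsub>H\<^esub> antipode H n1) n2)"])
      simp
  also have "\<dots> = dC P c (\<lambda>a b. dH P (\<nabla> b) (\<lambda>p q. dH P q (\<lambda>q1 q2. f (\<nabla> a \<otimes>\<^bsub>H\<^esub> (p \<otimes>\<^bsub>H\<^esub> antipode H q1)) q2)))"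
    by (simp add: m_assoc cong: tsum_cong)
  also have "\<dots> = dC P c (\<lambda>a b. f (\<nabla> a \<otimes>\<^bsub>H\<^esub> \<one>\<^bsub>H\<^esub>) (\<nabla> b))"
    by (rule tsum_cong[OF refl], rule antipode_cancel_left[OF P, where f = "\<lambda>p q. f (_ \<otimes>\<^bsub>H\<^esub> p) q"])
      simp_all
  also have "\<dots> = dC P c (\<lambda>a b. f (\<nabla> a) (\<nabla> b))"
    by (simp cong: tsum_cong)
  finally show ?thesis .
qed

text \<open>LPCC3 replaces the iterated coaction by a comultiplied one, to which
  \<open>coact_comult_antipode_nabla\<close> applies; the factor \<open>\<nabla> c1\<close> that
  LPCC3 leaves behind is then absorbed.\<close>

lemma coact_coact_antipode_nabla:
  assumes P: "module R P" and f: "bilinear_map R H H P f" and c: "c \<in> carrier C"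
  shows "co P c (\<lambda>g y. co P y (\<lambda>k z. f g (k \<otimes>\<^bsub>H\<^esub> antipode H (\<nabla> z)))) = co P c (\<lambda>g y. f g (\<nabla> y))"
proof -
  note [simp] = lin P bilinear_map_use[OF f]
  have "co P c (\<lambda>g y. co P y (\<lambda>k z. f g (k \<otimes>\<^bsub>H\<^esub> antipode H (\<nabla> z))))
    = dC P c (\<lambda>c1 c2. co P c2 (\<lambda>g y. dH P g (\<lambda>g1 g2.
        f (\<nabla> c1 \<otimes>\<^bsub>H\<^esub> g1) (g2 \<otimes>\<^bsub>H\<^esub> antipode H (\<nabla> y)))))"
    by (rule LPCC3_left_tsum[OF P _ c, where f = "\<lambda>g k z. f g (k \<otimes>\<^bsub>H\<^esub> antipode H (\<nabla> z))"]) simp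
  also have "\<dots> = dC P c (\<lambda>c1 c2. co P c2 (\<lambda>g y. f (\<nabla> c1 \<otimes>\<^bsub>H\<^esub> g) (\<nabla> y)))"
    by (rule tsum_cong[OF refl], rule coact_comult_antipode_nabla[OF P,
        where f = "\<lambda>p q. f (_ \<otimes>\<^bsub>H\<^esub> p) q"]) simp_all
  also have "\<dots> = co P c (\<lambda>g y. f g (\<nabla> y))"
    by (rule nabla_absorb_left[OF P _ c]) simp
  finally show ?thesis .
qed

text \<open>LPCC3 replaces the iterated coaction by a comultiplied one. Here both legs of
  \<open>g\<close> meet in the antipode axiom, and the counit that is left removes the coaction on
  \<open>c2\<close> by LPCC2.\<close>

lemma coact_antipode_coact_nabla:
  assumes P: "module R P" and f: "bilinear_map R H H P f" and c: "c \<in> carrier C"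
  shows "co P c (\<lambda>g y. co P y (\<lambda>k z. f (g \<otimes>\<^bsub>H\<^esub> antipode H k) (\<nabla> z)))
    = dC P c (\<lambda>a b. f (\<nabla> a) (\<nabla> b))"
proof -
  note [simp] = lin P bilinear_map_use[OF f]
  have "co P c (\<lambda>g y. co P y (\<lambda>k z. f (g \<otimes>\<^bsub>H\<^esub> antipode H k) (\<nabla> z)))
    = dC P c (\<lambda>c1 c2. co P c2 (\<lambda>g y. dH P g (\<lambda>g1 g2.
        f ((\<nabla> c1 \<otimes>\<^bsub>H\<^esub> g1) \<otimes>\<^bsub>H\<^esub> antipode H g2) (\<nabla> y))))"
    by (rule LPCC3_left_tsum[OF P _ c, where f = "\<lambda>g k z. f (g \<otimes>\<^bsub>H\<^esub> antipode H k) (\<nabla> z)"]) simp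
  also have "\<dots> = dC P c (\<lambda>c1 c2. co P c2 (\<lambda>g y. dH P g (\<lambda>g1 g2.
        f (\<nabla> c1 \<otimes>\<^bsub>H\<^esub> (g1 \<otimes>\<^bsub>H\<^esub> antipode H g2)) (\<nabla> y))))"
    by (simp add: m_assoc cong: tsum_cong)
  also have "\<dots> = dC P c (\<lambda>c1 c2. co P c2 (\<lambda>g y. counit H g \<odot>\<^bsub>P\<^esub> f (\<nabla> c1 \<otimes>\<^bsub>H\<^esub> \<one>\<^bsub>H\<^esub>) (\<nabla> y)))"
    by (rule tsum_cong[OF refl], rule tsum_cong[OF refl], rule antipode_right_tsum[OF P,
        where f = "\<lambda>w. f (_ \<otimes>\<^bsub>H\<^esub> w) _"]) simp_all
  also have "\<dots> = dC P c (\<lambda>c1 c2. f (\<nabla> c1 \<otimes>\<^bsub>H\<^esub> \<one>\<^bsub>H\<^esub>) (\<nabla> c2))"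
    by (rule tsum_cong[OF refl], rule LPCC2_tsum[OF P]) simp_all
  also have "\<dots> = dC P c (\<lambda>a b. f (\<nabla> a) (\<nabla> b))"
    by (simp cong: tsum_cong)
  finally show ?thesis .
qed

section \<open>The partial cosmash coproduct\<close>

abbreviation gen where "gen x h \<equiv> cosmash_gen R H C coact x h"

abbreviation D where "D \<equiv> cosmash R H C coact"

abbreviation T where "T \<equiv> tensor R C H"

lemma gen_eq:
  assumes "x \<in> carrier C" "h \<in> carrier H"
  shows "gen x h = dC T x (\<lambda>x1 x2. pure_tensor R C H x1 (\<nabla> x2 \<otimes>\<^bsub>H\<^esub> h))"
  unfolding cosmash_gen_def using assms by (intro sweedler_eq_tsumI) (simp_all add: lin)

abbreviation gens where "gens \<equiv> {gen x h | x h. x \<in> carrier C \<and> h \<in> carrier H}"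

lemma gens_subset: "gens \<subseteq> carrier T"
  by (auto simp: gen_eq lin)

lemma submodule_D: "submodule (module_span R T gens) R T"
  by (intro submodule_span gens_subset) (simp add: lin)

lemma cosmash_sel:
  "carrier D = module_span R T gens" "add D = add T" "zero D = zero T" "smult D = smult T"
  "comult D = cosmash_comult R H C coact" "counit D = cosmash_counit R H C coact"
  by (simp_all add: cosmash_def cosmash_module_def module.defs coalg.defs)

lemma cosmash_module_sel:
  "carrier (cosmash_module R H C coact) = module_span R T gens"
  "add (cosmash_module R H C coact) = add T" "zero (cosmash_module R H C coact) = zero T"
  "smult (cosmash_module R H C coact) = smult T"
  by (simp_all add: cosmash_module_def)

lemma module_D [lin]: "module R D"
proof -
  have "module R (T\<lparr>carrier := module_span R T gens\<rparr>)"
    by (rule submodule.submodule_is_module[OF submodule_D]) (simp add: lin)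
  then show ?thesis by (rule module_cong) (simp_all add: cosmash_sel)
qed

lemma gen_closed [lin]: "x \<in> carrier C \<Longrightarrow> h \<in> carrier H \<Longrightarrow> gen x h \<in> carrier D"
  using module_span_superset[of gens R T] by (auto simp: cosmash_sel)

lemma D_subset: "z \<in> carrier D \<Longrightarrow> z \<in> carrier T"
  using module.submoduleE(1)[OF _ submodule_D] by (auto simp: cosmash_sel lin)

lemma linear_map_inclusion: "linear_map R D T (\<lambda>z. z)"
  using D_subset by (auto simp: linear_map_def cosmash_sel)

lemma linear_map_into_D:
  assumes "linear_map R M T f" "\<And>x. x \<in> carrier M \<Longrightarrow> f x \<in> carrier D"
  shows "linear_map R M D f"
  using assms by (auto simp: linear_map_def cosmash_sel)

lemma linear_map_gen_left [lin]:
  assumes "linear_map R M C g" "h \<in> carrier H"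
  shows "linear_map R M D (\<lambda>x. gen (g x) h)"
proof (rule linear_map_compose[OF _ assms(1), where g = "\<lambda>x. gen x h"], rule linear_map_into_D)
  show "linear_map R C T (\<lambda>x. gen x h)"
    by (rule linear_map_cong[where g = "\<lambda>x. dC T x (\<lambda>x1 x2. pure_tensor R C H x1 (\<nabla> x2 \<otimes>\<^bsub>H\<^esub> h))"])
      (use assms(2) in \<open>simp_all add: gen_eq lin\<close>)
qed (simp add: lin assms(2))

lemma linear_map_gen_right [lin]:
  assumes "linear_map R M H g" "x \<in> carrier C"
  shows "linear_map R M D (\<lambda>h. gen x (g h))"
proof (rule linear_map_compose[OF _ assms(1), where g = "gen x"], rule linear_map_into_D)
  show "linear_map R H T (gen x)"
    by (rule linear_map_cong[where g = "\<lambda>h. dC T x (\<lambda>x1 x2. pure_tensor R C H x1 (\<nabla> x2 \<otimes>\<^bsub>H\<^esub> h))"])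
      (use assms(2) in \<open>simp_all add: gen_eq lin\<close>)
qed (simp add: lin assms(2))

lemma D_linear_eqI:
  assumes P: "module R P" and f: "linear_map R D P f" and g: "linear_map R D P g"
    and eq: "\<And>x h. x \<in> carrier C \<Longrightarrow> h \<in> carrier H \<Longrightarrow> f (gen x h) = g (gen x h)"
    and z: "z \<in> carrier D"
  shows "f z = g z"
proof (rule module_span_linear_eqI[OF P _ gens_subset submodule_D module_span_superset])
  show "linear_map R (T\<lparr>carrier := module_span R T gens\<rparr>) P f"
    "linear_map R (T\<lparr>carrier := module_span R T gens\<rparr>) P g"
    using f g by (simp_all add: linear_map_def cosmash_sel)
  show "module R T" by (simp add: lin)
  show "z \<in> module_span R T gens" using z by (simp add: cosmash_sel)
qed (use eq in auto)

text \<open>This is the idempotence of x \<otimes> h \<mapsto> \<open>gen x h\<close>: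
  coassociativity makes the two values of \<open>\<nabla>\<close> adjacent and
  \<open>nabla_idem\<close> merges them. It is first proved for the sum with values in
  \<open>D\<close>, so that an arbitrary linear map on \<open>D\<close> can be applied
  afterwards.\<close>

lemma gen_absorb:
  assumes P: "module R P" and f: "linear_map R D P f" and x: "x \<in> carrier C" and h: "h \<in> carrier H"
  shows "dC P x (\<lambda>x1 x2. f (gen x1 (\<nabla> x2 \<otimes>\<^bsub>H\<^esub> h))) = f (gen x h)"
proof -
  \<comment> \<open>\<open>gen\<close> is given by a formula in \<open>T\<close>, so the sum in
    \<open>D\<close> is carried along the inclusion.\<close>
  have "dC D x (\<lambda>x1 x2. gen x1 (\<nabla> x2 \<otimes>\<^bsub>H\<^esub> h)) = dC T x (\<lambda>x1 x2. gen x1 (\<nabla> x2 \<otimes>\<^bsub>H\<^esub> h))"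
    using x h by (intro linear_of_tsum[OF _ _ _ _ _ linear_map_inclusion]) (simp_all add: lin)
  also have "\<dots> = dC T x (\<lambda>x1 x2. dC T x1 (\<lambda>a b. pure_tensor R C H a (\<nabla> b \<otimes>\<^bsub>H\<^esub> (\<nabla> x2 \<otimes>\<^bsub>H\<^esub> h))))"
    using h by (intro tsum_cong refl gen_eq) (simp_all add: lin)
  also have "\<dots> = dC T x (\<lambda>a x'. dC T x' (\<lambda>b x2. pure_tensor R C H a (\<nabla> b \<otimes>\<^bsub>H\<^esub> (\<nabla> x2 \<otimes>\<^bsub>H\<^esub> h))))"
    using h by (intro C.coassoc_tsum x) (simp_all add: lin)
  also have "\<dots> = dC T x (\<lambda>a x'. dC T x' (\<lambda>b x2. pure_tensor R C H a ((\<nabla> b \<otimes>\<^bsub>H\<^esub> \<nabla> x2) \<otimes>\<^bsub>H\<^esub> h)))"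
    using h by (simp add: lin m_assoc cong: tsum_cong)
  also have "\<dots> = dC T x (\<lambda>a x'. pure_tensor R C H a (\<nabla> x' \<otimes>\<^bsub>H\<^esub> h))"
    by (rule tsum_cong[OF refl], rule nabla_idem[where f = "\<lambda>w. pure_tensor R C H _ (w \<otimes>\<^bsub>H\<^esub> h)"])
      (simp_all add: lin h)
  also have "\<dots> = gen x h" using x h by (simp add: gen_eq)
  finally have "gen x h = dC D x (\<lambda>x1 x2. gen x1 (\<nabla> x2 \<otimes>\<^bsub>H\<^esub> h))" ..
  then show ?thesis
    using x h by (simp add: linear_of_tsum[OF _ _ _ _ _ f] lin P)
qed

text \<open>Existence comes from restricting a map on \<open>T\<close> and uniqueness from the
  generators spanning \<open>D\<close>; together they make the description in
  \<open>linear_extension\<close> denote. The prescription \<open>f'\<close> is the formula as it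
  stands in a definition, \<open>f\<close> its multilinear form in terms of \<open>tsum\<close>; the
  two need only agree on the carriers.\<close>

lemma linear_extension_gen:
  assumes P: "module R P" and f: "bilinear_map R C H P f"
    and stable: "\<And>x h. x \<in> carrier C \<Longrightarrow> h \<in> carrier H \<Longrightarrow>
      dC P x (\<lambda>x1 x2. f x1 (\<nabla> x2 \<otimes>\<^bsub>H\<^esub> h)) = f x h"
    and f': "\<And>x h. x \<in> carrier C \<Longrightarrow> h \<in> carrier H \<Longrightarrow> f' (x, h) = f x h"
  defines "\<phi> \<equiv> linear_extension R D P (carrier C \<times> carrier H) (\<lambda>(x, h). gen x h) f'"
  shows "linear_map R D P \<phi>"
    and "x \<in> carrier C \<Longrightarrow> h \<in> carrier H \<Longrightarrow> \<phi> (gen x h) = f x h"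
proof -
  note [simp] = lin P bilinear_map_use[OF f]
  \<comment> \<open>The map on \<open>T\<close> induced by \<open>f\<close>, cut down to
    \<open>D\<close>. On \<open>gen x h\<close> it evaluates to the left-hand side of
    \<open>stable\<close>.\<close>
  define \<psi> where "\<psi> = (\<lambda>z\<in>carrier D. tsum R C H P z f)"
  have "linear_map R D P (\<lambda>z. tsum R C H P z f)"
    by (rule linear_map_compose[OF linear_map_tsum linear_map_inclusion]) (simp_all add: f)
  then have \<psi>: "linear_map R D P \<psi>"
    by (rule linear_map_cong[rotated]) (simp_all add: \<psi>_def)
  have \<psi>gen: "\<psi> (gen x h) = f x h" if [simp]: "x \<in> carrier C" "h \<in> carrier H" for x h
    using stable[OF that] by (simp add: \<psi>_def gen_eq[OF that] tsum_tsum tsum_pure f cong: tsum_cong)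
      (simp add: gen_eq[OF that, symmetric])
  have "\<phi> = \<psi>"
    unfolding \<phi>_def linear_extension_def
  proof (rule the_equality)
    show "\<psi> \<in> extensional (carrier D) \<and> linear_map R D P \<psi> \<and>
        (\<forall>i\<in>carrier C \<times> carrier H. \<psi> (case i of (x, h) \<Rightarrow> gen x h) = f' i)"
      using \<psi> \<psi>gen f' by (auto simp: \<psi>_def simp del: restrict_apply)
  next
    fix \<chi> assume \<chi>: "\<chi> \<in> extensional (carrier D) \<and> linear_map R D P \<chi> \<and>
        (\<forall>i\<in>carrier C \<times> carrier H. \<chi> (case i of (x, h) \<Rightarrow> gen x h) = f' i)"
    show "\<chi> = \<psi>"
    proof (rule extensionalityI)
      fix z assume z: "z \<in> carrier D"
      show "\<chi> z = \<psi> z"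
        by (rule D_linear_eqI[OF P _ \<psi> _ z]) (use \<chi> \<psi>gen f' in auto)
    qed (use \<chi> in \<open>auto simp: \<psi>_def\<close>)
  qed
  then show "linear_map R D P \<phi>"
    "x \<in> carrier C \<Longrightarrow> h \<in> carrier H \<Longrightarrow> \<phi> (gen x h) = f x h"
    using \<psi> \<psi>gen by simp_all
qed

section \<open>The maps omega0, counit and comultiplication on the cosmash coproduct\<close>

lemma omega0_linear: "linear_map R D H (omega0 R H C coact)"
  and omega0_gen: "x \<in> carrier C \<Longrightarrow> h \<in> carrier H \<Longrightarrow>
    omega0 R H C coact (gen x h) = \<nabla> x \<otimes>\<^bsub>H\<^esub> h"
proof -
  have st: "dC H x (\<lambda>x1 x2. \<nabla> x1 \<otimes>\<^bsub>H\<^esub> (\<nabla> x2 \<otimes>\<^bsub>H\<^esub> h)) = \<nabla> x \<otimes>\<^bsub>H\<^esub> h"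
    if "x \<in> carrier C" "h \<in> carrier H" for x h
    using that nabla_idem[of H "\<lambda>w. w \<otimes>\<^bsub>H\<^esub> h" x] by (simp add: lin m_assoc cong: tsum_cong)
  note * = linear_extension_gen[where P = H and f = "\<lambda>x h. \<nabla> x \<otimes>\<^bsub>H\<^esub> h"
      and f' = "\<lambda>(x, h). \<nabla> x \<otimes>\<^bsub>H\<^esub> h", OF _ _ st]
  show "linear_map R D H (omega0 R H C coact)"
    unfolding omega0_def by (rule *(1)) (simp_all add: lin)
  show "omega0 R H C coact (gen x h) = \<nabla> x \<otimes>\<^bsub>H\<^esub> h" if "x \<in> carrier C" "h \<in> carrier H"
    unfolding omega0_def using that by (intro *(2)) (simp_all add: lin)
qed

lemma counit_D:
  "counit D = linear_extension R D (regular_module R) (carrier C \<times> carrier H)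
      (\<lambda>(x, h). gen x h) (\<lambda>(x, h). counit C x \<otimes>\<^bsub>R\<^esub> counit H h)"
  by (simp add: cosmash_sel cosmash_counit_def linear_extension_def linear_map_def cosmash_module_sel)

lemma counit_D_linear: "linear_map R D (regular_module R) (counit D)"
  and counit_D_gen: "x \<in> carrier C \<Longrightarrow> h \<in> carrier H \<Longrightarrow>
    counit D (gen x h) = counit C x \<otimes>\<^bsub>R\<^esub> counit H h"
proof -
  let ?R = "regular_module R"
  \<comment> \<open>Multiplication in \<open>R\<close> is written as the scalar action on the
    regular module, the form in which the rules in \<open>lin\<close> recognise linearity.\<close>
  have bil: "bilinear_map R C H ?R (\<lambda>x h. counit C x \<otimes>\<^bsub>R\<^esub> counit H h)"
    unfolding smult_regular_module[symmetric] by (simp add: lin carrier_regular_module)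
  have st: "dC ?R x (\<lambda>x1 x2. counit C x1 \<otimes>\<^bsub>R\<^esub> counit H (\<nabla> x2 \<otimes>\<^bsub>H\<^esub> h)) = counit C x \<otimes>\<^bsub>R\<^esub> counit H h"
    if xh: "x \<in> carrier C" "h \<in> carrier H" for x h
  proof -
    have "dC ?R x (\<lambda>x1 x2. counit C x1 \<otimes>\<^bsub>R\<^esub> counit H (\<nabla> x2 \<otimes>\<^bsub>H\<^esub> h))
      = dC ?R x (\<lambda>x1 x2. counit C x1 \<odot>\<^bsub>?R\<^esub> (counit C x2 \<odot>\<^bsub>?R\<^esub> counit H h))"
      using xh by (intro tsum_cong refl)
        (simp add: smult_regular_module lin counit_mult counit_nabla)
    also have "\<dots> = counit C x \<odot>\<^bsub>?R\<^esub> counit H h"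
      using xh by (intro C.counit_left_tsum) (simp_all add: lin carrier_regular_module)
    finally show ?thesis by (simp add: smult_regular_module)
  qed
  note * = linear_extension_gen[where P = ?R and f = "\<lambda>x h. counit C x \<otimes>\<^bsub>R\<^esub> counit H h"
      and f' = "\<lambda>(x, h). counit C x \<otimes>\<^bsub>R\<^esub> counit H h", OF _ bil st]
  show "linear_map R D ?R (counit D)"
    unfolding counit_D by (rule *(1)) (simp_all add: lin)
  show "counit D (gen x h) = counit C x \<otimes>\<^bsub>R\<^esub> counit H h" if "x \<in> carrier C" "h \<in> carrier H"
    unfolding counit_D using that by (intro *(2)) (simp_all add: lin)
qed

abbreviation DD where "DD \<equiv> tensor R D D"

text \<open>The comultiplication formula followed by the map that \<open>f\<close> induces; for
  \<open>f = pure_tensor R D D\<close> it is the prescription for \<open>comult D\<close>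
  itself.\<close>

definition gen_comult where
  "gen_comult P f x h = dC P x (\<lambda>x1 x2. co P x2 (\<lambda>g y. dH P h (\<lambda>h1 h2. f (gen x1 (g \<otimes>\<^bsub>H\<^esub> h1)) (gen y h2))))"

text \<open>The well-definedness of the comultiplication. Comultiplying \<open>\<nabla> x2\<close>
  spreads it over both tensor factors; \<open>coact_comult_nabla_stable\<close> removes it, and the
  stability required there is \<open>gen_absorb\<close> for the second generator. The argument
  \<open>b\<close> of \<open>?G\<close> is the place where the second leg of
  \<open>\<nabla> x2\<close> arrives.\<close>

lemma gen_comult_stable:
  assumes P: "module R P" and f: "bilinear_map R D D P f" and x: "x \<in> carrier C"
    and h: "h \<in> carrier H"
  shows "dC P x (\<lambda>x1 x2. gen_comult P f x1 (\<nabla> x2 \<otimes>\<^bsub>H\<^esub> h)) = gen_comult P f x h"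
proof -
  note [simp] = lin P h bilinear_map_use[OF f]
  let ?G = "\<lambda>x1 a y b. dH P h (\<lambda>h1 h2. f (gen x1 (a \<otimes>\<^bsub>H\<^esub> h1)) (gen y (b \<otimes>\<^bsub>H\<^esub> h2)))"
  have "dC P x (\<lambda>x1 x2. gen_comult P f x1 (\<nabla> x2 \<otimes>\<^bsub>H\<^esub> h))
    = dC P x (\<lambda>x1 x2. dC P x1 (\<lambda>a b. co P b (\<lambda>g y. dH P (\<nabla> x2) (\<lambda>n1 n2. ?G a (g \<otimes>\<^bsub>H\<^esub> n1) y n2))))"
    unfolding gen_comult_def
    by (rule tsum_cong[OF refl], rule tsum_cong[OF refl], rule tsum_cong[OF refl],
        subst comult_mult_tsum) (simp_all add: m_assoc cong: tsum_cong)
  also have "\<dots> = dC P x (\<lambda>a x'. dC P x' (\<lambda>b x2. co P b (\<lambda>g y. dH P (\<nabla> x2) (\<lambda>n1 n2. ?G a (g \<otimes>\<^bsub>H\<^esub> n1) y n2))))"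
    by (rule C.coassoc_tsum[OF P _ x]) simp
  also have "\<dots> = dC P x (\<lambda>a x'. co P x' (\<lambda>g y. ?G a g y \<one>\<^bsub>H\<^esub>))"
  proof (rule tsum_cong[OF refl], rule coact_comult_nabla_stable[OF P])
    fix x1 y a b assume [simp]: "x1 \<in> carrier C" "y \<in> carrier C" "a \<in> carrier H" "b \<in> carrier H"
    have "dC P y (\<lambda>y1 y2. ?G x1 a y1 (\<nabla> y2 \<otimes>\<^bsub>H\<^esub> b))
      = dH P h (\<lambda>h1 h2. dC P y (\<lambda>y1 y2. f (gen x1 (a \<otimes>\<^bsub>H\<^esub> h1)) (gen y1 (\<nabla> y2 \<otimes>\<^bsub>H\<^esub> (b \<otimes>\<^bsub>H\<^esub> h2)))))"
      by (subst tsum_swap) (simp_all add: m_assoc cong: tsum_cong)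
    also have "\<dots> = ?G x1 a y b"
      by (rule tsum_cong[OF refl], rule gen_absorb[OF P]) simp_all
    finally show "dC P y (\<lambda>y1 y2. ?G x1 a y1 (\<nabla> y2 \<otimes>\<^bsub>H\<^esub> b)) = ?G x1 a y b" .
  qed simp_all
  also have "\<dots> = gen_comult P f x h"
    unfolding gen_comult_def by (simp cong: tsum_cong)
  finally show ?thesis .
qed

lemma bilinear_gen_comult:
  assumes P: "module R P" and f: "bilinear_map R D D P f"
  shows "bilinear_map R C H P (gen_comult P f)"
  unfolding gen_comult_def by (simp add: lin P bilinear_map_use[OF f])

lemma comult_D:
  "comult D = linear_extension R D DD (carrier C \<times> carrier H) (\<lambda>(x, h). gen x h)
    (\<lambda>(x, h). sweedler R DD (comult C x) (\<lambda>x1 x2. sweedler R DD (coact x2) (\<lambda>g y.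
      sweedler R DD (comult H h) (\<lambda>h1 h2. pure_tensor R D D (gen x1 (g \<otimes>\<^bsub>H\<^esub> h1)) (gen y h2)))))"
proof -
  have "tensor R (cosmash_module R H C coact) (cosmash_module R H C coact) = DD"
    "pure_tensor R (cosmash_module R H C coact) (cosmash_module R H C coact) = pure_tensor R D D"
    by (intro tensor_cong_module; simp add: cosmash_sel cosmash_module_sel)+
  then show ?thesis
    by (simp add: cosmash_sel cosmash_comult_def Let_def linear_extension_def linear_map_def cosmash_module_sel)
qed

lemma comult_D_linear: "linear_map R D DD (comult D)"
  and comult_D_gen: "x \<in> carrier C \<Longrightarrow> h \<in> carrier H \<Longrightarrow>
    comult D (gen x h) = gen_comult DD (pure_tensor R D D) x h"
proof -
  have DD: "module R DD" and bil: "bilinear_map R D D DD (pure_tensor R D D)"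
    by (simp_all add: lin bilinear_pure_tensor)
  have eq: "sweedler R DD (comult C x) (\<lambda>x1 x2. sweedler R DD (coact x2) (\<lambda>g y.
      sweedler R DD (comult H h) (\<lambda>h1 h2. pure_tensor R D D (gen x1 (g \<otimes>\<^bsub>H\<^esub> h1)) (gen y h2))))
    = gen_comult DD (pure_tensor R D D) x h" if "x \<in> carrier C" "h \<in> carrier H" for x h
    unfolding gen_comult_def using that by (intro sweedler_eq_tsumI) (simp_all add: lin)
  note * = linear_extension_gen[OF DD bilinear_gen_comult[OF DD bil] gen_comult_stable[OF DD bil],
      where f' = "\<lambda>(x, h). sweedler R DD (comult C x) (\<lambda>x1 x2. sweedler R DD (coact x2) (\<lambda>g y.
      sweedler R DD (comult H h) (\<lambda>h1 h2. pure_tensor R D D (gen x1 (g \<otimes>\<^bsub>H\<^esub> h1)) (gen y h2))))"]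
  show "linear_map R D DD (comult D)"
    unfolding comult_D by (rule *(1)) (simp_all add: eq)
  show "comult D (gen x h) = gen_comult DD (pure_tensor R D D) x h"
    if "x \<in> carrier C" "h \<in> carrier H"
    unfolding comult_D using that by (intro *(2)) (simp_all add: eq)
qed

section \<open>Coassociativity and the counit laws\<close>

abbreviation dD where "dD P z f \<equiv> tsum R D D P (comult D z) f"

lemma comult_D_closed [lin]: "z \<in> carrier D \<Longrightarrow> comult D z \<in> carrier DD"
  by (rule linear_map_closed[OF comult_D_linear])

lemma linear_map_comult_D [lin]:
  "linear_map R M D g \<Longrightarrow> linear_map R M DD (\<lambda>x. comult D (g x))"
  by (rule linear_map_compose[OF comult_D_linear])

lemma counit_D_closed [lin]: "z \<in> carrier D \<Longrightarrow> counit D z \<in> carrier R"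
  using linear_map_closed[OF counit_D_linear] by (simp add: carrier_regular_module)

lemma linear_map_counit_D [lin]:
  "linear_map R M D g \<Longrightarrow> linear_map R M (regular_module R) (\<lambda>x. counit D (g x))"
  by (rule linear_map_compose[OF counit_D_linear])

lemma tsum_comult_D_gen:
  assumes P: "module R P" and f: "bilinear_map R D D P f" and x: "x \<in> carrier C"
    and h: "h \<in> carrier H"
  shows "dD P (gen x h) f
    = dC P x (\<lambda>x1 x2. co P x2 (\<lambda>g y. dH P h (\<lambda>h1 h2. f (gen x1 (g \<otimes>\<^bsub>H\<^esub> h1)) (gen y h2))))"
  using x h
  by (simp add: comult_D_gen gen_comult_def tsum_tsum tsum_pure lin P f bilinear_map_use[OF f] cong: tsum_cong)

text \<open>The left side needs only the Hopf algebra and coassociativity of \<open>C\<close>. On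
  the right side LPCC1 and LPCC3 unfold the nested coactions, and the factor
  \<open>\<nabla> b1\<close> that LPCC3 introduces is absorbed by the coaction to its left. Both
  sides end in the same expression.\<close>

lemma coassoc_D_gen:
  assumes P: "module R P" and f: "trilinear_map R D D D P f" and x: "x \<in> carrier C"
    and h: "h \<in> carrier H"
  shows "dD P (gen x h) (\<lambda>c1 c2. dD P c1 (\<lambda>a b. f a b c2)) = dD P (gen x h) (\<lambda>c1 c2. dD P c2 (f c1))"
proof -
  note [simp] = lin P h trilinear_map_use[OF f]
  \<comment> \<open>\<open>?U\<close> collects the three legs of \<open>h\<close>, which are
    distributed in the same way on both sides; only the arguments coming from \<open>x\<close> are
    rearranged afterwards.\<close>
  let ?U = "\<lambda>a p w q y. dH P h (\<lambda>h1 h'. dH P h' (\<lambda>h2 h3.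
    f (gen a (p \<otimes>\<^bsub>H\<^esub> h1)) (gen w (q \<otimes>\<^bsub>H\<^esub> h2)) (gen y h3)))"
  have "dD P (gen x h) (\<lambda>c1 c2. dD P c1 (\<lambda>a b. f a b c2))
    = dC P x (\<lambda>x1 x2. co P x2 (\<lambda>g y. dH P h (\<lambda>h' h3. dC P x1 (\<lambda>a b. co P b (\<lambda>k w.
        dH P (g \<otimes>\<^bsub>H\<^esub> h') (\<lambda>p q. f (gen a (k \<otimes>\<^bsub>H\<^esub> p)) (gen w q) (gen y h3)))))))"
    using x by (simp add: tsum_comult_D_gen cong: tsum_cong)
  also have "\<dots> = dC P x (\<lambda>x1 x2. co P x2 (\<lambda>g y. dC P x1 (\<lambda>a b. co P b (\<lambda>k w. dH P g (\<lambda>g1 g2.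
      ?U a (k \<otimes>\<^bsub>H\<^esub> g1) w g2 y)))))"
  proof (rule tsum_cong[OF refl], rule tsum_cong[OF refl])
    fix x1 x2 g y
    assume [simp]: "x1 \<in> carrier C" "x2 \<in> carrier C" "g \<in> carrier H" "y \<in> carrier C"
    have "dH P h (\<lambda>h' h3. dC P x1 (\<lambda>a b. co P b (\<lambda>k w.
        dH P (g \<otimes>\<^bsub>H\<^esub> h') (\<lambda>p q. f (gen a (k \<otimes>\<^bsub>H\<^esub> p)) (gen w q) (gen y h3)))))
      = dC P x1 (\<lambda>a b. dH P h (\<lambda>h' h3. co P b (\<lambda>k w.
        dH P (g \<otimes>\<^bsub>H\<^esub> h') (\<lambda>p q. f (gen a (k \<otimes>\<^bsub>H\<^esub> p)) (gen w q) (gen y h3)))))"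
      by (rule tsum_swap) simp_all
    also have "\<dots> = dC P x1 (\<lambda>a b. co P b (\<lambda>k w. dH P h (\<lambda>h' h3.
        dH P (g \<otimes>\<^bsub>H\<^esub> h') (\<lambda>p q. f (gen a (k \<otimes>\<^bsub>H\<^esub> p)) (gen w q) (gen y h3)))))"
      by (rule tsum_cong[OF refl], rule tsum_swap) simp_all
    also have "\<dots> = dC P x1 (\<lambda>a b. co P b (\<lambda>k w. dH P g (\<lambda>g1 g2. ?U a (k \<otimes>\<^bsub>H\<^esub> g1) w g2 y)))"
    proof (rule tsum_cong[OF refl], rule tsum_cong[OF refl])
      fix a b k w
      assume [simp]: "a \<in> carrier C" "b \<in> carrier C" "k \<in> carrier H" "w \<in> carrier C"
      have "dH P h (\<lambda>h' h3. dH P (g \<otimes>\<^bsub>H\<^esub> h') (\<lambda>p q. f (gen a (k \<otimes>\<^bsub>H\<^esub> p)) (gen w q) (gen y h3)))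
        = dH P h (\<lambda>h' h3. dH P g (\<lambda>g1 g2. dH P h' (\<lambda>h1 h2.
            f (gen a ((k \<otimes>\<^bsub>H\<^esub> g1) \<otimes>\<^bsub>H\<^esub> h1)) (gen w (g2 \<otimes>\<^bsub>H\<^esub> h2)) (gen y h3))))"
        by (rule tsum_cong[OF refl], subst comult_mult_tsum) (simp_all add: m_assoc cong: tsum_cong)
      also have "\<dots> = dH P g (\<lambda>g1 g2. dH P h (\<lambda>h' h3. dH P h' (\<lambda>h1 h2.
            f (gen a ((k \<otimes>\<^bsub>H\<^esub> g1) \<otimes>\<^bsub>H\<^esub> h1)) (gen w (g2 \<otimes>\<^bsub>H\<^esub> h2)) (gen y h3))))"
        by (rule tsum_swap) simp_all
      also have "\<dots> = dH P g (\<lambda>g1 g2. ?U a (k \<otimes>\<^bsub>H\<^esub> g1) w g2 y)"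
        by (rule tsum_cong[OF refl], rule H.coassoc_tsum[OF P]) simp_all
      finally show "dH P h (\<lambda>h' h3. dH P (g \<otimes>\<^bsub>H\<^esub> h') (\<lambda>p q.
          f (gen a (k \<otimes>\<^bsub>H\<^esub> p)) (gen w q) (gen y h3)))
        = dH P g (\<lambda>g1 g2. ?U a (k \<otimes>\<^bsub>H\<^esub> g1) w g2 y)" .
    qed
    finally show "dH P h (\<lambda>h' h3. dC P x1 (\<lambda>a b. co P b (\<lambda>k w.
        dH P (g \<otimes>\<^bsub>H\<^esub> h') (\<lambda>p q. f (gen a (k \<otimes>\<^bsub>H\<^esub> p)) (gen w q) (gen y h3)))))
      = dC P x1 (\<lambda>a b. co P b (\<lambda>k w. dH P g (\<lambda>g1 g2. ?U a (k \<otimes>\<^bsub>H\<^esub> g1) w g2 y)))" .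
  qed
  also have "\<dots> = dC P x (\<lambda>x1 x2. dC P x1 (\<lambda>a b. co P b (\<lambda>k w. co P x2 (\<lambda>g y. dH P g (\<lambda>g1 g2.
      ?U a (k \<otimes>\<^bsub>H\<^esub> g1) w g2 y)))))"
    by (rule tsum_cong[OF refl], subst tsum_swap[where K = C and L = C], simp_all,
        rule tsum_cong[OF refl], rule tsum_swap) simp_all
  also have "\<dots> = dC P x (\<lambda>a x'. dC P x' (\<lambda>b x2. co P b (\<lambda>k w. co P x2 (\<lambda>g y. dH P g (\<lambda>g1 g2.
      ?U a (k \<otimes>\<^bsub>H\<^esub> g1) w g2 y)))))"
    by (rule C.coassoc_tsum[OF P _ x]) simp
  finally have lhs: "dD P (gen x h) (\<lambda>c1 c2. dD P c1 (\<lambda>a b. f a b c2)) = \<dots>" .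
  have "dD P (gen x h) (\<lambda>c1 c2. dD P c2 (f c1))
    = dC P x (\<lambda>x1 x2. co P x2 (\<lambda>g y. dH P h (\<lambda>h1 h'. dC P y (\<lambda>y1 y2. co P y2 (\<lambda>k z.
        dH P h' (\<lambda>h2 h3. f (gen x1 (g \<otimes>\<^bsub>H\<^esub> h1)) (gen y1 (k \<otimes>\<^bsub>H\<^esub> h2)) (gen z h3)))))))"
    using x by (simp add: tsum_comult_D_gen cong: tsum_cong)
  also have "\<dots> = dC P x (\<lambda>x1 x2. co P x2 (\<lambda>g y. dC P y (\<lambda>y1 y2. co P y2 (\<lambda>k z. ?U x1 g y1 k z))))"
    by (rule tsum_cong[OF refl], rule tsum_cong[OF refl], subst tsum_swap[where K = C and L = C], simp_all,
        rule tsum_cong[OF refl], rule tsum_swap) simp_all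
  also have "\<dots> = dC P x (\<lambda>x1 x2. dC P x2 (\<lambda>a b. co P a (\<lambda>g y1. co P b (\<lambda>l z. dH P l (\<lambda>l1 l2.
      ?U x1 (g \<otimes>\<^bsub>H\<^esub> l1) y1 l2 z)))))"
  proof (rule tsum_cong[OF refl])
    fix x1 x2 assume [simp]: "x1 \<in> carrier C" "x2 \<in> carrier C"
    have "co P x2 (\<lambda>g y. dC P y (\<lambda>y1 y2. co P y2 (\<lambda>k z. ?U x1 g y1 k z)))
      = dC P x2 (\<lambda>a b. co P a (\<lambda>g y1. co P b (\<lambda>g' y2. co P y2 (\<lambda>k z. ?U x1 (g \<otimes>\<^bsub>H\<^esub> g') y1 k z))))"
      by (rule LPCC1_tsum[OF P, where f = "\<lambda>g y1 y2. co P y2 (\<lambda>k z. ?U x1 g y1 k z)"]) simp_all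
    also have "\<dots> = dC P x2 (\<lambda>a b. co P a (\<lambda>g y1. dC P b (\<lambda>b1 b2. co P b2 (\<lambda>l z. dH P l (\<lambda>l1 l2.
        ?U x1 (g \<otimes>\<^bsub>H\<^esub> (\<nabla> b1 \<otimes>\<^bsub>H\<^esub> l1)) y1 l2 z)))))"
      by (rule tsum_cong[OF refl], rule tsum_cong[OF refl], rule LPCC3_left_tsum[OF P,
          where f = "\<lambda>g' k z. ?U x1 (_ \<otimes>\<^bsub>H\<^esub> g') _ k z"]) simp_all
    also have "\<dots> = dC P x2 (\<lambda>a b. dC P b (\<lambda>b1 b2. co P a (\<lambda>g y1. co P b2 (\<lambda>l z. dH P l (\<lambda>l1 l2.
        ?U x1 ((g \<otimes>\<^bsub>H\<^esub> \<nabla> b1) \<otimes>\<^bsub>H\<^esub> l1) y1 l2 z)))))"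
      by (rule tsum_cong[OF refl], subst tsum_swap) (simp_all add: m_assoc cong: tsum_cong)
    \<comment> \<open>Regrouping gives \<open>a\<close> and \<open>b1\<close> a common parent, which
      is what \<open>nabla_absorb_right\<close> needs.\<close>
    also have "\<dots> = dC P x2 (\<lambda>b' b2. dC P b' (\<lambda>a b1. co P a (\<lambda>g y1. co P b2 (\<lambda>l z. dH P l (\<lambda>l1 l2.
        ?U x1 ((g \<otimes>\<^bsub>H\<^esub> \<nabla> b1) \<otimes>\<^bsub>H\<^esub> l1) y1 l2 z)))))"
      by (rule C.coassoc_tsum[OF P, symmetric]) simp_all
    also have "\<dots> = dC P x2 (\<lambda>a b. co P a (\<lambda>g y1. co P b (\<lambda>l z. dH P l (\<lambda>l1 l2.
        ?U x1 (g \<otimes>\<^bsub>H\<^esub> l1) y1 l2 z))))"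
      by (rule tsum_cong[OF refl], rule nabla_absorb_right[OF P, where f = "\<lambda>g y1. co P _ (\<lambda>l z.
          dH P l (\<lambda>l1 l2. ?U x1 (g \<otimes>\<^bsub>H\<^esub> l1) y1 l2 z))"]) simp_all
    finally show "co P x2 (\<lambda>g y. dC P y (\<lambda>y1 y2. co P y2 (\<lambda>k z. ?U x1 g y1 k z)))
      = dC P x2 (\<lambda>a b. co P a (\<lambda>g y1. co P b (\<lambda>l z. dH P l (\<lambda>l1 l2. ?U x1 (g \<otimes>\<^bsub>H\<^esub> l1) y1 l2 z))))" .
  qed
  finally show ?thesis using lhs by simp
qed

lemma coalgebra_D: "coalgebra R D"
proof (intro coalgebra.intro coalgebra_axioms.intro module_D comult_D_linear counit_D_linear)
  fix c assume c: "c \<in> carrier D"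
  let ?T3 = "tensor R D (tensor R D D)"
  let ?p = "\<lambda>a b d. pure_tensor R D (tensor R D D) a (pure_tensor R D D b d)"
  have "sweedler R ?T3 (comult D c) (\<lambda>c1 c2. sweedler R ?T3 (comult D c1) (\<lambda>a b. ?p a b c2))
    = dD ?T3 c (\<lambda>c1 c2. dD ?T3 c1 (\<lambda>a b. ?p a b c2))"
    using c by (intro sweedler_eq_tsumI) (simp_all add: lin)
  also have "\<dots> = dD ?T3 c (\<lambda>c1 c2. dD ?T3 c2 (\<lambda>a b. ?p c1 a b))"
    by (rule D_linear_eqI[where P = ?T3, OF _ _ _ _ c], simp_all add: lin, rule coassoc_D_gen)
      (simp_all add: lin)
  also have "\<dots> = sweedler R ?T3 (comult D c) (\<lambda>c1 c2. sweedler R ?T3 (comult D c2) (\<lambda>a b. ?p c1 a b))"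
    by (rule sym, intro sweedler_eq_tsumI) (simp_all add: lin c)
  finally show "sweedler R ?T3 (comult D c) (\<lambda>c1 c2. sweedler R ?T3 (comult D c1) (\<lambda>a b. ?p a b c2))
    = sweedler R ?T3 (comult D c) (\<lambda>c1 c2. sweedler R ?T3 (comult D c2) (\<lambda>a b. ?p c1 a b))" .
next
  fix c assume c: "c \<in> carrier D"
  interpret D: module R D by (rule module_D)
  \<comment> \<open>Reorders the three counits so that each sum, from the innermost outwards, finds
    its own scalar in front: \<open>h\<close> goes by the counit law of \<open>H\<close>,
    \<open>g\<close> by LPCC2, and \<open>x1\<close> by the counit law of \<open>C\<close>.\<close>
  have scal: "(a \<otimes>\<^bsub>R\<^esub> (b \<otimes>\<^bsub>R\<^esub> d)) \<odot>\<^bsub>D\<^esub> z = d \<odot>\<^bsub>D\<^esub> (b \<odot>\<^bsub>D\<^esub> (a \<odot>\<^bsub>D\<^esub> z))"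
    if "a \<in> carrier R" "b \<in> carrier R" "d \<in> carrier R" "z \<in> carrier D" for a b d z
    using that by (simp add: D.smult_assoc1[symmetric] R.m_ac)
  have "dD D (gen x h) (\<lambda>c1 c2. counit D c1 \<odot>\<^bsub>D\<^esub> c2) = gen x h"
    if [simp]: "x \<in> carrier C" "h \<in> carrier H" for x h
  proof -
    have "dD D (gen x h) (\<lambda>c1 c2. counit D c1 \<odot>\<^bsub>D\<^esub> c2)
      = dC D x (\<lambda>x1 x2. co D x2 (\<lambda>g y. dH D h (\<lambda>h1 h2.
          counit H h1 \<odot>\<^bsub>D\<^esub> (counit H g \<odot>\<^bsub>D\<^esub> (counit C x1 \<odot>\<^bsub>D\<^esub> gen y h2)))))"
      by (simp add: tsum_comult_D_gen lin counit_D_gen counit_mult scal cong: tsum_cong)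
    also have "\<dots> = dC D x (\<lambda>x1 x2. co D x2 (\<lambda>g y. counit H g \<odot>\<^bsub>D\<^esub> (counit C x1 \<odot>\<^bsub>D\<^esub> gen y h)))"
      by (rule tsum_cong[OF refl], rule tsum_cong[OF refl], rule H.counit_left_tsum)
        (simp_all add: lin)
    also have "\<dots> = dC D x (\<lambda>x1 x2. counit C x1 \<odot>\<^bsub>D\<^esub> gen x2 h)"
      by (rule tsum_cong[OF refl], rule LPCC2_tsum) (simp_all add: lin)
    also have "\<dots> = gen x h" by (rule C.counit_left_tsum) (simp_all add: lin)
    finally show ?thesis .
  qed
  note counit_gen = this
  have "sweedler R D (comult D c) (\<lambda>c1 c2. counit D c1 \<odot>\<^bsub>D\<^esub> c2) = dD D c (\<lambda>c1 c2. counit D c1 \<odot>\<^bsub>D\<^esub> c2)"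
    by (intro sweedler_eq_tsumI) (simp_all add: lin c)
  also have "\<dots> = c"
    by (rule D_linear_eqI[where P = D and f = "\<lambda>c. dD D c (\<lambda>c1 c2. counit D c1 \<odot>\<^bsub>D\<^esub> c2)" and g = "\<lambda>c. c", OF _ _ _ _ c])
      (simp_all add: lin counit_gen)
  finally show "sweedler R D (comult D c) (\<lambda>c1 c2. counit D c1 \<odot>\<^bsub>D\<^esub> c2) = c" .
next
  fix c assume c: "c \<in> carrier D"
  interpret D: module R D by (rule module_D)
  have "dD D (gen x h) (\<lambda>c1 c2. counit D c2 \<odot>\<^bsub>D\<^esub> c1) = gen x h"
    if [simp]: "x \<in> carrier C" "h \<in> carrier H" for x h
  proof -
    have scal: "(a \<otimes>\<^bsub>R\<^esub> b) \<odot>\<^bsub>D\<^esub> z = b \<odot>\<^bsub>D\<^esub> (a \<odot>\<^bsub>D\<^esub> z)"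
      if "a \<in> carrier R" "b \<in> carrier R" "z \<in> carrier D" for a b z
      using that by (simp add: D.smult_assoc1[symmetric] R.m_comm)
    have "dD D (gen x h) (\<lambda>c1 c2. counit D c2 \<odot>\<^bsub>D\<^esub> c1)
      = dC D x (\<lambda>x1 x2. co D x2 (\<lambda>g y. dH D h (\<lambda>h1 h2.
          counit H h2 \<odot>\<^bsub>D\<^esub> (counit C y \<odot>\<^bsub>D\<^esub> gen x1 (g \<otimes>\<^bsub>H\<^esub> h1)))))"
      by (simp add: tsum_comult_D_gen lin counit_D_gen counit_mult scal cong: tsum_cong)
    also have "\<dots> = dC D x (\<lambda>x1 x2. co D x2 (\<lambda>g y. counit C y \<odot>\<^bsub>D\<^esub> gen x1 (g \<otimes>\<^bsub>H\<^esub> h)))"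
      by (rule tsum_cong[OF refl], rule tsum_cong[OF refl], rule H.counit_right_tsum)
        (simp_all add: lin)
    \<comment> \<open>Unlike on the left, the counit of \<open>y\<close> does not remove the
      coaction but turns it into \<open>\<nabla> x2\<close>; the law then rests on
      \<open>gen_absorb\<close>.\<close>
    also have "\<dots> = dC D x (\<lambda>x1 x2. gen x1 (\<nabla> x2 \<otimes>\<^bsub>H\<^esub> h))"
      by (rule tsum_cong[OF refl], rule nabla_tsum) (simp_all add: lin)
    also have "\<dots> = gen x h" by (rule gen_absorb) (simp_all add: lin)
    finally show ?thesis .
  qed
  note counit_gen = this
  have "sweedler R D (comult D c) (\<lambda>c1 c2. counit D c2 \<odot>\<^bsub>D\<^esub> c1) = dD D c (\<lambda>c1 c2. counit D c2 \<odot>\<^bsub>D\<^esub> c1)"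
    by (intro sweedler_eq_tsumI) (simp_all add: lin c)
  also have "\<dots> = c"
    by (rule D_linear_eqI[where P = D and f = "\<lambda>c. dD D c (\<lambda>c1 c2. counit D c2 \<odot>\<^bsub>D\<^esub> c1)" and g = "\<lambda>c. c", OF _ _ _ _ c])
      (simp_all add: lin counit_gen)
  finally show "sweedler R D (comult D c) (\<lambda>c1 c2. counit D c2 \<odot>\<^bsub>D\<^esub> c1) = c" .
qed

section \<open>The corepresentation axioms on generators\<close>

abbreviation om ("\<omega>\<^sub>0") where "\<omega>\<^sub>0 \<equiv> omega0 R H C coact"

lemma omega0_closed [lin]: "z \<in> carrier D \<Longrightarrow> \<omega>\<^sub>0 z \<in> carrier H"
  by (rule linear_map_closed[OF omega0_linear])

lemma linear_map_omega0 [lin]: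
  "linear_map R M D g \<Longrightarrow> linear_map R M H (\<lambda>x. \<omega>\<^sub>0 (g x))"
  by (rule linear_map_compose[OF omega0_linear])

text \<open>As the antipode reverses products, S(h') stands right behind the second leg of
  \<open>h1\<close> and cancels it, so that \<open>h\<close> survives as a plain factor. Then
  \<open>\<nabla> x1\<close> is absorbed by the coaction on \<open>x2\<close>, and
  \<open>coact_comult_antipode_nabla\<close> finishes.\<close>

lemma omega0_comult_antipode_gen:
  assumes P: "module R P" and f: "bilinear_map R H H P f" and x: "x \<in> carrier C"
    and h: "h \<in> carrier H"
  shows "dD P (gen x h) (\<lambda>c1 c2. dH P (\<omega>\<^sub>0 c1) (\<lambda>g1 g2. f g1 (g2 \<otimes>\<^bsub>H\<^esub> antipode H (\<omega>\<^sub>0 c2))))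
    = co P x (\<lambda>g y. f (g \<otimes>\<^bsub>H\<^esub> h) (\<nabla> y))"
proof -
  note [simp] = lin P x h bilinear_map_use[OF f]
  let ?S = "antipode H"
  have "dD P (gen x h) (\<lambda>c1 c2. dH P (\<omega>\<^sub>0 c1) (\<lambda>g1 g2. f g1 (g2 \<otimes>\<^bsub>H\<^esub> ?S (\<omega>\<^sub>0 c2))))
    = dC P x (\<lambda>x1 x2. co P x2 (\<lambda>g y. dH P h (\<lambda>h1 h'. dH P ((\<nabla> x1 \<otimes>\<^bsub>H\<^esub> g) \<otimes>\<^bsub>H\<^esub> h1) (\<lambda>a b.
        f a (b \<otimes>\<^bsub>H\<^esub> (?S h' \<otimes>\<^bsub>H\<^esub> ?S (\<nabla> y)))))))"
    by (simp add: tsum_comult_D_gen omega0_gen antipode_mult m_assoc cong: tsum_cong)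
  also have "\<dots> = dC P x (\<lambda>x1 x2. co P x2 (\<lambda>g y. dH P (\<nabla> x1 \<otimes>\<^bsub>H\<^esub> g) (\<lambda>n1 n2.
        f (n1 \<otimes>\<^bsub>H\<^esub> h) (n2 \<otimes>\<^bsub>H\<^esub> ?S (\<nabla> y)))))"
  proof (rule tsum_cong[OF refl], rule tsum_cong[OF refl])
    fix x1 x2 g y
    assume [simp]: "x1 \<in> carrier C" "x2 \<in> carrier C" "g \<in> carrier H" "y \<in> carrier C"
    let ?n = "\<nabla> x1 \<otimes>\<^bsub>H\<^esub> g"
    have "dH P h (\<lambda>h1 h'. dH P (?n \<otimes>\<^bsub>H\<^esub> h1) (\<lambda>a b. f a (b \<otimes>\<^bsub>H\<^esub> (?S h' \<otimes>\<^bsub>H\<^esub> ?S (\<nabla> y)))))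
      = dH P h (\<lambda>h1 h'. dH P ?n (\<lambda>n1 n2. dH P h1 (\<lambda>k1 k2.
          f (n1 \<otimes>\<^bsub>H\<^esub> k1) (n2 \<otimes>\<^bsub>H\<^esub> ((k2 \<otimes>\<^bsub>H\<^esub> ?S h') \<otimes>\<^bsub>H\<^esub> ?S (\<nabla> y))))))"
      by (rule tsum_cong[OF refl], subst comult_mult_tsum) (simp_all add: m_assoc cong: tsum_cong)
    also have "\<dots> = dH P ?n (\<lambda>n1 n2. dH P h (\<lambda>h1 h'. dH P h1 (\<lambda>k1 k2.
          f (n1 \<otimes>\<^bsub>H\<^esub> k1) (n2 \<otimes>\<^bsub>H\<^esub> ((k2 \<otimes>\<^bsub>H\<^esub> ?S h') \<otimes>\<^bsub>H\<^esub> ?S (\<nabla> y))))))"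
      by (rule tsum_swap) simp_all
    also have "\<dots> = dH P ?n (\<lambda>n1 n2. dH P h (\<lambda>k1 h'. dH P h' (\<lambda>k2 h3.
          f (n1 \<otimes>\<^bsub>H\<^esub> k1) (n2 \<otimes>\<^bsub>H\<^esub> ((k2 \<otimes>\<^bsub>H\<^esub> ?S h3) \<otimes>\<^bsub>H\<^esub> ?S (\<nabla> y))))))"
      by (rule tsum_cong[OF refl], rule H.coassoc_tsum[OF P]) simp_all
    also have "\<dots> = dH P ?n (\<lambda>n1 n2. f (n1 \<otimes>\<^bsub>H\<^esub> h) (n2 \<otimes>\<^bsub>H\<^esub> (\<one>\<^bsub>H\<^esub> \<otimes>\<^bsub>H\<^esub> ?S (\<nabla> y))))"
      by (rule tsum_cong[OF refl], rule antipode_cancel_right[OF P,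
          where f = "\<lambda>a w. f (_ \<otimes>\<^bsub>H\<^esub> a) (_ \<otimes>\<^bsub>H\<^esub> (w \<otimes>\<^bsub>H\<^esub> ?S (\<nabla> y)))"]) simp_all
    also have "\<dots> = dH P ?n (\<lambda>n1 n2. f (n1 \<otimes>\<^bsub>H\<^esub> h) (n2 \<otimes>\<^bsub>H\<^esub> ?S (\<nabla> y)))"
      by (simp cong: tsum_cong)
    finally show "dH P h (\<lambda>h1 h'. dH P (?n \<otimes>\<^bsub>H\<^esub> h1) (\<lambda>a b. f a (b \<otimes>\<^bsub>H\<^esub> (?S h' \<otimes>\<^bsub>H\<^esub> ?S (\<nabla> y)))))
      = dH P ?n (\<lambda>n1 n2. f (n1 \<otimes>\<^bsub>H\<^esub> h) (n2 \<otimes>\<^bsub>H\<^esub> ?S (\<nabla> y)))" .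
  qed
  also have "\<dots> = co P x (\<lambda>g y. dH P g (\<lambda>n1 n2. f (n1 \<otimes>\<^bsub>H\<^esub> h) (n2 \<otimes>\<^bsub>H\<^esub> ?S (\<nabla> y))))"
    by (rule nabla_absorb_left[OF P _ x, where f = "\<lambda>g y. dH P g (\<lambda>n1 n2.
        f (n1 \<otimes>\<^bsub>H\<^esub> h) (n2 \<otimes>\<^bsub>H\<^esub> ?S (\<nabla> y)))"]) simp
  also have "\<dots> = co P x (\<lambda>g y. f (g \<otimes>\<^bsub>H\<^esub> h) (\<nabla> y))"
    by (rule coact_comult_antipode_nabla[OF P _ x, where f = "\<lambda>a b. f (a \<otimes>\<^bsub>H\<^esub> h) b"]) simp
  finally show ?thesis .
qed

text \<open>The last two legs of \<open>h\<close> cancel. Both \<open>\<nabla> y1\<close> and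
  \<open>\<nabla> x1\<close> are then absorbed by the coactions next to them, which leaves the
  iterated coaction of \<open>coact_coact_antipode_nabla\<close>.\<close>

lemma omega0_antipode_gen:
  assumes P: "module R P" and f: "bilinear_map R H H P f" and x: "x \<in> carrier C"
    and h: "h \<in> carrier H"
  shows "dD P (gen x h) (\<lambda>c1 c'. dD P c' (\<lambda>c2 c3. f (\<omega>\<^sub>0 c1) (\<omega>\<^sub>0 c2 \<otimes>\<^bsub>H\<^esub> antipode H (\<omega>\<^sub>0 c3))))
    = co P x (\<lambda>g y. f (g \<otimes>\<^bsub>H\<^esub> h) (\<nabla> y))"
proof -
  note [simp] = lin P x h bilinear_map_use[OF f]
  let ?S = "antipode H"
  have "dD P (gen x h) (\<lambda>c1 c'. dD P c' (\<lambda>c2 c3. f (\<omega>\<^sub>0 c1) (\<omega>\<^sub>0 c2 \<otimes>\<^bsub>H\<^esub> ?S (\<omega>\<^sub>0 c3))))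
    = dC P x (\<lambda>x1 x2. co P x2 (\<lambda>g y. dH P h (\<lambda>h1 h'. dC P y (\<lambda>y1 y2. co P y2 (\<lambda>k z. dH P h' (\<lambda>h2 h3.
        f ((\<nabla> x1 \<otimes>\<^bsub>H\<^esub> g) \<otimes>\<^bsub>H\<^esub> h1) ((\<nabla> y1 \<otimes>\<^bsub>H\<^esub> k) \<otimes>\<^bsub>H\<^esub> ((h2 \<otimes>\<^bsub>H\<^esub> ?S h3) \<otimes>\<^bsub>H\<^esub> ?S (\<nabla> z)))))))))"
    by (simp add: tsum_comult_D_gen omega0_gen antipode_mult m_assoc cong: tsum_cong)
  also have "\<dots> = dC P x (\<lambda>x1 x2. co P x2 (\<lambda>g y. dC P y (\<lambda>y1 y2. co P y2 (\<lambda>k z. dH P h (\<lambda>h1 h'. dH P h' (\<lambda>h2 h3.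
        f ((\<nabla> x1 \<otimes>\<^bsub>H\<^esub> g) \<otimes>\<^bsub>H\<^esub> h1) ((\<nabla> y1 \<otimes>\<^bsub>H\<^esub> k) \<otimes>\<^bsub>H\<^esub> ((h2 \<otimes>\<^bsub>H\<^esub> ?S h3) \<otimes>\<^bsub>H\<^esub> ?S (\<nabla> z)))))))))"
    by (rule tsum_cong[OF refl], rule tsum_cong[OF refl], subst tsum_swap[where K = C and L = C], simp_all,
        rule tsum_cong[OF refl], rule tsum_swap) simp_all
  also have "\<dots> = dC P x (\<lambda>x1 x2. co P x2 (\<lambda>g y. dC P y (\<lambda>y1 y2. co P y2 (\<lambda>k z.
        f ((\<nabla> x1 \<otimes>\<^bsub>H\<^esub> g) \<otimes>\<^bsub>H\<^esub> h) ((\<nabla> y1 \<otimes>\<^bsub>H\<^esub> k) \<otimes>\<^bsub>H\<^esub> (\<one>\<^bsub>H\<^esub> \<otimes>\<^bsub>H\<^esub> ?S (\<nabla> z)))))))"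
    by ((rule tsum_cong[OF refl])+, rule antipode_cancel_right[OF P,
        where f = "\<lambda>a w. f (_ \<otimes>\<^bsub>H\<^esub> a) (_ \<otimes>\<^bsub>H\<^esub> (w \<otimes>\<^bsub>H\<^esub> _))"]) simp_all
  also have "\<dots> = dC P x (\<lambda>x1 x2. co P x2 (\<lambda>g y. dC P y (\<lambda>y1 y2. co P y2 (\<lambda>k z.
        f ((\<nabla> x1 \<otimes>\<^bsub>H\<^esub> g) \<otimes>\<^bsub>H\<^esub> h) ((\<nabla> y1 \<otimes>\<^bsub>H\<^esub> k) \<otimes>\<^bsub>H\<^esub> ?S (\<nabla> z))))))"
    by (simp cong: tsum_cong)
  also have "\<dots> = dC P x (\<lambda>x1 x2. co P x2 (\<lambda>g y. co P y (\<lambda>k z.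
        f ((\<nabla> x1 \<otimes>\<^bsub>H\<^esub> g) \<otimes>\<^bsub>H\<^esub> h) (k \<otimes>\<^bsub>H\<^esub> ?S (\<nabla> z)))))"
    by (rule tsum_cong[OF refl], rule tsum_cong[OF refl], rule nabla_absorb_left[OF P,
        where f = "\<lambda>k z. f _ (k \<otimes>\<^bsub>H\<^esub> ?S (\<nabla> z))"]) simp_all
  also have "\<dots> = co P x (\<lambda>g y. co P y (\<lambda>k z. f (g \<otimes>\<^bsub>H\<^esub> h) (k \<otimes>\<^bsub>H\<^esub> ?S (\<nabla> z))))"
    by (rule nabla_absorb_left[OF P _ x, where f = "\<lambda>g y. co P y (\<lambda>k z.
        f (g \<otimes>\<^bsub>H\<^esub> h) (k \<otimes>\<^bsub>H\<^esub> ?S (\<nabla> z)))"]) simp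
  also have "\<dots> = co P x (\<lambda>g y. f (g \<otimes>\<^bsub>H\<^esub> h) (\<nabla> y))"
    by (rule coact_coact_antipode_nabla[OF P _ x, where f = "\<lambda>a b. f (a \<otimes>\<^bsub>H\<^esub> h) b"]) simp
  finally show ?thesis .
qed

text \<open>Now the first two legs of \<open>h\<close> cancel, and the third survives in the second
  tensor factor. After absorbing \<open>\<nabla> x1\<close> the claim is
  \<open>coact_antipode_comult_nabla\<close>.\<close>

lemma omega0_antipode_comult_gen:
  assumes P: "module R P" and f: "bilinear_map R H H P f" and x: "x \<in> carrier C"
    and h: "h \<in> carrier H"
  shows "dD P (gen x h) (\<lambda>c1 c2. dH P (\<omega>\<^sub>0 c2) (\<lambda>g1 g2. f (\<omega>\<^sub>0 c1 \<otimes>\<^bsub>H\<^esub> antipode H g1) g2))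
    = dC P x (\<lambda>a b. f (\<nabla> a) (\<nabla> b \<otimes>\<^bsub>H\<^esub> h))"
proof -
  note [simp] = lin P x h bilinear_map_use[OF f]
  let ?S = "antipode H"
  have "dD P (gen x h) (\<lambda>c1 c2. dH P (\<omega>\<^sub>0 c2) (\<lambda>g1 g2. f (\<omega>\<^sub>0 c1 \<otimes>\<^bsub>H\<^esub> ?S g1) g2))
    = dC P x (\<lambda>x1 x2. co P x2 (\<lambda>g y. dH P h (\<lambda>h1 h'. dH P (\<nabla> y \<otimes>\<^bsub>H\<^esub> h') (\<lambda>a b.
        f ((\<nabla> x1 \<otimes>\<^bsub>H\<^esub> g) \<otimes>\<^bsub>H\<^esub> (h1 \<otimes>\<^bsub>H\<^esub> ?S a)) b))))"
    by (simp add: tsum_comult_D_gen omega0_gen m_assoc cong: tsum_cong)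
  also have "\<dots> = dC P x (\<lambda>x1 x2. co P x2 (\<lambda>g y. dH P (\<nabla> y) (\<lambda>n1 n2.
        f ((\<nabla> x1 \<otimes>\<^bsub>H\<^esub> g) \<otimes>\<^bsub>H\<^esub> ?S n1) (n2 \<otimes>\<^bsub>H\<^esub> h))))"
  proof (rule tsum_cong[OF refl], rule tsum_cong[OF refl])
    fix x1 x2 g y
    assume [simp]: "x1 \<in> carrier C" "x2 \<in> carrier C" "g \<in> carrier H" "y \<in> carrier C"
    let ?n = "\<nabla> x1 \<otimes>\<^bsub>H\<^esub> g"
    have "dH P h (\<lambda>h1 h'. dH P (\<nabla> y \<otimes>\<^bsub>H\<^esub> h') (\<lambda>a b. f (?n \<otimes>\<^bsub>H\<^esub> (h1 \<otimes>\<^bsub>H\<^esub> ?S a)) b))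
      = dH P h (\<lambda>h1 h'. dH P (\<nabla> y) (\<lambda>n1 n2. dH P h' (\<lambda>h2 h3.
          f (?n \<otimes>\<^bsub>H\<^esub> ((h1 \<otimes>\<^bsub>H\<^esub> ?S h2) \<otimes>\<^bsub>H\<^esub> ?S n1)) (n2 \<otimes>\<^bsub>H\<^esub> h3))))"
      by (rule tsum_cong[OF refl], subst comult_mult_tsum)
        (simp_all add: m_assoc antipode_mult cong: tsum_cong)
    also have "\<dots> = dH P (\<nabla> y) (\<lambda>n1 n2. dH P h (\<lambda>h1 h'. dH P h' (\<lambda>h2 h3.
          f (?n \<otimes>\<^bsub>H\<^esub> ((h1 \<otimes>\<^bsub>H\<^esub> ?S h2) \<otimes>\<^bsub>H\<^esub> ?S n1)) (n2 \<otimes>\<^bsub>H\<^esub> h3))))"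
      by (rule tsum_swap) simp_all
    also have "\<dots> = dH P (\<nabla> y) (\<lambda>n1 n2. f (?n \<otimes>\<^bsub>H\<^esub> (\<one>\<^bsub>H\<^esub> \<otimes>\<^bsub>H\<^esub> ?S n1)) (n2 \<otimes>\<^bsub>H\<^esub> h))"
      by (rule tsum_cong[OF refl], rule antipode_cancel_left[OF P,
          where f = "\<lambda>w b. f (?n \<otimes>\<^bsub>H\<^esub> (w \<otimes>\<^bsub>H\<^esub> _)) (_ \<otimes>\<^bsub>H\<^esub> b)"]) simp_all
    also have "\<dots> = dH P (\<nabla> y) (\<lambda>n1 n2. f (?n \<otimes>\<^bsub>H\<^esub> ?S n1) (n2 \<otimes>\<^bsub>H\<^esub> h))"
      by (simp cong: tsum_cong)
    finally show "dH P h (\<lambda>h1 h'. dH P (\<nabla> y \<otimes>\<^bsub>H\<^esub> h') (\<lambda>a b. f (?n \<otimes>\<^bsub>H\<^esub> (h1 \<otimes>\<^bsub>H\<^esub> ?S a)) b))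
      = dH P (\<nabla> y) (\<lambda>n1 n2. f (?n \<otimes>\<^bsub>H\<^esub> ?S n1) (n2 \<otimes>\<^bsub>H\<^esub> h))" .
  qed
  also have "\<dots> = co P x (\<lambda>g y. dH P (\<nabla> y) (\<lambda>n1 n2. f (g \<otimes>\<^bsub>H\<^esub> ?S n1) (n2 \<otimes>\<^bsub>H\<^esub> h)))"
    by (rule nabla_absorb_left[OF P _ x, where f = "\<lambda>g y. dH P (\<nabla> y) (\<lambda>n1 n2.
        f (g \<otimes>\<^bsub>H\<^esub> ?S n1) (n2 \<otimes>\<^bsub>H\<^esub> h))"]) simp
  also have "\<dots> = dC P x (\<lambda>a b. f (\<nabla> a) (\<nabla> b \<otimes>\<^bsub>H\<^esub> h))"
    by (rule coact_antipode_comult_nabla[OF P _ x, where f = "\<lambda>a b. f a (b \<otimes>\<^bsub>H\<^esub> h)"]) simp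
  finally show ?thesis .
qed

text \<open>Cancelling the first two legs of \<open>h\<close> and absorbing both nablas reduces the
  claim to \<open>coact_antipode_coact_nabla\<close>.\<close>

lemma antipode_omega0_gen:
  assumes P: "module R P" and f: "bilinear_map R H H P f" and x: "x \<in> carrier C"
    and h: "h \<in> carrier H"
  shows "dD P (gen x h) (\<lambda>c1 c'. dD P c' (\<lambda>c2 c3. f (\<omega>\<^sub>0 c1 \<otimes>\<^bsub>H\<^esub> antipode H (\<omega>\<^sub>0 c2)) (\<omega>\<^sub>0 c3)))
    = dC P x (\<lambda>a b. f (\<nabla> a) (\<nabla> b \<otimes>\<^bsub>H\<^esub> h))"
proof -
  note [simp] = lin P x h bilinear_map_use[OF f]
  let ?S = "antipode H"
  have "dD P (gen x h) (\<lambda>c1 c'. dD P c' (\<lambda>c2 c3. f (\<omega>\<^sub>0 c1 \<otimes>\<^bsub>H\<^esub> ?S (\<omega>\<^sub>0 c2)) (\<omega>\<^sub>0 c3)))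
    = dC P x (\<lambda>x1 x2. co P x2 (\<lambda>g y. dH P h (\<lambda>h1 h'. dC P y (\<lambda>y1 y2. co P y2 (\<lambda>k z. dH P h' (\<lambda>h2 h3.
        f ((\<nabla> x1 \<otimes>\<^bsub>H\<^esub> g) \<otimes>\<^bsub>H\<^esub> ((h1 \<otimes>\<^bsub>H\<^esub> ?S h2) \<otimes>\<^bsub>H\<^esub> ?S (\<nabla> y1 \<otimes>\<^bsub>H\<^esub> k))) (\<nabla> z \<otimes>\<^bsub>H\<^esub> h3)))))))"
    by (simp add: tsum_comult_D_gen omega0_gen antipode_mult m_assoc cong: tsum_cong)
  also have "\<dots> = dC P x (\<lambda>x1 x2. co P x2 (\<lambda>g y. dC P y (\<lambda>y1 y2. co P y2 (\<lambda>k z. dH P h (\<lambda>h1 h'. dH P h' (\<lambda>h2 h3.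
        f ((\<nabla> x1 \<otimes>\<^bsub>H\<^esub> g) \<otimes>\<^bsub>H\<^esub> ((h1 \<otimes>\<^bsub>H\<^esub> ?S h2) \<otimes>\<^bsub>H\<^esub> ?S (\<nabla> y1 \<otimes>\<^bsub>H\<^esub> k))) (\<nabla> z \<otimes>\<^bsub>H\<^esub> h3)))))))"
    by (rule tsum_cong[OF refl], rule tsum_cong[OF refl], subst tsum_swap[where K = C and L = C], simp_all,
        rule tsum_cong[OF refl], rule tsum_swap) simp_all
  also have "\<dots> = dC P x (\<lambda>x1 x2. co P x2 (\<lambda>g y. dC P y (\<lambda>y1 y2. co P y2 (\<lambda>k z.
        f ((\<nabla> x1 \<otimes>\<^bsub>H\<^esub> g) \<otimes>\<^bsub>H\<^esub> (\<one>\<^bsub>H\<^esub> \<otimes>\<^bsub>H\<^esub> ?S (\<nabla> y1 \<otimes>\<^bsub>H\<^esub> k))) (\<nabla> z \<otimes>\<^bsub>H\<^esub> h)))))"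
    by ((rule tsum_cong[OF refl])+, rule antipode_cancel_left[OF P,
        where f = "\<lambda>w b. f (_ \<otimes>\<^bsub>H\<^esub> (w \<otimes>\<^bsub>H\<^esub> _)) (_ \<otimes>\<^bsub>H\<^esub> b)"]) simp_all
  also have "\<dots> = dC P x (\<lambda>x1 x2. co P x2 (\<lambda>g y. dC P y (\<lambda>y1 y2. co P y2 (\<lambda>k z.
        f ((\<nabla> x1 \<otimes>\<^bsub>H\<^esub> g) \<otimes>\<^bsub>H\<^esub> ?S (\<nabla> y1 \<otimes>\<^bsub>H\<^esub> k)) (\<nabla> z \<otimes>\<^bsub>H\<^esub> h)))))"
    by (simp cong: tsum_cong)
  \<comment> \<open>The antipode of \<open>\<nabla> y1 \<otimes> k\<close> was left unexpanded so
    that absorption can act inside it.\<close>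
  also have "\<dots> = dC P x (\<lambda>x1 x2. co P x2 (\<lambda>g y. co P y (\<lambda>k z.
        f ((\<nabla> x1 \<otimes>\<^bsub>H\<^esub> g) \<otimes>\<^bsub>H\<^esub> ?S k) (\<nabla> z \<otimes>\<^bsub>H\<^esub> h))))"
    by (rule tsum_cong[OF refl], rule tsum_cong[OF refl], rule nabla_absorb_left[OF P,
        where f = "\<lambda>k z. f (_ \<otimes>\<^bsub>H\<^esub> ?S k) (\<nabla> z \<otimes>\<^bsub>H\<^esub> h)"]) simp_all
  also have "\<dots> = co P x (\<lambda>g y. co P y (\<lambda>k z. f (g \<otimes>\<^bsub>H\<^esub> ?S k) (\<nabla> z \<otimes>\<^bsub>H\<^esub> h)))"
    by (rule nabla_absorb_left[OF P _ x, where f = "\<lambda>g y. co P y (\<lambda>k z.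
        f (g \<otimes>\<^bsub>H\<^esub> ?S k) (\<nabla> z \<otimes>\<^bsub>H\<^esub> h))"]) simp
  also have "\<dots> = dC P x (\<lambda>a b. f (\<nabla> a) (\<nabla> b \<otimes>\<^bsub>H\<^esub> h))"
    by (rule coact_antipode_coact_nabla[OF P _ x, where f = "\<lambda>a b. f a (b \<otimes>\<^bsub>H\<^esub> h)"]) simp
  finally show ?thesis .
qed

lemma partial_corepresentation_omega0: "partial_corepresentation R H D \<omega>\<^sub>0"
proof (intro partial_corepresentation.intro partial_corepresentation_axioms.intro
    coalgebra_D omega0_linear)
  show "hopf_algebra R H" by (rule H.hopf_algebra_axioms)
  let ?HH = "tensor R H H" and ?S = "antipode H"
  have HH: "module R ?HH" by (simp add: lin)
  have bil: "bilinear_map R H H ?HH (pure_tensor R H H)" by (simp add: lin)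
  fix c assume c: "c \<in> carrier D"
  show "counit H (\<omega>\<^sub>0 c) = counit D c"
    by (rule D_linear_eqI[where P = "regular_module R", OF _ _ _ _ c])
      (simp_all add: lin omega0_gen counit_D_gen counit_mult counit_nabla)
  have "sweedler R ?HH (comult D c) (\<lambda>c1 c2. sweedler R ?HH (comult H (\<omega>\<^sub>0 c1)) (\<lambda>g1 g2.
      pure_tensor R H H g1 (g2 \<otimes>\<^bsub>H\<^esub> ?S (\<omega>\<^sub>0 c2))))
    = dD ?HH c (\<lambda>c1 c2. dH ?HH (\<omega>\<^sub>0 c1) (\<lambda>g1 g2. pure_tensor R H H g1 (g2 \<otimes>\<^bsub>H\<^esub> ?S (\<omega>\<^sub>0 c2))))"
    by (intro sweedler_eq_tsumI) (simp_all add: lin c)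
  also have "\<dots> = dD ?HH c (\<lambda>c1 c'. dD ?HH c' (\<lambda>c2 c3.
      pure_tensor R H H (\<omega>\<^sub>0 c1) (\<omega>\<^sub>0 c2 \<otimes>\<^bsub>H\<^esub> ?S (\<omega>\<^sub>0 c3))))"
    by (rule D_linear_eqI[where P = ?HH, OF _ _ _ _ c])
      (simp_all add: lin omega0_comult_antipode_gen[OF HH bil] omega0_antipode_gen[OF HH bil])
  also have "\<dots> = sweedler R ?HH (comult D c) (\<lambda>c1 c'. sweedler R ?HH (comult D c') (\<lambda>c2 c3.
      pure_tensor R H H (\<omega>\<^sub>0 c1) (\<omega>\<^sub>0 c2 \<otimes>\<^bsub>H\<^esub> ?S (\<omega>\<^sub>0 c3))))"
    by (rule sym, intro sweedler_eq_tsumI) (simp_all add: lin c)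
  finally show "sweedler R ?HH (comult D c) (\<lambda>c1 c2. sweedler R ?HH (comult H (\<omega>\<^sub>0 c1)) (\<lambda>g1 g2.
      pure_tensor R H H g1 (g2 \<otimes>\<^bsub>H\<^esub> ?S (\<omega>\<^sub>0 c2))))
    = sweedler R ?HH (comult D c) (\<lambda>c1 c'. sweedler R ?HH (comult D c') (\<lambda>c2 c3.
      pure_tensor R H H (\<omega>\<^sub>0 c1) (\<omega>\<^sub>0 c2 \<otimes>\<^bsub>H\<^esub> ?S (\<omega>\<^sub>0 c3))))" .
  have "sweedler R ?HH (comult D c) (\<lambda>c1 c2. sweedler R ?HH (comult H (\<omega>\<^sub>0 c2)) (\<lambda>g1 g2.
      pure_tensor R H H (\<omega>\<^sub>0 c1 \<otimes>\<^bsub>H\<^esub> ?S g1) g2))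
    = dD ?HH c (\<lambda>c1 c2. dH ?HH (\<omega>\<^sub>0 c2) (\<lambda>g1 g2. pure_tensor R H H (\<omega>\<^sub>0 c1 \<otimes>\<^bsub>H\<^esub> ?S g1) g2))"
    by (intro sweedler_eq_tsumI) (simp_all add: lin c)
  also have "\<dots> = dD ?HH c (\<lambda>c1 c'. dD ?HH c' (\<lambda>c2 c3.
      pure_tensor R H H (\<omega>\<^sub>0 c1 \<otimes>\<^bsub>H\<^esub> ?S (\<omega>\<^sub>0 c2)) (\<omega>\<^sub>0 c3)))"
    by (rule D_linear_eqI[where P = ?HH, OF _ _ _ _ c])
      (simp_all add: lin omega0_antipode_comult_gen[OF HH bil] antipode_omega0_gen[OF HH bil])
  also have "\<dots> = sweedler R ?HH (comult D c) (\<lambda>c1 c'. sweedler R ?HH (comult D c') (\<lambda>c2 c3.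
      pure_tensor R H H (\<omega>\<^sub>0 c1 \<otimes>\<^bsub>H\<^esub> ?S (\<omega>\<^sub>0 c2)) (\<omega>\<^sub>0 c3)))"
    by (rule sym, intro sweedler_eq_tsumI) (simp_all add: lin c)
  finally show "sweedler R ?HH (comult D c) (\<lambda>c1 c2. sweedler R ?HH (comult H (\<omega>\<^sub>0 c2)) (\<lambda>g1 g2.
      pure_tensor R H H (\<omega>\<^sub>0 c1 \<otimes>\<^bsub>H\<^esub> ?S g1) g2))
    = sweedler R ?HH (comult D c) (\<lambda>c1 c'. sweedler R ?HH (comult D c') (\<lambda>c2 c3.
      pure_tensor R H H (\<omega>\<^sub>0 c1 \<otimes>\<^bsub>H\<^esub> ?S (\<omega>\<^sub>0 c2)) (\<omega>\<^sub>0 c3)))" .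
qed

end

theorem proposition4p8:
  fixes R :: "('k, 'r) ring_scheme"
    and H :: "('k, 'h, 'm) hopf_scheme"
    and C :: "('k, 'c, 'n) coalg_scheme"
    and coact :: "'c \<Rightarrow> ('k, 'h, 'c) tensor"
  assumes "cring R"
    and "hopf_algebra R H"
    and "coalgebra R C"
    and "left_partial_comodule_coalgebra R H C coact"
  shows "(\<forall>x\<in>carrier C. \<forall>h\<in>carrier H.
            omega0 R H C coact (cosmash_gen R H C coact x h) = nabla R H C coact x \<otimes>\<^bsub>H\<^esub> h)
         \<and> partial_corepresentation R H (cosmash R H C coact) (omega0 R H C coact)"
proof -
  interpret left_partial_comodule_coalgebra R H C coact by fact
  show ?thesis using omega0_gen partial_corepresentation_omega0 by blast
qed

end
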